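(* Let $F$ be a field and let $\mathfrak g=\langle x\rangle\ltimes\mathfrak a$ be a Lie algebra over $F$, where $\mathrm{ad}\,x$ acts diagonalizably on the abelian Lie algebra $\mathfrak a$. Set $\mathfrak n=[\mathfrak g,\mathfrak g]$, which is the sum of all eigenspaces of $\mathrm{ad}\,x$ in $\mathfrak a$ with non-zero eigenvalue, and let $\mathfrak a_0$ be the $0$-eigenspace of $\mathrm{ad}\,x$ in $\mathfrak a$. Suppose that $F$ is an infinite perfect field or $\mathfrak a_0=0$, and let $U$ be a linked $\mathfrak g$-module of nilpotency length $m>1$, with nilpotency series $0=U^{(0)}\subset U^{(1)}\subset\cdots\subset U^{(m)}=U$. Then there is $y\in(\langle x\rangle\oplus\mathfrak a_0)\setminus\mathfrak a_0$ such that the following hold. (1) All the nilpotency factors $U^{(1)}/U^{(0)},\dots,U^{(m)}/U^{(m-1)}$ are uniserial $F[X]$-modules via the action of $y$ (i.e. $X$ acts as $y$); and if $p_1,\dots,p_m\in F[X]$ are the monic irreducible polynomials whose powers $p_1^{s_1},\dots,p_m^{s_m}$ satisfy $$U^{(i)}/U^{(i-1)}\cong F[X]/(p_i^{s_i}),\qquad 1\le i\le m,$$ as $F[X]$-modules via $y$, then $p_1,\dots,p_m$ have common degree $d$, are related by $p_i(X)=p_1(X+i-1)$ for $1\le i\le m$, and $s_1\ge\cdots\ge s_m$. Assume from now on that, if $F$ has prime characteristic $p$, then $p\ge m$ and the stabilizer of $p_1$ under the action of the additive group $F^+$ on $F[X]$ given by $g^{\sigma(\gamma)}(X)=g(X+\gamma)$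 is trivial. (2) For $\delta\in F$ let $\mathfrak a(\delta)=\{u\in\mathfrak a\mid[y,u]=\delta u\}$ and set $S=\{\delta\in F\mid\mathfrak a(\delta)U\ne 0\}$. Then $1\in S$ and every $j\in S$ is (the image in $F$ of) an integer satisfying $0\le j<m$. (3) There is a basis of $U$ such that: $\bullet$ $y$ is represented by the matrix $\mathbf A$ defined in the context. $\bullet$ There is $v\in\mathfrak n$ such that $v\ne0$, $[y,v]=v$ and $v$ is represented by the matrix $\mathbf T$ defined in the context. $\bullet$ Corresponding to every integer $j$ with $0\le j<m$ there is a linear map $g^j:\mathfrak a(j)\to F[X]_{ds_{j+1}}$, $u\mapsto g^j_u$, such that $g^1_v=1$ and every $u\in\mathfrak a(j)$ is represented by $\mathbf T^jg^j_u(\mathbf E)$, with $\mathbf E$ the matrix defined in the context. In particular, the image of $\mathfrak g$ in $\mathfrak{gl}(t)$, where $t=d(s_1+\cdots+s_m)$, is $$\langle\mathbf A\rangle\ltimes(\mathcal E_0\oplus\mathcal E_1\mathbf T\oplus\cdots\oplus\mathcal E_{m-1}\mathbf T^{m-1}),\qquad \mathcal E_j=\{g^j_u(\mathbf E)\mid u\in\mathfrak a(j)\},\quad 0\le j<m.$$ (4) $U$ is uniserial if and only if $s_1=\cdots=s_m=1$, in which case $y$ must act semisimply on $U$, and hence so does $x$ if $\mathfrak a_0=0$ or $d=1$.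
   Context: All vector spaces, Lie algebras and modules are finite dimensional over $F$ (polynomial algebras excepted). For $n\ge 0$, $F[X]_n=\{a_0+a_1X+\cdots+a_{n-1}X^{n-1}\mid a_i\in F\}$. Linked modules: let $\mathfrak g$ be a Lie algebra with solvable radical $\mathfrak r$ and put $\mathfrak n=[\mathfrak g,\mathfrak r]$ (so $\mathfrak n=[\mathfrak g,\mathfrak g]$ if $\mathfrak g$ is solvable). A $\mathfrak g$-module $U$ is admissible if it is non-zero and $\mathfrak n$ acts on $U$ by nilpotent operators. The nilpotency series $0=U^{(0)}\subset U^{(1)}\subset\cdots\subset U^{(m)}=U$ of an admissible module is defined so that $U^{(i)}/U^{(i-1)}=\{w\in U/U^{(i-1)}\mid \mathfrak n w=0\}$, each inclusion being strict; $m$ is the nilpotency length and the quotients $U^{(i)}/U^{(i-1)}$ are the nilpotency factors, which are $\mathfrak g/\mathfrak n$-modules. A module is uniserial if it is non-zero and its submodules form a chain. $U$ is linked if it is admissible and every nilpotency factor is uniserial as a $\mathfrak g/\mathfrak n$-module. Matrices: for a monic $f=f_0+f_1X+\cdots+f_{n-1}X^{n-1}+X^n\in F[X]$, its companion matrix $C_f\in M_n(F)$ has ones on the first subdiagonal, last column $(-f_0,-f_1,\dots,-f_{n-1})^{t}$, and zeros elsewhere. Let $C_i=C_{p_i^{s_i}}\in M_{ds_i}(F)$. Then $\mathbf A$ is the block diagonal matrix with diagonal blocks $C_1,C_2,\dots,C_m$; $\mathbf E$ is the block diagonal matrix with diagonal blocks $C_1,\,C_2+I,\dots,C_m+(m-1)I$;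 and $\mathbf T$ is the block matrix (with the same block sizes) whose block in position $(i-1,i)$ is $B_i\in M_{ds_{i-1},ds_i}(F)$ for $2\le i\le m$ and whose other blocks are $0$, where the $(a,b)$ entry of $B_i$ is the coefficient of $X^{a-1}$ in $(X-1)^{b-1}p_{i-1}(X)^{s_{i-1}-s_i}$. *)

theory Defs
  imports
    "HOL-Computational_Algebra.Polynomial"
    "Jordan_Normal_Form.Matrix"
begin

section \<open>Fields\<close>

definition perfect_field :: "'f::field itself \<Rightarrow> bool" where
  "perfect_field _ \<longleftrightarrow> CHAR('f) = 0 \<or> surj (\<lambda>c::'f. c ^ CHAR('f))"

section \<open>Submodules, uniserial modules and quotient modules\<close>

text \<open>Modules over a Lie algebra and modules over \<open>F[X]\<close> are treated uniformly: a module is given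
  by its carrier \<open>C\<close>, its zero, its addition and the set \<open>H\<close> of the operators through which scalars
  and (Lie or polynomial) ring elements act on it.\<close>

definition submodules :: "'m set \<Rightarrow> 'm \<Rightarrow> ('m \<Rightarrow> 'm \<Rightarrow> 'm) \<Rightarrow> ('m \<Rightarrow> 'm) set \<Rightarrow> 'm set set" where
  "submodules C z pl H =
     {N. N \<subseteq> C \<and> z \<in> N \<and> (\<forall>a\<in>N. \<forall>b\<in>N. pl a b \<in> N) \<and> (\<forall>h\<in>H. \<forall>a\<in>N. h a \<in> N)}"

definition uniserial_module :: "'m set \<Rightarrow> 'm \<Rightarrow> ('m \<Rightarrow> 'm \<Rightarrow> 'm) \<Rightarrow> ('m \<Rightarrow> 'm) set \<Rightarrow> bool" where
  "uniserial_module C z pl H \<longleftrightarrow>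
     C \<noteq> {z} \<and> (\<forall>N\<in>submodules C z pl H. \<forall>N'\<in>submodules C z pl H. N \<subseteq> N' \<or> N' \<subseteq> N)"

text \<open>The quotient \<open>V/W\<close> is the set of cosets \<open>v + W\<close> with \<open>v \<in> V\<close>; its zero is \<open>W\<close>. An additive
  operator \<open>h\<close> preserving \<open>W\<close> induces \<open>quot_op W h\<close>, which maps \<open>v + W\<close> to \<open>h v + W\<close>.\<close>

definition quot_coset :: "'v::ab_group_add set \<Rightarrow> 'v \<Rightarrow> 'v set" where
  "quot_coset W v = (\<lambda>w. v + w) ` W"

definition quot_carrier :: "'v::ab_group_add set \<Rightarrow> 'v set \<Rightarrow> 'v set set" where
  "quot_carrier V W = quot_coset W ` V"

definition quot_add :: "'v::ab_group_add set \<Rightarrow> 'v set \<Rightarrow> 'v set" where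
  "quot_add A B = {a + b |a b. a \<in> A \<and> b \<in> B}"

definition quot_op :: "'v::ab_group_add set \<Rightarrow> ('v \<Rightarrow> 'v) \<Rightarrow> 'v set \<Rightarrow> 'v set" where
  "quot_op W h A = (\<Union>a\<in>A. quot_coset W (h a))"

definition uniserial_quotient :: "'v::ab_group_add set \<Rightarrow> 'v set \<Rightarrow> ('v \<Rightarrow> 'v) set \<Rightarrow> bool" where
  "uniserial_quotient V W H \<longleftrightarrow>
     uniserial_module (quot_carrier V W) W quot_add (quot_op W ` H)"

lemma quot_op_coset:
  assumes "\<And>u v. h (u + v) = h u + h v" "\<And>w. w \<in> W \<Longrightarrow> h w \<in> W" "0 \<in> W"
    and "\<And>u v. u \<in> W \<Longrightarrow> v \<in> W \<Longrightarrow> u + v \<in> W"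
  shows "quot_op W h (quot_coset W v) = quot_coset W (h v)"
proof (intro equalityI subsetI)
  fix z assume "z \<in> quot_op W h (quot_coset W v)"
  then obtain w w' where "w \<in> W" "w' \<in> W" "z = h (v + w) + w'"
    by (auto simp: quot_op_def quot_coset_def)
  then have "z = h v + (h w + w')" "h w + w' \<in> W" using assms by (auto simp: add.assoc)
  then show "z \<in> quot_coset W (h v)" by (auto simp: quot_coset_def)
next
  fix z assume "z \<in> quot_coset W (h v)"
  moreover have "v \<in> quot_coset W v"
    using assms(3) by (force simp: quot_coset_def)
  ultimately show "z \<in> quot_op W h (quot_coset W v)" by (auto simp: quot_op_def)
qed

section \<open>Modules over polynomials\<close>

text \<open>Action of \<open>f \<in> F[X]\<close> on a vector space on which \<open>X\<close> acts as \<open>h\<close>.\<close>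

definition poly_op ::
  "('f::field \<Rightarrow> 'u::ab_group_add \<Rightarrow> 'u) \<Rightarrow> ('u \<Rightarrow> 'u) \<Rightarrow> 'f poly \<Rightarrow> 'u \<Rightarrow> 'u" where
  "poly_op sc h f u = (\<Sum>k\<le>degree f. sc (coeff f k) ((h ^^ k) u))"

text \<open>\<open>V/W \<cong> F[X]/(q)\<close> as \<open>F[X]\<close>-modules, \<open>X\<close> acting on \<open>V/W\<close> through \<open>h\<close>.\<close>

definition quotient_iso_cyclic ::
  "('f::field \<Rightarrow> 'u::ab_group_add \<Rightarrow> 'u) \<Rightarrow> ('u \<Rightarrow> 'u) \<Rightarrow> 'u set \<Rightarrow> 'u set \<Rightarrow> 'f poly \<Rightarrow> bool" where
  "quotient_iso_cyclic sc h V W q \<longleftrightarrow>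
     (let I = {q * r |r. True} in
      \<exists>\<phi>. bij_betw \<phi> (quot_carrier V W) (quot_carrier UNIV I) \<and>
          (\<forall>A\<in>quot_carrier V W. \<forall>B\<in>quot_carrier V W. \<phi> (quot_add A B) = quot_add (\<phi> A) (\<phi> B)) \<and>
          (\<forall>f. \<forall>A\<in>quot_carrier V W.
             \<phi> (quot_op W (poly_op sc h f) A) = quot_op I (\<lambda>r. f * r) (\<phi> A)))"

definition polys_below :: "nat \<Rightarrow> 'f::field poly set" where
  "polys_below n = {\<Sum>k<n. monom (c k) k |c. True}"

section \<open>Linear maps\<close>

definition linear_map_on ::
  "('f \<Rightarrow> 'v \<Rightarrow> 'v) \<Rightarrow> ('f \<Rightarrow> 'w \<Rightarrow> 'w) \<Rightarrow> 'v::plus set \<Rightarrow> ('v \<Rightarrow> 'w::plus) \<Rightarrow> bool" where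
  "linear_map_on s1 s2 V h \<longleftrightarrow>
     (\<forall>u\<in>V. \<forall>w\<in>V. h (u + w) = h u + h w) \<and> (\<forall>c. \<forall>u\<in>V. h (s1 c u) = s2 c (h u))"

definition semisimple_operator ::
  "('f::field \<Rightarrow> 'u::ab_group_add \<Rightarrow> 'u) \<Rightarrow> ('u \<Rightarrow> 'u) \<Rightarrow> bool" where
  "semisimple_operator sc h \<longleftrightarrow>
     (\<forall>W. Modules.module.subspace sc W \<and> h ` W \<subseteq> W \<longrightarrow>
        (\<exists>W'. Modules.module.subspace sc W' \<and> h ` W' \<subseteq> W' \<and> W \<inter> W' = {0} \<and>
              (\<forall>u. \<exists>w\<in>W. \<exists>w'\<in>W'. u = w + w')))"

definition is_basis_list :: "('f::field \<Rightarrow> 'u::ab_group_add \<Rightarrow> 'u) \<Rightarrow> 'u list \<Rightarrow> bool" where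
  "is_basis_list sc bs \<longleftrightarrow> distinct bs \<and> \<not> Modules.module.dependent sc (set bs) \<and>
     Modules.module.span sc (set bs) = UNIV"

text \<open>The \<open>k\<close>-th column of the matrix consists of the coordinates of the image of the \<open>k\<close>-th basis
  vector.\<close>

definition matrix_in_basis ::
  "('f::field \<Rightarrow> 'u::ab_group_add \<Rightarrow> 'u) \<Rightarrow> 'u list \<Rightarrow> ('u \<Rightarrow> 'u) \<Rightarrow> 'f mat" where
  "matrix_in_basis sc bs h = mat (length bs) (length bs)
     (\<lambda>(i, k). Modules.module.representation sc (set bs) (h (bs ! k)) (bs ! i))"

section \<open>Lie algebras and their modules\<close>

locale lie_algebra = vector_space scale
  for scale :: "'f::field \<Rightarrow> 'g::ab_group_add \<Rightarrow> 'g" +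
  fixes bracket :: "'g \<Rightarrow> 'g \<Rightarrow> 'g"
  assumes bracket_add_left: "bracket (a + b) c = bracket a c + bracket b c"
    and bracket_add_right: "bracket a (b + c) = bracket a b + bracket a c"
    and bracket_scale_left: "bracket (scale k a) b = scale k (bracket a b)"
    and bracket_scale_right: "bracket a (scale k b) = scale k (bracket a b)"
    and bracket_self: "bracket a a = 0"
    and jacobi: "bracket a (bracket b c) + bracket b (bracket c a) + bracket c (bracket a b) = 0"
    and finite_dim: "\<exists>B. finite B \<and> span B = UNIV"
begin

definition bracket_span :: "'g set \<Rightarrow> 'g set \<Rightarrow> 'g set" where
  "bracket_span A B = span {bracket a b |a b. a \<in> A \<and> b \<in> B}"

definition ideal :: "'g set \<Rightarrow> bool" where
  "ideal I \<longleftrightarrow> subspace I \<and> (\<forall>a. \<forall>b\<in>I. bracket a b \<in> I)"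

primrec derived_series :: "'g set \<Rightarrow> nat \<Rightarrow> 'g set" where
  "derived_series I 0 = I"
| "derived_series I (Suc k) = bracket_span (derived_series I k) (derived_series I k)"

definition solvable :: "'g set \<Rightarrow> bool" where
  "solvable I \<longleftrightarrow> (\<exists>k. derived_series I k = {0})"

definition radical :: "'g set" where
  "radical = span (\<Union>{I. ideal I \<and> solvable I})"

definition nil_part :: "'g set" where
  "nil_part = bracket_span UNIV radical"

definition eigenspace_in :: "'g set \<Rightarrow> 'g \<Rightarrow> 'f \<Rightarrow> 'g set" where
  "eigenspace_in V y \<delta> = {u \<in> V. bracket y u = scale \<delta> u}"

definition ad_diagonalizable_on :: "'g \<Rightarrow> 'g set \<Rightarrow> bool" where
  "ad_diagonalizable_on x V \<longleftrightarrow>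
     (\<exists>B. independent B \<and> span B = V \<and> (\<forall>b\<in>B. \<exists>\<delta>. bracket x b = scale \<delta> b))"

definition is_semidirect :: "'g \<Rightarrow> 'g set \<Rightarrow> bool" where
  "is_semidirect x V \<longleftrightarrow> ideal V \<and> x \<notin> V \<and> (\<forall>z. \<exists>c. \<exists>u\<in>V. z = scale c x + u)"

definition abelian :: "'g set \<Rightarrow> bool" where
  "abelian V \<longleftrightarrow> (\<forall>u\<in>V. \<forall>w\<in>V. bracket u w = 0)"

end

locale lie_module = lie_algebra scale bracket + U: vector_space scaleU
  for scale :: "'f::field \<Rightarrow> 'g::ab_group_add \<Rightarrow> 'g"
    and bracket :: "'g \<Rightarrow> 'g \<Rightarrow> 'g"
    and scaleU :: "'f \<Rightarrow> 'u::ab_group_add \<Rightarrow> 'u" +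
  fixes act :: "'g \<Rightarrow> 'u \<Rightarrow> 'u"
  assumes act_add_left: "act (a + b) u = act a u + act b u"
    and act_add_right: "act a (u + w) = act a u + act a w"
    and act_scale_left: "act (scale k a) u = scaleU k (act a u)"
    and act_scale_right: "act a (scaleU k u) = scaleU k (act a u)"
    and act_bracket: "act (bracket a b) u = act a (act b u) - act b (act a u)"
    and finite_dim_module: "\<exists>B. finite B \<and> U.span B = UNIV"
begin

definition module_ops :: "('u \<Rightarrow> 'u) set" where
  "module_ops = range scaleU \<union> range act"

definition uniserial :: bool where
  "uniserial \<longleftrightarrow> uniserial_module UNIV 0 (+) module_ops"

definition admissible :: bool where
  "admissible \<longleftrightarrow> (UNIV :: 'u set) \<noteq> {0} \<and> (\<forall>z\<in>nil_part. \<exists>k. \<forall>u. (act z ^^ k) u = 0)"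

text \<open>The next term consists of the \<open>u\<close> whose class modulo the current one is annihilated by
  \<open>nil_part\<close>.\<close>

primrec nil_series :: "nat \<Rightarrow> 'u set" where
  "nil_series 0 = {0}"
| "nil_series (Suc i) = {u. \<forall>z\<in>nil_part. act z u \<in> nil_series i}"

definition has_nil_length :: "nat \<Rightarrow> bool" where
  "has_nil_length m \<longleftrightarrow> nil_series m = UNIV \<and> (\<forall>i<m. nil_series i \<subset> nil_series (Suc i))"

text \<open>On a nilpotency factor the class of \<open>z\<close> modulo \<open>nil_part\<close> acts as \<open>z\<close> does, so the submodules
  for the quotient Lie algebra are the subspaces stable under the operators \<open>act z\<close>.\<close>

definition linked :: bool where
  "linked \<longleftrightarrow> admissible \<and>
     (\<exists>m. has_nil_length m \<and>
          (\<forall>i\<in>{1..m}. uniserial_quotient (nil_series i) (nil_series (i - 1)) module_ops))"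

end

section \<open>Matrices\<close>

definition companion_mat :: "'f::field poly \<Rightarrow> 'f mat" where
  "companion_mat f = mat (degree f) (degree f)
     (\<lambda>(i, k). if Suc k = degree f then - coeff f i else if i = Suc k then 1 else 0)"

definition mat_poly :: "'f::field poly \<Rightarrow> 'f mat \<Rightarrow> 'f mat" where
  "mat_poly f M = mat (dim_row M) (dim_row M)
     (\<lambda>(i, k). \<Sum>l\<le>degree f. coeff f l * (M ^\<^sub>m l) $$ (i, k))"

text \<open>Position \<open>(block, index inside the block)\<close> of a global index, both counted from \<open>0\<close>, for
  consecutive blocks of sizes \<open>ns\<close>.\<close>

fun block_pos :: "nat list \<Rightarrow> nat \<Rightarrow> nat \<times> nat" where
  "block_pos [] r = (0, r)"
| "block_pos (n # ns) r =
     (if r < n then (0, r) else (let (i, a) = block_pos ns (r - n) in (Suc i, a)))"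

definition block_mat :: "nat list \<Rightarrow> (nat \<Rightarrow> nat \<Rightarrow> 'f mat) \<Rightarrow> 'f mat" where
  "block_mat ns B = mat (sum_list ns) (sum_list ns)
     (\<lambda>(r, c). let (i, a) = block_pos ns r; (k, b) = block_pos ns c in B i k $$ (a, b))"

text \<open>The data \<open>p i\<close>, \<open>s i\<close> are indexed by \<open>i = 1, \<dots>, m\<close>, as is the family \<open>B i\<close> below; matrix
  entries and the blocks of \<open>block_mat\<close> are counted from \<open>0\<close>.\<close>

definition matrix_A :: "nat \<Rightarrow> (nat \<Rightarrow> 'f::field poly) \<Rightarrow> (nat \<Rightarrow> nat) \<Rightarrow> 'f mat" where
  "matrix_A m p s = diag_block_mat (map (\<lambda>i. companion_mat (p i ^ s i)) [1..<Suc m])"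

definition matrix_E :: "nat \<Rightarrow> (nat \<Rightarrow> 'f::field poly) \<Rightarrow> (nat \<Rightarrow> nat) \<Rightarrow> 'f mat" where
  "matrix_E m p s = diag_block_mat (map (\<lambda>i. companion_mat (p i ^ s i) +
     of_nat (i - 1) \<cdot>\<^sub>m 1\<^sub>m (degree (p i ^ s i))) [1..<Suc m])"

definition block_B :: "nat \<Rightarrow> (nat \<Rightarrow> 'f::field poly) \<Rightarrow> (nat \<Rightarrow> nat) \<Rightarrow> nat \<Rightarrow> 'f mat" where
  "block_B d p s i = mat (d * s (i - 1)) (d * s i)
     (\<lambda>(a, b). coeff ([:-1, 1:] ^ b * p (i - 1) ^ (s (i - 1) - s i)) a)"

definition matrix_T :: "nat \<Rightarrow> nat \<Rightarrow> (nat \<Rightarrow> 'f::field poly) \<Rightarrow> (nat \<Rightarrow> nat) \<Rightarrow> 'f mat" where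
  "matrix_T d m p s = (let ns = map (\<lambda>i. d * s i) [1..<Suc m] in
     block_mat ns (\<lambda>i k. if k = Suc i then block_B d p s (Suc k) else 0\<^sub>m (ns ! i) (ns ! k)))"

subsection \<open>Direct and semidirect sums of spaces of square matrices\<close>

definition mat_subspace :: "nat \<Rightarrow> 'f::field mat set \<Rightarrow> bool" where
  "mat_subspace t V \<longleftrightarrow> V \<subseteq> carrier_mat t t \<and> 0\<^sub>m t t \<in> V \<and>
     (\<forall>M\<in>V. \<forall>N\<in>V. M + N \<in> V) \<and> (\<forall>c. \<forall>M\<in>V. c \<cdot>\<^sub>m M \<in> V)"

definition mat_sum_below :: "nat \<Rightarrow> nat \<Rightarrow> (nat \<Rightarrow> 'f::field mat) \<Rightarrow> 'f mat" where
  "mat_sum_below t m M = mat t t (\<lambda>ij. \<Sum>j<m. M j $$ ij)"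

definition mat_direct_sum :: "nat \<Rightarrow> nat \<Rightarrow> (nat \<Rightarrow> 'f::field mat set) \<Rightarrow> 'f mat set \<Rightarrow> bool" where
  "mat_direct_sum t m V N \<longleftrightarrow>
     (\<forall>j<m. mat_subspace t (V j)) \<and>
     N = {mat_sum_below t m M |M. \<forall>j<m. M j \<in> V j} \<and>
     (\<forall>M. (\<forall>j<m. M j \<in> V j) \<and> mat_sum_below t m M = 0\<^sub>m t t \<longrightarrow> (\<forall>j<m. M j = 0\<^sub>m t t))"

definition mat_semidirect :: "nat \<Rightarrow> 'f::field mat \<Rightarrow> 'f mat set \<Rightarrow> 'f mat set \<Rightarrow> bool" where
  "mat_semidirect t A N L \<longleftrightarrow>
     A \<in> carrier_mat t t \<and> mat_subspace t N \<and> A \<notin> N \<and>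
     L = {c \<cdot>\<^sub>m A + M |c M. M \<in> N} \<and>
     (\<forall>P\<in>L. \<forall>M\<in>N. P * M - M * P \<in> N)"

end

(* A generic y in the span of x and a_0 turns every nilpotency factor into a cyclic F[X]-module:
   take y with minimal polynomial of largest degree. Along a line y + c b this degree does not change,
   and differentiating the equation of the minimal polynomial at c = 0 shows, by separability, that b
   acts as a polynomial in y. This is used on the top of a uniserial factor and on its second layer, and
   Nakayama's lemma does the rest; the conditions for the different factors are open, so they are met at once.

   For u in n with [y, u] = delta u one has f(y) u = u f(y + delta), so an injective u between consecutive
   factors shifts their polynomials by delta. As the algebra a is abelian, one eigenvector v injective on the
   second factor is injective on all of them; scaling y gives delta = 1. When the shifted polynomials are
   distinct, U is the sum of its primary components U_i for y, v maps U_{i+1} injectively to U_i,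
   and generators of the U_i can be chosen compatibly. An eigenvector u of weight j and v^j g(E)
   agree on a generator of U_{j+1} for a suitable g, hence everywhere since both commute with v. *)
theory Submission
  imports Defs "Jordan_Normal_Form.Determinant" "HOL-Computational_Algebra.Polynomial_Factorial"
begin

section \<open>Bezout coprimality, shifts of the variable, separability of irreducible
  polynomials\<close>

section \<open>Coprime polynomials over a field\<close>

text \<open>The matrix E comes from [y, v] = v: on U_i it is y + (i - 1), and this correction is
  exactly what makes it commute with v, although y does not. As f(E) acts on U_i as f(y + i - 1), a
  single polynomial describes an eigenvector on all components at once. The conditions on the field
  enter separately. A perfect field makes an irreducible polynomial coprime to its derivative; an
  infinite field leaves room outside finitely many bad parameters of a line. If a_0 = 0, all
  operators in question are multiples of x, and x itself serves. The trivial stabilizer of p_1 says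
  that different shifts of p_1 are different polynomials, and characteristic at least m keeps 0,
  ..., m - 1 apart in the field, so that a weight determines by how many components an eigenvector
  moves. The second layer of a factor is needed because a generator of the top need not lift for a
  given y. If it lifted for no generic y, the factor modulo the submodule below its second layer
  would be generated by too few powers of y for its dimension.\<close>

definition bezout_coprime :: "'f::field poly \<Rightarrow> 'f poly \<Rightarrow> bool" where
  "bezout_coprime f g \<longleftrightarrow> (\<exists>a b. a * f + b * g = 1)"

lemma bezout_coprime_sym: "bezout_coprime f g \<Longrightarrow> bezout_coprime g f"
  unfolding bezout_coprime_def by (metis add.commute)

lemma bezout_coprime_1 [simp]: "bezout_coprime 1 g"
  unfolding bezout_coprime_def by (rule exI[of _ 1], rule exI[of _ 0]) simp

lemma bezout_coprime_mult:
  assumes "bezout_coprime f h" "bezout_coprime g h"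
  shows "bezout_coprime (f * g) h"
proof -
  obtain a b c d where "a * f + b * h = 1" "c * g + d * h = 1"
    using assms unfolding bezout_coprime_def by blast
  then have "(a * f + b * h) * (c * g + d * h) = 1" by simp
  then have "(a * c) * (f * g) + (a * f * d + b * c * g + b * h * d) * h = 1"
    by (simp add: algebra_simps)
  then show ?thesis unfolding bezout_coprime_def by blast
qed

lemma bezout_coprime_power: "bezout_coprime f h \<Longrightarrow> bezout_coprime (f ^ n) h"
  by (induction n) (auto intro: bezout_coprime_mult)

lemma bezout_coprime_powers: "bezout_coprime f h \<Longrightarrow> bezout_coprime (f ^ n) (h ^ k)"
  by (meson bezout_coprime_power bezout_coprime_sym)

lemma bezout_coprime_prod:
  "finite A \<Longrightarrow> (\<And>i. i \<in> A \<Longrightarrow> bezout_coprime (f i) h) \<Longrightarrow> bezout_coprime (prod f A) h"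
  by (induction A rule: finite_induct) (auto intro: bezout_coprime_mult)

text \<open>A nonzero element of least degree in the ideal generated by \<open>f\<close> and
  \<open>g\<close> divides every element of it, by division with remainder. It divides the
  irreducible \<open>f\<close>; were it not a unit, it would be associated to \<open>f\<close>, and
  \<open>f\<close> would divide \<open>g\<close>.\<close>

lemma irreducible_bezout_coprime:
  fixes f g :: "'f::field poly"
  assumes "irreducible f" "\<not> f dvd g"
  shows "bezout_coprime f g"
proof -
  let ?I = "{a * f + b * g |a b. True}"
  have f0: "f \<noteq> 0" using assms(1) by auto
  have fI: "f \<in> ?I" by (rule CollectI, rule exI[of _ 1], rule exI[of _ 0]) simp
  have gI: "g \<in> ?I" by (rule CollectI, rule exI[of _ 0], rule exI[of _ 1]) simp
  obtain h where h: "h \<in> ?I" "h \<noteq> 0" and min: "\<And>k. k \<in> ?I \<Longrightarrow> k \<noteq> 0 \<Longrightarrow> degree h \<le> degree k"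
    using ex_has_least_nat[of "\<lambda>h. h \<in> ?I \<and> h \<noteq> 0" f degree] fI f0 by blast
  have dvd: "h dvd k" if k: "k \<in> ?I" for k
  proof (rule ccontr)
    assume "\<not> h dvd k"
    then have n0: "k mod h \<noteq> 0" by (simp add: mod_eq_0_iff_dvd)
    then have "degree (k mod h) < degree h" using h(2) by (metis degree_mod_less)
    moreover have "k mod h \<in> ?I"
    proof -
      from k h(1) obtain a b c d where "k = a * f + b * g" "h = c * f + d * g" by blast
      moreover have "k mod h = k - k div h * h" by (simp add: minus_div_mult_eq_mod)
      ultimately have "k mod h = (a - k div h * c) * f + (b - k div h * d) * g"
        by (metis (no_types, opaque_lifting) add_diff_add distrib_left left_diff_distrib mult.assoc)
      then show ?thesis by blast
    qed
    ultimately show False using min n0 by fastforce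
  qed
  from dvd[OF fI] obtain k where k: "f = h * k" by blast
  have "is_unit h"
  proof (rule ccontr)
    assume "\<not> is_unit h"
    with assms(1) k have "is_unit k" by (auto simp: irreducible_def)
    then have "f dvd h" using k by (metis dvd_mult_unit_iff dvd_refl)
    with dvd[OF gI] assms(2) show False by (meson dvd_trans)
  qed
  then obtain l where l: "1 = h * l" by (rule dvdE)
  from h(1) obtain a b where "h = a * f + b * g" by blast
  with l have "(l * a) * f + (l * b) * g = 1" by (simp add: algebra_simps)
  then show ?thesis unfolding bezout_coprime_def by blast
qed

lemma irreducible_monic_dvd_eq:
  fixes p q :: "'f::field poly"
  assumes "irreducible p" "irreducible q" "lead_coeff p = 1" "lead_coeff q = 1" "p dvd q"
  shows "p = q"
proof -
  obtain k where k: "q = p * k" using assms(5) by blast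
  have "\<not> is_unit p" using assms(1) by (auto simp: irreducible_def)
  then have "is_unit k" using assms(2) k by (auto simp: irreducible_def)
  then obtain c where c: "k = [:c:]" by (auto simp: is_unit_poly_iff)
  have "c = 1" using k c assms(3,4) by (auto split: if_splits)
  then show ?thesis using k c by (simp add: one_pCons)
qed

lemma irreducible_bezout_coprime_distinct:
  fixes p q :: "'f::field poly"
  assumes "irreducible p" "irreducible q" "lead_coeff p = 1" "lead_coeff q = 1" "p \<noteq> q"
  shows "bezout_coprime p q"
  using irreducible_bezout_coprime irreducible_monic_dvd_eq assms by blast

lemma irreducible_prime_elem: "irreducible (p :: 'f::field poly) \<Longrightarrow> prime_elem p"
  by (rule field_poly_irreducible_imp_prime)

lemma bezout_coprime_dvd_mult:
  assumes "bezout_coprime f g" "f dvd g * h"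
  shows "f dvd h"
proof -
  obtain a b where ab: "a * f + b * g = 1" using assms(1) unfolding bezout_coprime_def by blast
  have "h = (a * f + b * g) * h" using ab by simp
  also have "\<dots> = f * (a * h) + b * (g * h)" by (simp add: algebra_simps)
  finally show ?thesis using assms(2) by (metis dvd_add dvd_mult dvd_triv_left)
qed

lemma irreducible_degree_pos: "irreducible (p :: 'f::field poly) \<Longrightarrow> degree p > 0"
  by (metis irreducible_def is_unit_iff_degree gr0I)

text \<open>The substitution X -> X + c is an automorphism of F[X] with inverse X -> X - c, so
  factorizations can be carried back and forth.\<close>

lemma irreducible_pcompose_shift:
  fixes p :: "'f::field poly"
  assumes "irreducible p"
  shows "irreducible (p \<circ>\<^sub>p [:c, 1:])"
proof (rule irreducibleI)
  have inv: "(q \<circ>\<^sub>p [:c, 1:]) \<circ>\<^sub>p [:-c, 1:] = q" for q :: "'f poly"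
    by (simp add: pcompose_assoc[symmetric] pcompose_pCons)
  show "p \<circ>\<^sub>p [:c, 1:] \<noteq> 0" using assms inv[of p] by auto
  show "\<not> is_unit (p \<circ>\<^sub>p [:c, 1:])"
    using irreducible_degree_pos[OF assms] \<open>p \<circ>\<^sub>p [:c, 1:] \<noteq> 0\<close>
    by (simp add: is_unit_iff_degree degree_pcompose)
  fix a b assume ab: "p \<circ>\<^sub>p [:c, 1:] = a * b"
  then have "p = (a \<circ>\<^sub>p [:-c, 1:]) * (b \<circ>\<^sub>p [:-c, 1:])"
    using inv[of p] by (simp add: pcompose_mult)
  then have "is_unit (a \<circ>\<^sub>p [:-c, 1:]) \<or> is_unit (b \<circ>\<^sub>p [:-c, 1:])"
    using assms by (auto simp: irreducible_def)
  moreover have "is_unit q" if "is_unit (q \<circ>\<^sub>p [:-c, 1:])" for q :: "'f poly"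
  proof -
    from that have n0: "q \<noteq> 0" by auto
    have "q \<circ>\<^sub>p [:-c, 1:] \<noteq> 0" using that by auto
    with that n0 show ?thesis by (simp add: is_unit_iff_degree degree_pcompose)
  qed
  ultimately show "is_unit a \<or> is_unit b" by blast
qed

lemma monic_pcompose_shift: "lead_coeff (p \<circ>\<^sub>p [:c, 1:]) = lead_coeff (p :: 'f::field poly)"
  by (subst lead_coeff_comp) auto

lemma pcompose_power: "(p ^ n) \<circ>\<^sub>p q = (p \<circ>\<^sub>p q :: 'f::field poly) ^ n"
  by (induction n) (auto simp: pcompose_mult pcompose_1)

lemma degree_monic_power:
  fixes p :: "'f::field poly" shows "lead_coeff p = 1 \<Longrightarrow> degree (p ^ n) = degree p * n"
  by (cases "p = 0") (auto simp: degree_power_eq mult.commute)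

text \<open>If \<open>p' = 0\<close> then \<open>p\<close> is a polynomial in \<open>X\<close> to the power of the characteristic, hence a power
  of a polynomial.\<close>
lemma perfect_field_pderiv_nonzero:
  fixes p :: "'f::field poly"
  assumes perf: "perfect_field TYPE('f)" and irr: "irreducible p"
  shows "pderiv p \<noteq> 0"
proof
  assume p0: "pderiv p = 0"
  have d: "degree p > 0" by (rule irreducible_degree_pos[OF irr])
  have co: "of_nat k * coeff p k = 0" for k
  proof (cases k)
    case (Suc l)
    have "coeff (pderiv p) l = 0" using p0 by simp
    then show ?thesis using Suc by (simp add: coeff_pderiv)
  qed simp
  let ?q = "CHAR('f)"
  \<comment> \<open>In characteristic zero the relation \<open>co\<close> at the degree of
    \<open>p\<close> would force the leading coefficient to vanish.\<close>
  have q0: "?q \<noteq> 0"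
  proof
    assume "?q = 0"
    then have "of_nat (degree p) \<noteq> (0::'f)" using d by (simp add: of_nat_eq_0_iff_char_dvd)
    then show False using co[of "degree p"] d by auto
  qed
  then have pr: "prime ?q" by (simp add: prime_CHAR_semidom)
  from perf q0 have sj: "surj (\<lambda>c::'f. c ^ ?q)" by (simp add: perfect_field_def)
  \<comment> \<open>Roots of the coefficients exist because Frobenius is onto. Only coefficients at
    multiples of the characteristic survive \<open>co\<close>, and their roots are the coefficients
    of \<open>r\<close>.\<close>
  define rt where "rt c = (SOME b::'f. b ^ ?q = c)" for c
  have rt: "rt c ^ ?q = c" for c
    unfolding rt_def by (rule someI_ex) (use sj in \<open>metis surjD\<close>)
  define n where "n = degree p div ?q"
  define r where "r = (\<Sum>k\<le>n. monom (rt (coeff p (k * ?q))) k)"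
  have "r ^ ?q = (\<Sum>k\<le>n. monom (rt (coeff p (k * ?q))) k ^ ?q)"
    unfolding r_def by (rule freshmans_dream_sum) (use pr in simp_all)
  also have "\<dots> = (\<Sum>k\<le>n. monom (coeff p (k * ?q)) (k * ?q))"
    by (simp add: monom_power rt mult.commute)
  also have "\<dots> = (\<Sum>k\<in>(\<lambda>k. k * ?q) ` {..n}. monom (coeff p k) k)"
    by (subst sum.reindex) (use q0 in \<open>auto simp: inj_on_def\<close>)
  also have "\<dots> = (\<Sum>k\<le>degree p. monom (coeff p k) k)"
  proof (rule sum.mono_neutral_left)
    show "(\<lambda>k. k * ?q) ` {..n} \<subseteq> {..degree p}"
      unfolding n_def
      by (auto intro: order_trans[OF mult_le_mono1 div_times_less_eq_dividend])
    show "\<forall>i\<in>{..degree p} - (\<lambda>k. k * ?q) ` {..n}. monom (coeff p i) i = 0"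
    proof
      fix i assume i: "i \<in> {..degree p} - (\<lambda>k. k * ?q) ` {..n}"
      have "\<not> ?q dvd i"
      proof
        assume "?q dvd i"
        then have "i = (i div ?q) * ?q" by simp
        moreover have "i div ?q \<le> n" using i unfolding n_def by (auto intro: div_le_mono)
        ultimately show False using i by blast
      qed
      then have "of_nat i \<noteq> (0::'f)" by (simp add: of_nat_eq_0_iff_char_dvd)
      then show "monom (coeff p i) i = 0" using co[of i] by simp
    qed
  qed simp
  also have "\<dots> = p" by (rule poly_as_sum_of_monoms)
  finally have rq: "r ^ ?q = p" .
  have "?q \<ge> 2" using pr by (rule prime_ge_2_nat)
  then have "p = r * r ^ (?q - 1)" using rq q0 by (metis power_eq_if)
  then have "is_unit r \<or> is_unit (r ^ (?q - 1))" using irr by (auto simp: irreducible_def)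
  then have "is_unit r" using \<open>?q \<ge> 2\<close> by (simp add: is_unit_power_iff)
  then have "is_unit p" using rq by (metis is_unit_power_iff)
  then show False using irr by (auto simp: irreducible_def)
qed

lemma perfect_field_bezout_coprime_pderiv:
  fixes p :: "'f::field poly"
  assumes "perfect_field TYPE('f)" "irreducible p"
  shows "bezout_coprime p (pderiv p)"
proof (rule irreducible_bezout_coprime[OF assms(2)])
  have "pderiv p \<noteq> 0" using assms by (rule perfect_field_pderiv_nonzero)
  moreover have "degree (pderiv p) < degree p"
    by (rule degree_lessI)
      (use irreducible_degree_pos[OF assms(2)] in \<open>auto simp: coeff_pderiv coeff_eq_0\<close>)
  ultimately show "\<not> p dvd pderiv p" by (auto dest: dvd_imp_degree_le)
qed

text \<open>The second highest coefficient detects shifts: in characteristic zero the added term is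
  nonzero for a nonconstant polynomial and c \<noteq> 0, which is how the stabilizer is seen to be
  trivial there.\<close>

lemma coeff_pcompose_shift_penultimate:
  fixes p :: "'f::field poly"
  assumes "degree p = Suc n"
  shows "coeff (p \<circ>\<^sub>p [:c, 1:]) n = coeff p n + of_nat (Suc n) * c * lead_coeff p"
  using assms
proof (induction p arbitrary: n)
  case (pCons a p)
  have dp: "degree p = n" using pCons.prems by (auto split: if_splits)
  have top: "coeff (p \<circ>\<^sub>p [:c, 1:]) n = lead_coeff p"
    using monic_pcompose_shift[of p c] dp by (simp add: degree_pcompose)
  show ?case
  proof (cases n)
    case 0
    then obtain b where "p = [:b:]" using dp by (metis degree_eq_zeroE)
    moreover have "p \<noteq> 0" using pCons.prems by auto
    ultimately show ?thesis using 0 by (simp add: pcompose_pCons)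
  next
    case (Suc l)
    have "coeff (p \<circ>\<^sub>p [:c, 1:]) l = coeff p l + of_nat n * c * lead_coeff p"
      using pCons.IH[of l] dp Suc by simp
    moreover have "p \<noteq> 0" using dp Suc by auto
    ultimately show ?thesis using top Suc dp
      by (simp add: pcompose_pCons coeff_pCons algebra_simps split: nat.splits)
  qed
qed simp

section \<open>Polynomials in an operator, cyclic subspaces modulo a stable subspace, and their
  behaviour along a line of operators\<close>

section \<open>Linear operators and polynomials in them\<close>

locale fd_space = vector_space sc for sc :: "'f::field \<Rightarrow> 'u::ab_group_add \<Rightarrow> 'u" +
  assumes fin_gen: "\<exists>B. finite B \<and> span B = UNIV"
begin

text \<open>The locale \<open>finite_dimensional_vector_space\<close> takes a basis as a parameter;
  the choice fixes one, which makes \<open>dim\<close> and \<open>dimension\<close>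
  available.\<close>

definition some_basis :: "'u set" where
  "some_basis = (SOME B. finite B \<and> independent B \<and> span B = UNIV)"

lemma some_basis: "finite some_basis \<and> independent some_basis \<and> span some_basis = UNIV"
  unfolding some_basis_def
proof (rule someI_ex)
  obtain B where B: "finite B" "span B = UNIV" using fin_gen by blast
  obtain C where C: "C \<subseteq> B" "independent C" "B \<subseteq> span C"
    using maximal_independent_subset[of B] by blast
  then have "span C = UNIV" using B(2) span_minimal[OF C(3) subspace_span] by blast
  then show "\<exists>B. finite B \<and> independent B \<and> span B = UNIV"
    using C(2) finite_subset[OF C(1) B(1)] by (intro exI[of _ C] conjI)
qed

sublocale finite_dimensional_vector_space sc some_basis
  using some_basis by unfold_locales auto

definition lin :: "('u \<Rightarrow> 'u) \<Rightarrow> bool" where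
  "lin h \<longleftrightarrow> (\<forall>u w. h (u + w) = h u + h w) \<and> (\<forall>c u. h (sc c u) = sc c (h u))"

lemma lin_add: "lin h \<Longrightarrow> h (u + w) = h u + h w"
  and lin_scale: "lin h \<Longrightarrow> h (sc c u) = sc c (h u)"
  unfolding lin_def by auto

lemma lin_0 [simp]: "lin h \<Longrightarrow> h 0 = 0"
  using lin_add[of h 0 0] by simp

lemma lin_minus: "lin h \<Longrightarrow> h (- u) = - h u"
  using lin_add[of h u "- u"] by (simp add: eq_neg_iff_add_eq_0 add.commute)

lemma lin_diff: "lin h \<Longrightarrow> h (u - w) = h u - h w"
  using lin_add[of h u "- w"] lin_minus[of h w] by simp

lemma lin_sum: "lin h \<Longrightarrow> h (sum g A) = (\<Sum>a\<in>A. h (g a))"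
  by (induction A rule: infinite_finite_induct) (auto simp: lin_add)

lemma lin_comp: "lin h \<Longrightarrow> lin k \<Longrightarrow> lin (\<lambda>u. h (k u))"
  unfolding lin_def by simp

lemma lin_plus: "lin h \<Longrightarrow> lin k \<Longrightarrow> lin (\<lambda>u. h u + k u)"
  unfolding lin_def by (simp add: scale_right_distrib ac_simps)

lemma lin_smult: "lin h \<Longrightarrow> lin (\<lambda>u. sc c (h u))"
  unfolding lin_def by (simp add: scale_right_distrib mult.commute)

lemma lin_id: "lin (\<lambda>u. u)"
  unfolding lin_def by simp

lemma lin_funpow: "lin h \<Longrightarrow> lin (h ^^ k)"
  by (induction k) (auto simp: lin_def)

lemma lin_zero: "lin (\<lambda>u. 0)"
  unfolding lin_def by simp

definition stable :: "('u \<Rightarrow> 'u) \<Rightarrow> 'u set \<Rightarrow> bool" where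
  "stable h N \<longleftrightarrow> subspace N \<and> (\<forall>w\<in>N. h w \<in> N)"

lemma stable_subspace: "stable h N \<Longrightarrow> subspace N"
  and stable_mem: "stable h N \<Longrightarrow> w \<in> N \<Longrightarrow> h w \<in> N"
  unfolding stable_def by auto

abbreviation pa :: "('u \<Rightarrow> 'u) \<Rightarrow> 'f poly \<Rightarrow> 'u \<Rightarrow> 'u" where "pa \<equiv> poly_op sc"

lemma pa_eq_sum:
  assumes "degree f \<le> n"
  shows "pa h f u = (\<Sum>k\<le>n. sc (coeff f k) ((h ^^ k) u))"
  unfolding poly_op_def
  by (rule sum.mono_neutral_left) (use assms in \<open>auto simp: coeff_eq_0\<close>)

lemma pa_0 [simp]: "pa h 0 u = 0"
  by (simp add: poly_op_def)

lemma pa_pCons: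
  assumes "lin h"
  shows "pa h (pCons a f) u = sc a u + h (pa h f u)"
proof -
  have "pa h (pCons a f) u = (\<Sum>k\<le>Suc (degree f). sc (coeff (pCons a f) k) ((h ^^ k) u))"
    by (rule pa_eq_sum) (rule degree_pCons_le)
  also have "\<dots> = sc a u + (\<Sum>k\<le>degree f. sc (coeff f k) (h ((h ^^ k) u)))"
    by (subst sum.atMost_Suc_shift) simp
  finally show ?thesis unfolding poly_op_def by (simp add: lin_sum lin_scale assms)
qed

lemma pa_const [simp]: "lin h \<Longrightarrow> pa h [:a:] u = sc a u"
  by (simp add: pa_pCons)

lemma pa_1 [simp]: "lin h \<Longrightarrow> pa h 1 u = u"
  by (simp add: one_pCons)

lemma pa_add: "pa h (f + g) u = pa h f u + pa h g u"
proof -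
  let ?n = "max (degree f) (degree g)"
  have "degree (f + g) \<le> ?n" by (rule degree_add_le_max)
  then show ?thesis
    by (simp add: pa_eq_sum[of _ ?n] sum.distrib[symmetric] scale_left_distrib)
qed

lemma pa_smult: "pa h (Polynomial.smult c f) u = sc c (pa h f u)"
  by (simp add: pa_eq_sum[of _ "degree f"] degree_smult_le scale_sum_right)

lemma pa_minus: "pa h (- f) u = - pa h f u"
  using pa_smult[of h "-1" f u] by simp

lemma pa_diff: "pa h (f - g) u = pa h f u - pa h g u"
  using pa_add[of h f "- g" u] by (simp add: pa_minus)

lemma pa_sum: "pa h (sum F A) u = (\<Sum>a\<in>A. pa h (F a) u)"
  by (induction A rule: infinite_finite_induct) (auto simp: pa_add)

lemma lin_pa: "lin h \<Longrightarrow> lin (pa h f)"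
proof (induction f)
  case 0 then show ?case by (simp add: lin_def)
next
  case (pCons a f)
  then have "lin (\<lambda>u. sc a u + h (pa h f u))"
    using lin_plus[OF lin_smult[OF lin_id] lin_comp[of h "pa h f"]] by blast
  then show ?case by (simp add: pa_pCons[OF pCons.prems] lin_def)
qed

lemma pa_mult: "lin h \<Longrightarrow> pa h (f * g) u = pa h f (pa h g u)"
proof (induction f)
  case (pCons a f)
  then show ?case by (simp add: pa_pCons pa_add pa_smult)
qed simp

lemma pa_mult': "lin h \<Longrightarrow> pa h (f * g) u = pa h g (pa h f u)"
  by (metis mult.commute pa_mult)

lemma pa_X: "lin h \<Longrightarrow> pa h [:0, 1:] u = h u"
  by (simp add: pa_pCons)

lemma pa_monom: "lin h \<Longrightarrow> pa h (monom c k) u = sc c ((h ^^ k) u)"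
  by (induction k) (auto simp: monom_0 monom_Suc pa_pCons lin_scale)

lemma pa_X_power: "lin h \<Longrightarrow> pa h ([:0, 1:] ^ k) u = (h ^^ k) u"
  using pa_monom[of h 1 k u] by (simp add: monom_altdef)

text \<open>By induction on the Horner form: moving one factor \<open>h\<close> past
  \<open>k\<close> replaces it by h + d. Every shift of a polynomial below comes from here.\<close>

lemma pa_twist:
  assumes "lin h" "lin k" "\<And>u. h (k u) = k (h u) + sc d (k u)"
  shows "pa h f (k u) = k (pa h (f \<circ>\<^sub>p [:d, 1:]) u)"
proof (induction f arbitrary: u)
  case 0 then show ?case using assms by simp
next
  case (pCons a f)
  have "pa h (pCons a f) (k u) = sc a (k u) + h (k (pa h (f \<circ>\<^sub>p [:d, 1:]) u))"
    by (simp add: pa_pCons assms pCons.IH)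
  also have "\<dots> = k (sc a u) + k (h (pa h (f \<circ>\<^sub>p [:d, 1:]) u) + sc d (pa h (f \<circ>\<^sub>p [:d, 1:]) u))"
    using assms by (simp add: lin_add lin_scale)
  also have "\<dots> = k (pa h (pCons a f \<circ>\<^sub>p [:d, 1:]) u)"
    using assms by (simp add: pcompose_pCons pa_add pa_pCons pa_smult lin_add lin_scale ac_simps)
  finally show ?case .
qed

lemma pa_commute:
  assumes "lin h" "lin k" "\<And>u. h (k u) = k (h u)"
  shows "pa h f (k u) = k (pa h f u)"
  using pa_twist[of h k 0 f u] assms by (simp add: pcompose_idR)

lemma stable_pa: "lin h \<Longrightarrow> stable h N \<Longrightarrow> w \<in> N \<Longrightarrow> pa h f w \<in> N"
proof (induction f)
  case 0 then show ?case by (simp add: stable_def subspace_0)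
next
  case (pCons a f)
  then show ?case by (simp add: pa_pCons stable_def subspace_add subspace_scale)
qed

lemma subspace_vimage:
  assumes "lin h" "subspace N" "subspace V"
  shows "subspace {w\<in>V. h w \<in> N}"
  using assms by (auto simp: subspace_def lin_add lin_scale)

lemma subspace_image: "lin h \<Longrightarrow> subspace N \<Longrightarrow> subspace (h ` N)"
proof -
  assume h: "lin h" and N: "subspace N"
  show ?thesis
  proof (rule subspaceI)
    show "0 \<in> h ` N" using h N subspace_0 by (metis image_eqI lin_0)
    fix x y assume "x \<in> h ` N" "y \<in> h ` N"
    then show "x + y \<in> h ` N" using h N by (auto simp: lin_add[symmetric] subspace_add)
  next
    fix c x assume "x \<in> h ` N"
    then show "sc c x \<in> h ` N" using h N by (auto simp: lin_scale[symmetric] subspace_scale)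
  qed
qed

text \<open>Evaluating the Bezout identity at \<open>h\<close> resolves the identity operator. This
  is why coprimality is recorded as an identity: it splits each vector into a part reached through
  \<open>f\<close> and a part reached through \<open>g\<close>.\<close>

lemma bezout_coprime_split:
  assumes "lin h" "bezout_coprime f g"
  obtains a b where "\<And>u. u = pa h (a * f) u + pa h (b * g) u"
proof -
  obtain a b where "a * f + b * g = 1" using assms(2) unfolding bezout_coprime_def by blast
  then have "u = pa h (a * f) u + pa h (b * g) u" for u
    using pa_1[OF assms(1), of u] by (simp add: pa_add[symmetric])
  then show thesis by (rule that)
qed

lemma bezout_coprime_mem:
  assumes "lin h" "bezout_coprime f g" "stable h N" "pa h f w \<in> N" "pa h g w \<in> N"
  shows "w \<in> N"
proof -
  obtain a b where *: "\<And>u. u = pa h (a * f) u + pa h (b * g) u"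
    using bezout_coprime_split[OF assms(1,2)] by metis
  have "pa h (a * f) w \<in> N" "pa h (b * g) w \<in> N"
    using assms by (simp_all add: pa_mult stable_pa)
  then show ?thesis using *[of w] assms(3) by (metis stable_subspace subspace_add)
qed

subsection \<open>Cyclic subspaces modulo a stable subspace\<close>

text \<open>The preimage of the cyclic F[X]-submodule of the quotient by \<open>Z\<close> generated
  by the class of \<open>v\<close>. Working with preimages avoids cosets throughout.\<close>

definition cyc :: "'u set \<Rightarrow> ('u \<Rightarrow> 'u) \<Rightarrow> 'u \<Rightarrow> 'u set" where
  "cyc Z h v = {pa h f v + z |f z. z \<in> Z}"

lemma cycI: "z \<in> Z \<Longrightarrow> pa h f v + z \<in> cyc Z h v"
  unfolding cyc_def by blast

lemma cyc_pa: "subspace Z \<Longrightarrow> pa h f v \<in> cyc Z h v"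
  using cycI[of 0 Z h f v] by (simp add: subspace_0)

lemma cyc_self: "lin h \<Longrightarrow> subspace Z \<Longrightarrow> v \<in> cyc Z h v"
  using cyc_pa[of Z h 1 v] by simp

lemma subset_cyc: "Z \<subseteq> cyc Z h v"
  using cycI[of _ Z h 0 v] by auto

lemma subspace_cyc:
  assumes "subspace Z" shows "subspace (cyc Z h v)"
proof (rule subspaceI)
  show "0 \<in> cyc Z h v" using subset_cyc assms subspace_0 by blast
next
  fix x y assume "x \<in> cyc Z h v" "y \<in> cyc Z h v"
  then obtain f g z z' where "x = pa h f v + z" "y = pa h g v + z'" "z \<in> Z" "z' \<in> Z"
    unfolding cyc_def by blast
  then have "x + y = pa h (f + g) v + (z + z')" "z + z' \<in> Z"
    using assms by (auto simp: pa_add subspace_add)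
  then show "x + y \<in> cyc Z h v" using cycI by metis
next
  fix c x assume "x \<in> cyc Z h v"
  then obtain f z where "x = pa h f v + z" "z \<in> Z" unfolding cyc_def by blast
  then have "sc c x = pa h (Polynomial.smult c f) v + sc c z" "sc c z \<in> Z"
    using assms by (auto simp: pa_smult scale_right_distrib subspace_scale)
  then show "sc c x \<in> cyc Z h v" using cycI by metis
qed

lemma stable_cyc:
  assumes "lin h" "stable h Z" shows "stable h (cyc Z h v)"
  unfolding stable_def
proof (intro conjI ballI)
  show "subspace (cyc Z h v)" using assms subspace_cyc stable_subspace by blast
  fix w assume "w \<in> cyc Z h v"
  then obtain f z where "w = pa h f v + z" "z \<in> Z" unfolding cyc_def by blast
  then have "h w = pa h (pCons 0 f) v + h z" "h z \<in> Z"
    using assms by (auto simp: pa_pCons lin_add stable_mem)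
  then show "h w \<in> cyc Z h v" using cycI by metis
qed

lemma cyc_subset:
  assumes "lin h" "stable h N" "v \<in> N" "Z \<subseteq> N"
  shows "cyc Z h v \<subseteq> N"
  unfolding cyc_def using assms by (auto intro!: subspace_add stable_pa stable_subspace)

text \<open>Linear independence of the classes in the quotient by \<open>Z\<close>, formulated for
  an indexed family so that repeated vectors count as dependent.\<close>

definition indep_mod :: "'u set \<Rightarrow> nat \<Rightarrow> (nat \<Rightarrow> 'u) \<Rightarrow> bool" where
  "indep_mod Z n e \<longleftrightarrow> (\<forall>c. (\<Sum>k<n. sc (c k) (e k)) \<in> Z \<longrightarrow> (\<forall>k<n. c k = 0))"

lemma indep_mod_mono:
  assumes "indep_mod Z n e" "k \<le> n"
  shows "indep_mod Z k e"
  unfolding indep_mod_def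
proof (intro allI impI)
  fix c l assume c: "(\<Sum>k<k. sc (c k) (e k)) \<in> Z" and l: "l < k"
  let ?c = "\<lambda>i. if i < k then c i else 0"
  have "(\<Sum>i<n. sc (?c i) (e i)) = (\<Sum>i<k. sc (?c i) (e i))"
    by (rule sum.mono_neutral_right) (use assms(2) in auto)
  also have "\<dots> = (\<Sum>i<k. sc (c i) (e i))" by (rule sum.cong) auto
  finally have "(\<Sum>i<n. sc (?c i) (e i)) \<in> Z" using c by simp
  from assms(1)[unfolded indep_mod_def, rule_format, OF this, of l]
  have "?c l = 0" using assms(2) l by simp
  then show "c l = 0" using l by simp
qed

lemma span_Un_image:
  assumes "subspace Z"
  shows "span (Z \<union> e ` {..<n::nat}) = {z + (\<Sum>k<n. sc (c k) (e k)) |z c. z \<in> Z}"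
proof (induction n)
  case 0
  then show ?case using assms by (simp add: span_eq_iff)
next
  case (Suc n)
  have "Z \<union> e ` {..<Suc n} = insert (e n) (Z \<union> e ` {..<n})" by (auto simp: lessThan_Suc)
  then have "span (Z \<union> e ` {..<Suc n}) = {x. \<exists>k. x - sc k (e n) \<in> span (Z \<union> e ` {..<n})}"
    by (simp add: span_insert)
  also have "\<dots> = {z + (\<Sum>k<Suc n. sc (c k) (e k)) |z c. z \<in> Z}" (is "?l = ?r")
  proof (intro equalityI subsetI)
    fix x assume "x \<in> ?l"
    then obtain k z c where kz: "x - sc k (e n) = z + (\<Sum>k<n. sc (c k) (e k))" "z \<in> Z"
      unfolding Suc by blast
    have "(\<Sum>i<Suc n. sc ((c(n := k)) i) (e i)) = (\<Sum>k<n. sc (c k) (e k)) + sc k (e n)" by simp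
    then have "x = z + (\<Sum>i<Suc n. sc ((c(n := k)) i) (e i))" using kz by (simp add: diff_eq_eq ac_simps)
    then show "x \<in> ?r" using kz(2) by blast
  next
    fix x assume "x \<in> ?r"
    then obtain z c where x: "x = z + (\<Sum>k<Suc n. sc (c k) (e k))" "z \<in> Z" by blast
    then have "x - sc (c n) (e n) = z + (\<Sum>k<n. sc (c k) (e k))" by simp
    then show "x \<in> ?l" unfolding Suc using x(2) by blast
  qed
  finally show ?case .
qed

lemma dim_span_indep_mod:
  assumes "subspace Z" "indep_mod Z n e"
  shows "dim (span (Z \<union> e ` {..<n})) = dim Z + n"
  using assms(2)
proof (induction n)
  case 0
  then show ?case by simp
next
  case (Suc n)
  have eq: "Z \<union> e ` {..<Suc n} = insert (e n) (Z \<union> e ` {..<n})" by (auto simp: lessThan_Suc)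
  have "e n \<notin> span (Z \<union> e ` {..<n})"
  proof
    assume "e n \<in> span (Z \<union> e ` {..<n})"
    then obtain z c where zc: "e n = z + (\<Sum>k<n. sc (c k) (e k))" "z \<in> Z"
      unfolding span_Un_image[OF assms(1)] by blast
    have "(\<Sum>k<Suc n. sc (((\<lambda>k. - c k)(n := 1)) k) (e k)) = e n - (\<Sum>k<n. sc (c k) (e k))"
      by (simp add: sum_negf)
    also have "\<dots> = z" using zc(1) by simp
    finally have "((\<lambda>k. - c k)(n := 1)) n = 0"
      using Suc.prems zc(2) unfolding indep_mod_def by (metis lessI)
    then show False by simp
  qed
  moreover have "indep_mod Z n e" using Suc.prems by (rule indep_mod_mono) simp
  ultimately show ?case using Suc.IH by (simp add: eq dim_insert)
qed

lemma cyc_eq_span: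
  assumes h: "lin h" and Z: "stable h Z" and mu: "lead_coeff \<mu> = 1" "pa h \<mu> v \<in> Z"
  shows "cyc Z h v = span (Z \<union> (\<lambda>k. (h ^^ k) v) ` {..<degree \<mu>})" (is "_ = ?S")
proof (intro equalityI subsetI)
  have sZ: "subspace Z" using Z by (rule stable_subspace)
  fix w assume "w \<in> cyc Z h v"
  then obtain f z where w: "w = pa h f v + z" "z \<in> Z" unfolding cyc_def by blast
  define r where "r = f mod \<mu>"
  have mu0: "\<mu> \<noteq> 0" using mu by auto
  have f: "f = f div \<mu> * \<mu> + r" unfolding r_def by simp
  have "pa h f v = pa h (f div \<mu> * \<mu> + r) v" using f by simp
  also have "\<dots> = pa h (f div \<mu>) (pa h \<mu> v) + pa h r v" by (simp only: pa_add pa_mult[OF h])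
  finally have fv: "pa h f v = pa h (f div \<mu>) (pa h \<mu> v) + pa h r v" .
  have "pa h r v = (\<Sum>k\<le>degree r. sc (coeff r k) ((h ^^ k) v))" by (simp add: poly_op_def)
  also have "\<dots> \<in> ?S"
  proof (rule span_sum)
    fix k assume k: "k \<in> {..degree r}"
    show "sc (coeff r k) ((h ^^ k) v) \<in> ?S"
    proof (cases "r = 0")
      case True then show ?thesis by (simp add: span_zero)
    next
      case False
      then have "degree r < degree \<mu>" unfolding r_def using mu0 by (metis degree_mod_less)
      then show ?thesis using k by (intro span_scale span_base) auto
    qed
  qed
  finally have "pa h r v \<in> ?S" .
  moreover have "pa h (f div \<mu>) (pa h \<mu> v) \<in> ?S" "z \<in> ?S"
    using stable_pa[OF h Z] mu w by (auto intro: span_base)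
  ultimately show "w \<in> ?S" unfolding w fv by (simp add: span_add)
next
  fix w assume "w \<in> ?S"
  moreover have "(h ^^ k) v \<in> cyc Z h v" for k
    using cyc_pa[OF stable_subspace[OF Z], of h "[:0,1:]^k" v] h by (simp add: pa_X_power)
  then have "?S \<subseteq> cyc Z h v"
    by (intro span_minimal subspace_cyc stable_subspace[OF Z]) (use subset_cyc in auto)
  ultimately show "w \<in> cyc Z h v" by blast
qed

text \<open>More than \<open>dimension\<close> vectors cannot be independent modulo
  \<open>Z\<close>; a relation among the powers of \<open>h\<close> applied to \<open>v\<close> is
  an annihilating polynomial, made monic by scaling.\<close>

lemma exists_annihilator:
  assumes h: "lin h" and Z: "stable h Z"
  shows "\<exists>\<mu>. lead_coeff \<mu> = 1 \<and> pa h \<mu> v \<in> Z"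
proof -
  have "\<not> indep_mod Z (Suc dimension) (\<lambda>k. (h ^^ k) v)"
  proof
    assume "indep_mod Z (Suc dimension) (\<lambda>k. (h ^^ k) v)"
    from dim_span_indep_mod[OF stable_subspace[OF Z] this] show False
      using dim_subset_UNIV by (metis Suc_n_not_le_n add_leD2)
  qed
  then obtain c k where c: "(\<Sum>k<Suc dimension. sc (c k) ((h ^^ k) v)) \<in> Z" "k < Suc dimension" "c k \<noteq> 0"
    unfolding indep_mod_def by blast
  define f where "f = (\<Sum>k<Suc dimension. monom (c k) k)"
  have cf: "coeff f k = c k" using c(2) by (simp add: f_def coeff_sum if_distrib cong: if_cong)
  have "pa h f v \<in> Z" using c(1) by (simp add: f_def pa_sum pa_monom[OF h] del: sum.lessThan_Suc)
  then have "pa h (Polynomial.smult (inverse (lead_coeff f)) f) v \<in> Z"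
    using Z by (simp add: pa_smult stable_subspace subspace_scale)
  moreover have "f \<noteq> 0" using cf c(3) by auto
  then have "lead_coeff (Polynomial.smult (inverse (lead_coeff f)) f) = 1" by simp
  ultimately show ?thesis by blast
qed

text \<open>The degree of the minimal polynomial of the class of \<open>v\<close> modulo
  \<open>Z\<close>, which is also the dimension of the cyclic module it generates
  (\<open>dim_cyc\<close>).\<close>

definition min_deg :: "'u set \<Rightarrow> ('u \<Rightarrow> 'u) \<Rightarrow> 'u \<Rightarrow> nat" where
  "min_deg Z h v = (LEAST r. \<exists>\<mu>. lead_coeff \<mu> = 1 \<and> degree \<mu> = r \<and> pa h \<mu> v \<in> Z)"

lemma min_deg_ex:
  assumes "lin h" "stable h Z"
  obtains \<mu> where "lead_coeff \<mu> = 1" "degree \<mu> = min_deg Z h v" "pa h \<mu> v \<in> Z"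
proof -
  have "\<exists>r \<mu>. lead_coeff \<mu> = 1 \<and> degree \<mu> = r \<and> pa h \<mu> v \<in> Z"
    using exists_annihilator[OF assms] by blast
  from LeastI_ex[OF this] show thesis using that unfolding min_deg_def by blast
qed

lemma min_deg_le:
  assumes "subspace Z" "f \<noteq> 0" "pa h f v \<in> Z"
  shows "min_deg Z h v \<le> degree f"
  unfolding min_deg_def
proof (rule Least_le, intro exI conjI)
  let ?g = "Polynomial.smult (inverse (lead_coeff f)) f"
  show "lead_coeff ?g = 1" "degree ?g = degree f" "pa h ?g v \<in> Z"
    using assms by (auto simp: pa_smult subspace_scale)
qed

lemma indep_mod_min_deg:
  assumes h: "lin h" and Z: "subspace Z"
  shows "indep_mod Z (min_deg Z h v) (\<lambda>k. (h ^^ k) v)"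
  unfolding indep_mod_def
proof (intro allI impI, rule ccontr)
  let ?r = "min_deg Z h v"
  fix c k assume c: "(\<Sum>k<?r. sc (c k) ((h ^^ k) v)) \<in> Z" and k: "k < ?r" "c k \<noteq> 0"
  define f where "f = (\<Sum>k<?r. monom (c k) k)"
  have cf: "coeff f l = (if l < ?r then c l else 0)" for l
    by (simp add: f_def coeff_sum if_distrib cong: if_cong)
  have "degree f < ?r" using k cf by (intro degree_lessI) auto
  moreover have "f \<noteq> 0" using cf[of k] k by auto
  moreover have "pa h f v \<in> Z" using c by (simp add: f_def pa_sum pa_monom[OF h])
  ultimately show False using min_deg_le[OF Z, of f h v] by simp
qed

lemma dim_cyc:
  assumes "lin h" "stable h Z"
  shows "dim (cyc Z h v) = dim Z + min_deg Z h v"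
proof -
  obtain \<mu> where "lead_coeff \<mu> = 1" "degree \<mu> = min_deg Z h v" "pa h \<mu> v \<in> Z"
    using min_deg_ex[OF assms] .
  then show ?thesis
    using cyc_eq_span[OF assms, of \<mu> v] dim_span_indep_mod[OF stable_subspace[OF assms(2)] indep_mod_min_deg[OF assms(1) stable_subspace[OF assms(2)], of v]]
    by simp
qed

end

context fd_space
begin

subsection \<open>Vectors depending polynomially on a parameter\<close>

text \<open>Vector-valued polynomials in \<open>c\<close>, built by the Horner scheme, so that
  polynomial dependence can be stated without coordinates.\<close>

inductive polyvec :: "('f \<Rightarrow> 'u) \<Rightarrow> bool" where
  const: "polyvec (\<lambda>c. w)"
| horner: "polyvec g \<Longrightarrow> polyvec (\<lambda>c. w + sc c (g c))"

lemma polyvec_add: "polyvec g \<Longrightarrow> polyvec g' \<Longrightarrow> polyvec (\<lambda>c. g c + g' c)"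
proof (induction g arbitrary: g' rule: polyvec.induct)
  case (const w)
  from const show ?case
  proof cases
    case (const w')
    then show ?thesis using polyvec.const[of "w + w'"] by simp
  next
    case (horner h w')
    then show ?thesis using polyvec.horner[of h "w + w'"] by (simp add: add.assoc)
  qed
next
  case (horner g w)
  from \<open>polyvec g'\<close> show ?case
  proof cases
    case (const w')
    then show ?thesis using polyvec.horner[OF horner.hyps, of "w + w'"] by (simp add: ac_simps)
  next
    case h: (horner h w')
    have "polyvec (\<lambda>c. (w + w') + sc c (g c + h c))"
      by (intro polyvec.horner horner.IH h)
    moreover have "(\<lambda>c. (w + w') + sc c (g c + h c)) = (\<lambda>c. w + sc c (g c) + g' c)"
      using h(1) by (simp add: fun_eq_iff scale_right_distrib ac_simps)
    ultimately show ?thesis by simp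
  qed
qed

lemma polyvec_lin: "lin h \<Longrightarrow> polyvec g \<Longrightarrow> polyvec (\<lambda>c. h (g c))"
  by (rotate_tac 1, induction g rule: polyvec.induct)
    (auto simp: lin_add lin_scale intro: polyvec.intros)

definition functional :: "('u \<Rightarrow> 'f) \<Rightarrow> bool" where
  "functional l \<longleftrightarrow> (\<forall>u w. l (u + w) = l u + l w) \<and> (\<forall>c u. l (sc c u) = c * l u)"

lemma functional_0: "functional l \<Longrightarrow> l 0 = 0"
  unfolding functional_def by (metis add_cancel_right_right)

lemma functional_sum: "functional l \<Longrightarrow> l (sum g A) = (\<Sum>a\<in>A. l (g a))"
  by (induction A rule: infinite_finite_induct) (auto simp: functional_def functional_0)

lemma polyvec_functional:
  "polyvec g \<Longrightarrow> functional l \<Longrightarrow> \<exists>P. \<forall>c. l (g c) = poly P c"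
proof (induction g rule: polyvec.induct)
  case (const w)
  show ?case by (rule exI[of _ "[:l w:]"]) simp
next
  case (horner g w)
  then obtain P where "\<forall>c. l (g c) = poly P c" by blast
  then show ?case using horner.prems
    by (intro exI[of _ "pCons (l w) P"]) (simp add: functional_def)
qed

lemma exists_functional:
  assumes Z: "subspace Z" and e: "e \<notin> Z"
  shows "\<exists>l. functional l \<and> (\<forall>z\<in>Z. l z = 0) \<and> l e = 1"
proof -
  obtain B where B: "B \<subseteq> Z" "independent B" "Z \<subseteq> span B" "card B = dim Z"
    using basis_exists by metis
  have sB: "span B = Z" using B Z by (metis span_minimal subset_antisym)
  have ind: "independent (insert e B)" using B(2) e sB by (metis independent_insertI)
  define C where "C = extend_basis (insert e B)"
  have C: "independent C" "insert e B \<subseteq> C" "span C = UNIV"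
    using ind extend_basis_superset[OF ind] by (simp_all add: C_def independent_extend_basis)
  define l where "l w = representation C w e" for w
  have "functional l" unfolding functional_def l_def
    using C by (simp add: representation_add representation_scale)
  moreover have "l z = 0" if "z \<in> Z" for z
  proof -
    have "representation C z = representation B z"
      using C(1) that C(2) by (intro representation_extend) (auto simp: sB)
    moreover have "e \<notin> B" using e B by blast
    ultimately show ?thesis unfolding l_def using representation_ne_zero by metis
  qed
  moreover have "l e = 1" unfolding l_def using C by (simp add: representation_basis)
  ultimately show ?thesis by blast
qed

text \<open>Independence modulo \<open>Z\<close> keeps \<open>e i\<close> out of the span of
  \<open>Z\<close> and the other vectors, so some functional vanishes on that span and is 1 at
  \<open>e i\<close>.\<close>

lemma exists_dual_functionals:
  assumes Z: "subspace Z" and ind: "indep_mod Z n e"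
  shows "\<exists>l. \<forall>i<n. functional (l i) \<and> (\<forall>z\<in>Z. l i z = 0) \<and> (\<forall>k<n. l i (e k) = (if i = k then 1 else 0))"
proof -
  have "\<exists>l. functional l \<and> (\<forall>z\<in>Z. l z = 0) \<and> (\<forall>k<n. l (e k) = (if i = k then 1 else 0))" if i: "i < n" for i
  proof -
    \<comment> \<open>Replacing \<open>e i\<close> by zero instead of removing it keeps the index
      range, so that \<open>span_Un_image\<close> applies.\<close>
    define e' where "e' k = (if k = i then 0 else e k)" for k
    let ?Z = "span (Z \<union> e' ` {..<n})"
    have "e i \<notin> ?Z"
    proof
      assume "e i \<in> ?Z"
      then obtain z c where zc: "e i = z + (\<Sum>k<n. sc (c k) (e' k))" "z \<in> Z"
        unfolding span_Un_image[OF Z] by blast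
      define f where "f k = (if k = i then 1 else - c k)" for k
      have "(\<Sum>k<n. sc (f k) (e k)) = e i + (\<Sum>k\<in>{..<n} - {i}. sc (f k) (e k))"
        by (subst sum.remove[of _ i]) (use i in \<open>auto simp: f_def\<close>)
      also have "(\<Sum>k\<in>{..<n} - {i}. sc (f k) (e k)) = - (\<Sum>k\<in>{..<n} - {i}. sc (c k) (e' k))"
        by (simp add: f_def e'_def sum_negf[symmetric])
      also have "(\<Sum>k\<in>{..<n} - {i}. sc (c k) (e' k)) = (\<Sum>k<n. sc (c k) (e' k))"
        by (rule sum.mono_neutral_left) (auto simp: e'_def)
      finally have "(\<Sum>k<n. sc (f k) (e k)) = z" using zc(1) by (simp add: diff_eq_eq)
      then have "f i = 0" using ind zc(2) i unfolding indep_mod_def by blast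
      then show False by (simp add: f_def)
    qed
    from exists_functional[OF subspace_span this] obtain l where
      l: "functional l" "\<forall>z\<in>?Z. l z = 0" "l (e i) = 1" by blast
    have "e k \<in> ?Z" if "k < n" "k \<noteq> i" for k
      using that by (intro span_base) (auto simp: e'_def image_iff)
    moreover have "z \<in> ?Z" if "z \<in> Z" for z using that by (intro span_base) auto
    ultimately show ?thesis using l by (intro exI[of _ l]) auto
  qed
  then show ?thesis by metis
qed

text \<open>With dual functionals at \<open>0\<close>, the determinant of the coordinate matrix is a polynomial in
  \<open>c\<close> with value \<open>1\<close> at \<open>0\<close>.\<close>
lemma finite_not_indep_mod:
  assumes Z: "subspace Z" and g: "\<And>k. k < n \<Longrightarrow> polyvec (g k)"
    and ind: "indep_mod Z n (\<lambda>k. g k 0)"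
  shows "finite {c. \<not> indep_mod Z n (\<lambda>k. g k c)}"
proof -
  obtain l where l: "\<And>i. i < n \<Longrightarrow> functional (l i)" "\<And>i z. i < n \<Longrightarrow> z \<in> Z \<Longrightarrow> l i z = 0"
    "\<And>i k. i < n \<Longrightarrow> k < n \<Longrightarrow> l i (g k 0) = (if i = k then 1 else 0)"
    using exists_dual_functionals[OF Z ind] by metis
  define P where "P i k = (SOME P. \<forall>c. l i (g k c) = poly P c)" for i k
  have P: "l i (g k c) = poly (P i k) c" if "i < n" "k < n" for i k c
    using someI_ex[OF polyvec_functional[OF g l(1), OF that(2,1)]] unfolding P_def by blast
  define M where "M = mat n n (\<lambda>(i, k). P i k)"
  have hom: "comm_ring_hom (\<lambda>p. poly p c)" for c :: 'f by unfold_locales auto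
  have detc: "poly (det M) c = det (map_mat (\<lambda>p. poly p c) M)" for c
    by (rule comm_ring_hom.hom_det[OF hom, symmetric])
  have "map_mat (\<lambda>p. poly p 0) M = 1\<^sub>m n"
    using l(3) P[of _ _ 0] by (intro eq_matI) (auto simp: M_def)
  then have "poly (det M) 0 = 1" using detc[of 0] by simp
  then have "det M \<noteq> 0" by auto
  then have fin: "finite {c. poly (det M) c = 0}" by (rule poly_roots_finite)
  \<comment> \<open>The functionals vanish on \<open>Z\<close>, so they turn a relation modulo
    \<open>Z\<close> into a kernel vector of the coordinate matrix at \<open>c\<close>.\<close>
  have "indep_mod Z n (\<lambda>k. g k c)" if c: "poly (det M) c \<noteq> 0" for c
    unfolding indep_mod_def
  proof (intro allI impI)
    fix x k assume x: "(\<Sum>k<n. sc (x k) (g k c)) \<in> Z" and k: "k < n"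
    let ?M = "map_mat (\<lambda>p. poly p c) M"
    have MC: "?M \<in> carrier_mat n n" by (simp add: M_def)
    have "?M *\<^sub>v vec n x = 0\<^sub>v n"
    proof (rule eq_vecI)
      fix i assume "i < dim_vec (0\<^sub>v n :: 'f vec)"
      then have i: "i < n" by simp
      have "(?M *\<^sub>v vec n x) $ i = (\<Sum>k<n. poly (P i k) c * x k)"
        using i by (simp add: M_def scalar_prod_def atLeast0LessThan)
      also have "\<dots> = (\<Sum>k<n. l i (sc (x k) (g k c)))"
        using i P l(1) by (intro sum.cong) (auto simp: functional_def mult.commute)
      also have "\<dots> = l i (\<Sum>k<n. sc (x k) (g k c))" using functional_sum l(1) i by metis
      also have "\<dots> = 0" using l(2) i x by blast
      finally show "(?M *\<^sub>v vec n x) $ i = 0\<^sub>v n $ i" using i by simp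
    qed (simp add: M_def)
    then have "vec n x = 0\<^sub>v n"
      using det_0_iff_vec_prod_zero_field[OF MC] c detc[of c] vec_carrier[of n x] by metis
    then show "x k = 0" using k by (metis index_vec index_zero_vec(1))
  qed
  then have "{c. \<not> indep_mod Z n (\<lambda>k. g k c)} \<subseteq> {c. poly (det M) c = 0}" by blast
  then show ?thesis using fin finite_subset by blast
qed

abbreviation perturb :: "('u \<Rightarrow> 'u) \<Rightarrow> 'f \<Rightarrow> ('u \<Rightarrow> 'u) \<Rightarrow> 'u \<Rightarrow> 'u" where
  "perturb y c b \<equiv> (\<lambda>u. y u + sc c (b u))"

lemma lin_perturb: "lin y \<Longrightarrow> lin b \<Longrightarrow> lin (perturb y c b)"
  by (intro lin_plus lin_smult)

text \<open>The Horner recursion sends the remainder h to y h + b f(y) v + c b h. Since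
  \<open>b\<close> commutes with \<open>y\<close>, its value at 0 follows the product rule, so the
  derivative of f(y + c b) v at c = 0 is f'(y) b v.\<close>

lemma pa_perturb:
  assumes y: "lin y" and b: "lin b" and comm: "\<And>u. b (y u) = y (b u)"
  shows "\<exists>h. polyvec h \<and> h 0 = pa y (pderiv f) (b v) \<and>
    (\<forall>c. pa (perturb y c b) f v = pa y f v + sc c (h c))"
proof (induction f)
  case 0
  show ?case by (rule exI[of _ "\<lambda>c. 0"]) (auto intro: polyvec.const)
next
  case (pCons a f)
  then obtain h where h: "polyvec h" "h 0 = pa y (pderiv f) (b v)"
    "\<And>c. pa (perturb y c b) f v = pa y f v + sc c (h c)" by blast
  let ?h = "\<lambda>c. y (h c) + (b (pa y f v) + sc c (b (h c)))"
  have "polyvec ?h"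
    by (rule polyvec_add[OF polyvec_lin[OF y h(1)] polyvec.horner[OF polyvec_lin[OF b h(1)]]])
  moreover have "?h 0 = pa y (pderiv (pCons a f)) (b v)"
    using h(2) pa_commute[OF y b] comm by (simp add: pderiv_pCons pa_add pa_pCons y)
  moreover have "pa (perturb y c b) (pCons a f) v = pa y (pCons a f) v + sc c (?h c)" for c
    using y b by (simp add: pa_pCons lin_perturb h(3) lin_add lin_scale scale_right_distrib ac_simps)
  ultimately show ?case by blast
qed

lemma polyvec_funpow_perturb:
  assumes "lin y" "lin b" "\<And>u. b (y u) = y (b u)"
  shows "polyvec (\<lambda>c. (perturb y c b ^^ k) v)"
proof -
  obtain h where h: "polyvec h"
    "\<And>c. pa (perturb y c b) ([:0,1:] ^ k) v = pa y ([:0,1:] ^ k) v + sc c (h c)"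
    using pa_perturb[OF assms, of "[:0,1:] ^ k" v] by blast
  have "(\<lambda>c. (perturb y c b ^^ k) v) = (\<lambda>c. pa y ([:0,1:] ^ k) v + sc c (h c))"
    using h(2) by (simp add: pa_X_power[symmetric] lin_perturb assms)
  then show ?thesis using polyvec.horner[OF h(1)] by simp
qed

text \<open>If the minimal polynomial \<open>\<mu>\<close> of \<open>v\<close> keeps its degree along the line \<open>y + c b\<close>, then
  differentiating the equation \<open>\<mu>\<^sub>c(y + c b) v = 0\<close> at \<open>c = 0\<close> expresses \<open>\<mu>'(y) b v\<close> through the
  powers of \<open>y\<close>.\<close>
lemma pderiv_mem_cyc:
  assumes y: "lin y" and b: "lin b" and comm: "\<And>u. b (y u) = y (b u)"
    and Z: "stable y Z" "stable b Z"
    and \<mu>: "lead_coeff \<mu> = 1" "degree \<mu> = min_deg Z y v" "pa y \<mu> v \<in> Z"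
    and inf: "infinite {c. min_deg Z (perturb y c b) v \<le> min_deg Z y v}"
  shows "pa y (pderiv \<mu>) (b v) \<in> cyc Z y v"
proof -
  define r where "r = min_deg Z y v"
  have sZ: "subspace Z" using Z(1) by (rule stable_subspace)
  obtain h where h: "polyvec h" "h 0 = pa y (pderiv \<mu>) (b v)"
    "\<And>c. pa (perturb y c b) \<mu> v = pa y \<mu> v + sc c (h c)"
    using pa_perturb[OF y b comm] by blast
  \<comment> \<open>The first \<open>r\<close> vectors are the powers of the perturbed operator
    applied to \<open>v\<close>, the last is the remainder of \<open>\<mu>\<close>. Were they
    independent modulo \<open>Z\<close> at c = 0, they would be so for almost all c, in particular
    for some c \<noteq> 0 at which the degree has not grown.\<close>
  define g where "g k c = (if k < r then (perturb y c b ^^ k) v else h c)" for k c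
  have pg: "polyvec (g k)" for k
  proof -
    have "g k = (if k < r then (\<lambda>c. (perturb y c b ^^ k) v) else h)" by (simp add: g_def fun_eq_iff)
    then show ?thesis using polyvec_funpow_perturb[OF y b comm, of k v] h(1) by simp
  qed
  have gsum: "(\<Sum>k<Suc r. sc (x k) (g k c)) =
      (\<Sum>k<r. sc (x k) ((perturb y c b ^^ k) v)) + sc (x r) (h c)" for x c
    by (simp add: g_def)
  have "\<not> indep_mod Z (Suc r) (\<lambda>k. g k 0)"
  proof
    assume "indep_mod Z (Suc r) (\<lambda>k. g k 0)"
    from finite_not_indep_mod[OF sZ pg this]
    have "finite ({0} \<union> {c. \<not> indep_mod Z (Suc r) (\<lambda>k. g k c)})" by simp
    from Diff_infinite_finite[OF this inf]
    have "{c. min_deg Z (perturb y c b) v \<le> min_deg Z y v} -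
        ({0} \<union> {c. \<not> indep_mod Z (Suc r) (\<lambda>k. g k c)}) \<noteq> {}"
      by (rule infinite_imp_nonempty)
    then obtain c where c: "min_deg Z (perturb y c b) v \<le> r" "c \<noteq> 0"
        "indep_mod Z (Suc r) (\<lambda>k. g k c)" unfolding r_def by blast
    let ?y = "perturb y c b"
    have ly: "lin ?y" using y b by (rule lin_perturb)
    have sy: "stable ?y Z" using Z by (auto simp: stable_def subspace_add subspace_scale)
    obtain \<nu> where \<nu>: "lead_coeff \<nu> = 1" "degree \<nu> = min_deg Z ?y v" "pa ?y \<nu> v \<in> Z"
      using min_deg_ex[OF ly sy] by blast
    have n0: "\<nu> \<noteq> 0" using \<nu>(1) by auto
    \<comment> \<open>A power of X raises the degree of \<open>\<nu>\<close> to exactly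
      \<open>r\<close>, so that the difference from \<open>\<mu>\<close> has degree below
      \<open>r\<close>.\<close>
    define \<nu>' where "\<nu>' = [:0,1:] ^ (r - degree \<nu>) * \<nu>"
    have dX: "degree ([:0,1:] ^ n :: 'f poly) = n" for n by (simp add: degree_power_eq)
    have lX: "lead_coeff ([:0,1:] ^ n :: 'f poly) = 1" for n by (simp add: lead_coeff_power)
    have \<nu>': "lead_coeff \<nu>' = 1" "degree \<nu>' = r" "pa ?y \<nu>' v \<in> Z"
    proof -
      show "lead_coeff \<nu>' = 1" using \<nu>(1) lX unfolding \<nu>'_def by (simp only: lead_coeff_mult) simp
      show "degree \<nu>' = r" unfolding \<nu>'_def using n0 c(1) \<nu>(2)
        by (subst degree_mult_eq) (auto simp: dX)
      show "pa ?y \<nu>' v \<in> Z" unfolding \<nu>'_def using \<nu>(3) stable_pa[OF ly sy] by (simp add: pa_mult[OF ly])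
    qed
    define \<delta> where "\<delta> = \<mu> - \<nu>'"
    have \<delta>0: "coeff \<delta> k = 0" if "k \<ge> r" for k
    proof (cases "k = r")
      case True
      then show ?thesis using \<mu>(1,2) \<nu>'(1,2) by (simp add: \<delta>_def r_def)
    next
      case False
      then show ?thesis using that \<mu>(2) \<nu>'(2) by (simp add: \<delta>_def r_def coeff_eq_0)
    qed
    have "pa ?y \<delta> v = (\<Sum>k\<le>max r (degree \<delta>). sc (coeff \<delta> k) ((?y ^^ k) v))"
      by (rule pa_eq_sum) simp
    also have "\<dots> = (\<Sum>k<r. sc (coeff \<delta> k) ((?y ^^ k) v))"
      by (rule sum.mono_neutral_right) (use \<delta>0 in auto)
    finally have d: "pa ?y \<delta> v = (\<Sum>k<r. sc (coeff \<delta> k) ((?y ^^ k) v))" .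
    \<comment> \<open>The coefficients of the forbidden relation: the combination equals \<nu>'(y +
      c b) v - \<mu>(y) v, which lies in \<open>Z\<close>, and its last coefficient is c \<noteq>
      0.\<close>
    let ?x = "\<lambda>k. if k < r then - coeff \<delta> k else c"
    have "(\<Sum>k<Suc r. sc (?x k) (g k c)) = sc c (h c) - pa ?y \<delta> v"
      by (simp add: gsum d sum_negf del: sum.lessThan_Suc)
    also have "\<dots> = pa ?y \<nu>' v - pa y \<mu> v" by (simp add: \<delta>_def pa_diff h(3))
    also have "\<dots> \<in> Z" using \<nu>'(3) \<mu>(3) sZ by (rule subspace_diff[rotated])
    finally have "(\<Sum>k<Suc r. sc (?x k) (g k c)) \<in> Z" .
    from c(3)[unfolded indep_mod_def, rule_format, OF this, of r]
    show False using c(2) by simp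
  qed
  then obtain x k where x: "(\<Sum>k<Suc r. sc (x k) (g k 0)) \<in> Z" "k < Suc r" "x k \<noteq> 0"
    unfolding indep_mod_def by blast
  have y0: "perturb y 0 b = y" by (simp add: fun_eq_iff)
  from x(1) have x1: "(\<Sum>k<r. sc (x k) ((y ^^ k) v)) + sc (x r) (h 0) \<in> Z"
    unfolding gsum by (simp add: y0)
  \<comment> \<open>Otherwise the relation would involve only powers of \<open>y\<close> below the
    minimal degree.\<close>
  have xr: "x r \<noteq> 0"
  proof
    assume 0: "x r = 0"
    then have "(\<Sum>k<r. sc (x k) ((y ^^ k) v)) \<in> Z" using x1 by simp
    then have "\<forall>k<r. x k = 0" using indep_mod_min_deg[OF y sZ, of v] unfolding indep_mod_def r_def by blast
    then show False using x(2,3) 0 by (metis less_Suc_eq)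
  qed
  have "(\<Sum>k<r. sc (x k) ((y ^^ k) v)) = pa y (\<Sum>k<r. monom (x k) k) v"
    by (simp add: pa_sum pa_monom[OF y])
  then have "(\<Sum>k<r. sc (x k) ((y ^^ k) v)) \<in> cyc Z y v" using cyc_pa[OF sZ] by metis
  then have "sc (x r) (h 0) \<in> cyc Z y v"
    using x1 subset_cyc[of Z y v] subspace_cyc[OF sZ, of y v] by (metis add_diff_cancel_left' subsetD subspace_diff)
  then have "sc (inverse (x r)) (sc (x r) (h 0)) \<in> cyc Z y v"
    using subspace_cyc[OF sZ] subspace_scale by blast
  then show ?thesis using xr h(2) by simp
qed

end

section \<open>Commuting operators: some operator acts cyclically on a uniserial module\<close>

section \<open>Uniserial modules over commuting operators\<close>

text \<open>\<open>L\<close> will be the set of operators of the span of x and the zero eigenspace.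
  Closure under h + c k provides the lines along which a generic operator is sought.\<close>

locale comm_ops = fd_space sc for sc :: "'f::field \<Rightarrow> 'u::ab_group_add \<Rightarrow> 'u" +
  fixes L :: "('u \<Rightarrow> 'u) set"
  assumes L_lin: "h \<in> L \<Longrightarrow> lin h"
    and L_comm: "h \<in> L \<Longrightarrow> k \<in> L \<Longrightarrow> h (k u) = k (h u)"
    and L_perturb: "h \<in> L \<Longrightarrow> k \<in> L \<Longrightarrow> (\<lambda>u. h u + sc c (k u)) \<in> L"
    and L_nonempty: "L \<noteq> {}"
begin

definition Lstable :: "'u set \<Rightarrow> bool" where
  "Lstable N \<longleftrightarrow> subspace N \<and> (\<forall>h\<in>L. \<forall>w\<in>N. h w \<in> N)"

text \<open>Uniseriality of V/W for the operators in \<open>L\<close>, expressed through the stable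
  subspaces between \<open>W\<close> and \<open>V\<close>.\<close>

definition layer :: "'u set \<Rightarrow> 'u set \<Rightarrow> bool" where
  "layer W V \<longleftrightarrow> Lstable W \<and> Lstable V \<and> W \<subset> V \<and>
    (\<forall>N N'. Lstable N \<longrightarrow> Lstable N' \<longrightarrow> W \<subseteq> N \<longrightarrow> N \<subseteq> V \<longrightarrow> W \<subseteq> N' \<longrightarrow> N' \<subseteq> V \<longrightarrow> N \<subseteq> N' \<or> N' \<subseteq> N)"

lemma Lstable_stable: "Lstable N \<Longrightarrow> h \<in> L \<Longrightarrow> stable h N"
  unfolding Lstable_def stable_def by blast

lemma Lstable_subspace: "Lstable N \<Longrightarrow> subspace N"
  unfolding Lstable_def by blast

lemma Lstable_Int: "Lstable N \<Longrightarrow> Lstable N' \<Longrightarrow> Lstable (N \<inter> N')"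
  unfolding Lstable_def by (auto simp: subspace_inter)

lemma pa_L_comm: "y \<in> L \<Longrightarrow> b \<in> L \<Longrightarrow> pa y f (b u) = b (pa y f u)"
  by (rule pa_commute) (auto simp: L_lin L_comm)

lemma Lstable_vimage_pa:
  assumes "y \<in> L" "Lstable Z" "Lstable V"
  shows "Lstable {u\<in>V. pa y f u \<in> Z}"
  using assms subspace_vimage[OF lin_pa[OF L_lin] Lstable_subspace Lstable_subspace]
  by (auto simp: Lstable_def pa_L_comm)

lemma Lstable_image_pa_add:
  assumes y: "y \<in> L" and V: "Lstable V" and W: "Lstable W"
  shows "Lstable {pa y f u + w |u w. u \<in> V \<and> w \<in> W}"
proof -
  have "{pa y f u + w |u w. u \<in> V \<and> w \<in> W} = {a + w |a w. a \<in> pa y f ` V \<and> w \<in> W}" by blast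
  moreover have "subspace {a + w |a w. a \<in> pa y f ` V \<and> w \<in> W}"
    using assms by (intro subspace_sums subspace_image lin_pa L_lin Lstable_subspace)
  moreover have "h (pa y f u + w) = pa y f (h u) + h w" if "h \<in> L" for h u w
    using that y by (simp add: pa_L_comm L_lin lin_add)
  ultimately show ?thesis using V W unfolding Lstable_def
    by (smt (verit) mem_Collect_eq)
qed

text \<open>Take a proper submodule of largest dimension: being comparable with every other one, it
  contains them all.\<close>

lemma layer_max:
  assumes "layer W V"
  obtains V' where "Lstable V'" "W \<subseteq> V'" "V' \<subset> V"
    "\<And>N. Lstable N \<Longrightarrow> W \<subseteq> N \<Longrightarrow> N \<subseteq> V \<Longrightarrow> N \<noteq> V \<Longrightarrow> N \<subseteq> V'"
proof -
  let ?P = "\<lambda>N. Lstable N \<and> W \<subseteq> N \<and> N \<subset> V"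
  have "?P W" using assms unfolding layer_def by blast
  moreover have "\<forall>N. ?P N \<longrightarrow> dim N < Suc dimension" using dim_subset_UNIV by (auto simp: less_Suc_eq_le)
  ultimately have "\<exists>V'. ?P V' \<and> (\<forall>N. ?P N \<longrightarrow> dim N \<le> dim V')"
    by (rule ex_has_greatest_nat)
  then obtain V' where V': "?P V'" "\<And>N. ?P N \<Longrightarrow> dim N \<le> dim V'" by blast
  have "N \<subseteq> V'" if N: "Lstable N" "W \<subseteq> N" "N \<subseteq> V" "N \<noteq> V" for N
  proof -
    have "N \<subseteq> V' \<or> V' \<subseteq> N" using assms V'(1) N unfolding layer_def by blast
    moreover have "V' = N" if "V' \<subseteq> N"
      using that V'(2)[of N] N V'(1) by (intro subspace_dim_equal) (auto simp: Lstable_subspace)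
    ultimately show ?thesis by blast
  qed
  then show thesis using that V'(1) by blast
qed

lemma Lstable_cyc:
  assumes "y \<in> L" "Lstable Z" "\<And>b. b \<in> L \<Longrightarrow> b v \<in> cyc Z y v"
  shows "Lstable (cyc Z y v)"
  unfolding Lstable_def
proof (intro conjI ballI)
  show sub: "subspace (cyc Z y v)" using assms subspace_cyc Lstable_subspace by blast
  fix h w assume h: "h \<in> L" and "w \<in> cyc Z y v"
  then obtain f z where w: "w = pa y f v + z" "z \<in> Z" unfolding cyc_def by blast
  have "h w = pa y f (h v) + h z" using w h assms by (simp add: lin_add L_lin pa_L_comm)
  moreover have "pa y f (h v) \<in> cyc Z y v"
    using assms(1,2) assms(3)[OF h] by (intro stable_pa stable_cyc L_lin Lstable_stable)
  moreover have "h z \<in> cyc Z y v" using subset_cyc w(2) h assms(2) unfolding Lstable_def by blast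
  ultimately show "h w \<in> cyc Z y v" using sub by (simp add: subspace_add)
qed

text \<open>\<open>V/Z\<close> is simple, so the operators induce a field on it.\<close>
lemma simple_min_poly_irreducible:
  assumes y: "y \<in> L" and Z: "Lstable Z" and V: "Lstable V" and v: "v \<in> V" "v \<notin> Z"
    and simple: "\<And>u N. u \<in> V \<Longrightarrow> u \<notin> Z \<Longrightarrow> Lstable N \<Longrightarrow> Z \<subseteq> N \<Longrightarrow> u \<in> N \<Longrightarrow> V \<subseteq> N"
    and \<mu>: "lead_coeff \<mu> = 1" "degree \<mu> = min_deg Z y v" "pa y \<mu> v \<in> Z"
  shows "irreducible \<mu>"
proof (rule irreducibleI)
  have ly: "lin y" using y by (rule L_lin)
  have sZ: "subspace Z" using Z by (rule Lstable_subspace)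
  show m0: "\<mu> \<noteq> 0" using \<mu>(1) by auto
  show "\<not> is_unit \<mu>"
  proof
    assume "is_unit \<mu>"
    then obtain c where c: "\<mu> = [:c:]" by (auto simp: is_unit_poly_iff)
    then have "c = 1" using \<mu>(1) by (auto split: if_splits)
    then show False using c \<mu>(3) v(2) ly by simp
  qed
  fix f g assume fg: "\<mu> = f * g"
  then have n0: "f \<noteq> 0" "g \<noteq> 0" using m0 by auto
  then have deg: "degree f + degree g = min_deg Z y v" using \<mu>(2) fg by (simp add: degree_mult_eq)
  show "is_unit f \<or> is_unit g"
  proof (rule ccontr)
    assume "\<not> (is_unit f \<or> is_unit g)"
    then have "degree f > 0" "degree g > 0" using n0 by (auto simp: is_unit_iff_degree)
    then have lt: "degree f < min_deg Z y v" "degree g < min_deg Z y v" using deg by auto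
    then have gv: "pa y g v \<notin> Z" and fv: "pa y f v \<notin> Z" using min_deg_le[OF sZ] n0 not_le by blast+
    have "pa y g v \<in> V" using stable_pa[OF ly Lstable_stable[OF V y]] v(1) by blast
    moreover have "Lstable {u\<in>UNIV. pa y f u \<in> Z}"
      by (rule Lstable_vimage_pa[OF y Z]) (auto simp: Lstable_def)
    moreover have "Z \<subseteq> {u\<in>UNIV. pa y f u \<in> Z}"
      using stable_pa[OF ly Lstable_stable[OF Z y]] by blast
    moreover have "pa y g v \<in> {u\<in>UNIV. pa y f u \<in> Z}" using \<mu>(3) fg by (simp add: pa_mult[OF ly])
    \<comment> \<open>Simplicity: f(y) annihilates the nonzero class of g(y) v, hence every class of
      V/Z, including that of \<open>v\<close>, against the minimality of the degree.\<close>
    ultimately have "V \<subseteq> {u\<in>UNIV. pa y f u \<in> Z}" using simple[OF _ gv] by blast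
    then show False using fv v(1) by blast
  qed
qed

text \<open>A primitive element: \<open>y\<close> whose minimal polynomial has the largest degree.\<close>
lemma exists_cyclic_simple:
  assumes inf: "infinite (UNIV :: 'f set)" and perf: "perfect_field TYPE('f)"
    and Z: "Lstable Z" and V: "Lstable V" "Z \<subseteq> V" and v: "v \<in> V" "v \<notin> Z"
    and simple: "\<And>u N. u \<in> V \<Longrightarrow> u \<notin> Z \<Longrightarrow> Lstable N \<Longrightarrow> Z \<subseteq> N \<Longrightarrow> u \<in> N \<Longrightarrow> V \<subseteq> N"
  shows "\<exists>y\<in>L. cyc Z y v = V"
proof -
  have sZ: "subspace Z" using Z by (rule Lstable_subspace)
  obtain y0 where y0: "y0 \<in> L" using L_nonempty by blast
  have bd: "min_deg Z y v < Suc dimension" if "y \<in> L" for y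
    using dim_cyc[OF L_lin[OF that] Lstable_stable[OF Z that], of v] dim_subset_UNIV[of "cyc Z y v"] by simp
  have "\<exists>y. y \<in> L \<and> (\<forall>y'. y' \<in> L \<longrightarrow> min_deg Z y' v \<le> min_deg Z y v)"
    by (rule ex_has_greatest_nat[where P = "\<lambda>y. y \<in> L" and k = y0, OF y0]) (use bd in blast)
  then obtain y where y: "y \<in> L" and max: "\<And>y'. y' \<in> L \<Longrightarrow> min_deg Z y' v \<le> min_deg Z y v"
    by blast
  have ly: "lin y" using y by (rule L_lin)
  obtain \<mu> where \<mu>: "lead_coeff \<mu> = 1" "degree \<mu> = min_deg Z y v" "pa y \<mu> v \<in> Z"
    using min_deg_ex[OF ly Lstable_stable[OF Z y]] by blast
  have "irreducible \<mu>" by (rule simple_min_poly_irreducible[OF y Z V(1) v _ \<mu>]) (rule simple)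
  then have cop: "bezout_coprime \<mu> (pderiv \<mu>)" using perf by (rule perfect_field_bezout_coprime_pderiv[rotated])
  let ?C = "cyc Z y v"
  have "b v \<in> ?C" if b: "b \<in> L" for b
  proof (rule bezout_coprime_mem[OF ly cop stable_cyc[OF ly Lstable_stable[OF Z y]]])
    \<comment> \<open>The whole line through \<open>y\<close> lies in \<open>L\<close>, so by
      maximality the degree grows nowhere on it.\<close>
    have "{c. min_deg Z (perturb y c b) v \<le> min_deg Z y v} = UNIV" using max L_perturb[OF y b] by blast
    then show "pa y (pderiv \<mu>) (b v) \<in> ?C"
      using inf by (intro pderiv_mem_cyc[OF ly L_lin[OF b] _ _ _ \<mu>]) (auto simp: L_comm y b Lstable_stable Z)
    show "pa y \<mu> (b v) \<in> ?C"
      using \<mu>(3) Z b subset_cyc[of Z y v] unfolding pa_L_comm[OF y b] Lstable_def by blast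
  qed
  then have "Lstable ?C" using y Z by (intro Lstable_cyc)
  then have "V \<subseteq> ?C" using simple[OF v, of ?C] subset_cyc[of Z y v] cyc_self[OF ly sZ] by blast
  moreover have "?C \<subseteq> V" using cyc_subset[OF ly Lstable_stable[OF V(1) y] v(1) V(2)] .
  ultimately show ?thesis using y by blast
qed

text \<open>Being cyclic with generator \<open>v\<close> means that the first dim V - dim Z powers
  applied to \<open>v\<close> are independent modulo \<open>Z\<close>, a condition that fails for
  only finitely many parameters once it holds at c = 0.\<close>

lemma finite_not_cyc:
  assumes y: "y \<in> L" and b: "b \<in> L" and Z: "Lstable Z" and V: "Lstable V" "Z \<subseteq> V"
    and v: "v \<in> V" and cyc: "cyc Z y v = V"
  shows "finite {c. cyc Z (perturb y c b) v \<noteq> V}"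
proof -
  have ly: "lin y" and lb: "lin b" using y b L_lin by auto
  have sZ: "subspace Z" using Z by (rule Lstable_subspace)
  define n where "n = min_deg Z y v"
  have dV: "dim V = dim Z + n" using dim_cyc[OF ly Lstable_stable[OF Z y], of v] cyc n_def by simp
  have y0: "perturb y 0 b = y" by (simp add: fun_eq_iff)
  have "finite {c. \<not> indep_mod Z n (\<lambda>k. (perturb y c b ^^ k) v)}"
    using polyvec_funpow_perturb[OF ly lb] L_comm[OF b y] indep_mod_min_deg[OF ly sZ, of v]
    by (intro finite_not_indep_mod sZ) (simp_all add: y0 n_def)
  moreover have "cyc Z (perturb y c b) v = V" if c: "indep_mod Z n (\<lambda>k. (perturb y c b ^^ k) v)" for c
  proof -
    let ?y = "perturb y c b"
    have yL: "?y \<in> L" using L_perturb y b .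
    let ?S = "span (Z \<union> (\<lambda>k. (?y ^^ k) v) ` {..<n})"
    have "(?y ^^ k) v \<in> cyc Z ?y v" for k
      using cyc_pa[OF sZ, of ?y "[:0,1:]^k" v] by (simp add: pa_X_power L_lin yL)
    then have 1: "?S \<subseteq> cyc Z ?y v"
      by (intro span_minimal subspace_cyc sZ) (use subset_cyc in auto)
    have 2: "cyc Z ?y v \<subseteq> V" using cyc_subset[OF L_lin[OF yL] Lstable_stable[OF V(1) yL] v V(2)] .
    have "?S = V" using dim_span_indep_mod[OF sZ c] dV 1 2
      by (intro subspace_dim_equal) (auto simp: Lstable_subspace V)
    then show ?thesis using 1 2 by blast
  qed
  then have "{c. cyc Z (perturb y c b) v \<noteq> V} \<subseteq> {c. \<not> indep_mod Z n (\<lambda>k. (perturb y c b ^^ k) v)}"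
    by blast
  ultimately show ?thesis by (rule finite_subset[rotated])
qed

end

lemma irreducible_power_split:
  fixes p q :: "'f::field poly"
  assumes "irreducible p" "q \<noteq> 0"
  shows "\<exists>k q'. q = p ^ k * q' \<and> \<not> p dvd q'"
  using assms(2)
proof (induction "degree q" arbitrary: q rule: less_induct)
  case less
  show ?case
  proof (cases "p dvd q")
    case False
    then show ?thesis by (intro exI[of _ 0] exI[of _ q]) simp
  next
    case True
    then obtain r where r: "q = p * r" by blast
    then have "r \<noteq> 0" using less.prems by auto
    moreover have "degree r < degree q"
      using r less.prems irreducible_degree_pos[OF assms(1)] by (auto simp: degree_mult_eq)
    ultimately obtain k q' where "r = p ^ k * q'" "\<not> p dvd q'" using less.hyps by blast
    then show ?thesis using r by (intro exI[of _ "Suc k"] exI[of _ q']) (simp add: mult.assoc)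
  qed
qed

context comm_ops
begin

text \<open>Nakayama: if \<open>p(y)\<close> maps \<open>V\<close> onto the largest proper submodule \<open>V'\<close>, a generator modulo
  \<open>V'\<close> generates, because \<open>p(y)\<close> is nilpotent modulo \<open>W\<close>.\<close>
lemma cyclic_lift:
  assumes lay: "layer W V" and y: "y \<in> L" and irr: "irreducible p"
    and V': "Lstable V'" "W \<subseteq> V'" "V' \<subseteq> V" and v: "v \<in> V" "v \<notin> V'"
    and cyc: "cyc V' y v = V" and pv: "pa y p v \<in> V'"
    and onto: "V' \<subseteq> {pa y p u + w |u w. u \<in> V \<and> w \<in> W}"
    and gen: "\<And>N. Lstable N \<Longrightarrow> W \<subseteq> N \<Longrightarrow> v \<in> N \<Longrightarrow> V \<subseteq> N"
  shows "cyc W y v = V"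
proof -
  have ly: "lin y" using y by (rule L_lin)
  have W: "Lstable W" and V: "Lstable V" "W \<subseteq> V" using lay unfolding layer_def by auto
  have sW: "subspace W" using W by (rule Lstable_subspace)
  note stW = stable_pa[OF ly Lstable_stable[OF W y]] and stV = stable_pa[OF ly Lstable_stable[OF V(1) y]]
  obtain q where q: "lead_coeff q = 1" "pa y q v \<in> W"
    using exists_annihilator[OF ly Lstable_stable[OF W y]] by blast
  then have "q \<noteq> 0" by auto
  then obtain k q' where kq: "q = p ^ k * q'" "\<not> p dvd q'" using irreducible_power_split[OF irr] by blast
  have cop: "bezout_coprime p q'" using irr kq(2) by (rule irreducible_bezout_coprime)
  define K where "K f = {u\<in>V. pa y f u \<in> W}" for f
  have K: "Lstable (K f)" "W \<subseteq> K f" "K f \<subseteq> V" for f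
    unfolding K_def using Lstable_vimage_pa[OF y W V(1)] stW V(2) by auto
  obtain a b where ab: "\<And>u. u = pa y (a * p ^ k) u + pa y (b * q') u"
    using bezout_coprime_split[OF ly bezout_coprime_power[OF cop]] by metis
  have 1: "pa y (a * p ^ k) v \<in> K q'"
  proof -
    have "pa y q' (pa y (a * p ^ k) v) = pa y a (pa y q v)"
      unfolding kq(1) pa_mult[OF ly, symmetric] by (simp add: ac_simps)
    then show ?thesis unfolding K_def using q(2) stW stV v(1) by simp
  qed
  have 2: "pa y (b * q') v \<in> K (p ^ k)"
  proof -
    have "pa y (p ^ k) (pa y (b * q') v) = pa y b (pa y q v)"
      unfolding kq(1) pa_mult[OF ly, symmetric] by (simp add: ac_simps)
    then show ?thesis unfolding K_def using q(2) stW stV v(1) by simp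
  qed
  \<comment> \<open>\<open>p ^ k\<close> and \<open>q'\<close> are coprime, so \<open>v\<close> is a
    sum of vectors from the two kernels; one kernel contains the other, hence \<open>v\<close>. It
    cannot be \<open>K q'\<close>, since then p(y) v and q'(y) v would both lie in
    \<open>V'\<close>, and with them \<open>v\<close>.\<close>
  have "K (p ^ k) \<subseteq> K q' \<or> K q' \<subseteq> K (p ^ k)" using lay K unfolding layer_def by blast
  then have "v \<in> K q' \<or> v \<in> K (p ^ k)"
    using 1 2 ab[of v] K(1) by (metis Lstable_subspace subsetD subspace_add)
  moreover have "v \<notin> K q'"
  proof
    assume "v \<in> K q'"
    then have "pa y q' v \<in> V'" using V'(2) unfolding K_def by blast
    then show False using bezout_coprime_mem[OF ly cop Lstable_stable[OF V'(1) y] pv] v(2) by blast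
  qed
  ultimately have "v \<in> K (p ^ k)" by blast
  then have nil: "\<And>u. u \<in> V \<Longrightarrow> pa y (p ^ k) u \<in> W" using gen[OF K(1,2)] unfolding K_def by blast
  let ?X = "cyc W y v"
  have sX: "stable y ?X" using stable_cyc[OF ly Lstable_stable[OF W y]] .
  \<comment> \<open>Each round writes u' as f(y) v plus an element of \<open>V'\<close>, and that
    element as p(y) of a vector plus an element of \<open>W\<close>. The exponent of p grows by one,
    and p^k maps \<open>V\<close> into \<open>W\<close>.\<close>
  have step: "\<exists>x u'. x \<in> ?X \<and> u' \<in> V \<and> u = x + pa y (p ^ j) u'" if u: "u \<in> V" for u j
  proof (induction j)
    case 0
    show ?case using u ly sW by (intro exI[of _ 0] exI[of _ u]) (auto intro: subspace_0 subspace_cyc)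
  next
    case (Suc j)
    then obtain x u' where xu: "x \<in> ?X" "u' \<in> V" "u = x + pa y (p ^ j) u'" by blast
    from xu(2) cyc obtain f z where fz: "u' = pa y f v + z" "z \<in> V'" unfolding cyc_def by blast
    then obtain u2 w where uw: "z = pa y p u2 + w" "u2 \<in> V" "w \<in> W" using onto by blast
    have lj: "lin (pa y (p ^ j))" using ly by (rule lin_pa)
    have "u = (x + pa y (p ^ j) (pa y f v + w)) + pa y (p ^ Suc j) u2"
      unfolding xu(3) fz(1) uw(1) by (simp add: lin_add[OF lj] pa_mult' ly pa_mult ac_simps)
    moreover have "pa y f v + w \<in> ?X" using uw(3) by (rule cycI)
    then have "x + pa y (p ^ j) (pa y f v + w) \<in> ?X"
      using xu(1) stable_pa[OF ly sX] stable_subspace[OF sX] by (simp add: subspace_add)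
    ultimately show ?case using uw(2) by blast
  qed
  have "u \<in> ?X" if u: "u \<in> V" for u
  proof -
    obtain x u' where xu: "x \<in> ?X" "u' \<in> V" "u = x + pa y (p ^ k) u'" using step[OF u, of k] by blast
    then have "pa y (p ^ k) u' \<in> ?X" using nil subset_cyc[of W y v] by blast
    then show ?thesis using xu stable_subspace[OF sX] by (simp add: subspace_add)
  qed
  moreover have "?X \<subseteq> V" using cyc_subset[OF ly Lstable_stable[OF V(1) y] v(1) V(2)] .
  ultimately show ?thesis by blast
qed

text \<open>Suppose no \<open>y\<close> works and \<open>V'\<close> is larger than \<open>W\<close>.
  Then lifting fails for every \<open>y\<close> that generates the top V/V', which means that its
  minimal polynomial there sends \<open>v\<close> even into \<open>V2\<close>, the largest proper
  submodule of \<open>V'\<close> over \<open>W\<close>. Hence the degree modulo \<open>V2\<close> is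
  still \<open>d\<close> at almost all points of a line, differentiation works modulo
  \<open>V2\<close>, and \<open>V\<close> is cyclic modulo \<open>V2\<close> of dimension
  \<open>d\<close>: too small, since dim V = dim V' + d.\<close>

lemma exists_cyclic:
  assumes inf: "infinite (UNIV :: 'f set)" and perf: "perfect_field TYPE('f)"
    and lay: "layer W V"
  shows "\<exists>y\<in>L. \<exists>v\<in>V. cyc W y v = V"
proof -
  have W: "Lstable W" and V: "Lstable V" "W \<subset> V" using lay unfolding layer_def by auto
  obtain V' where V': "Lstable V'" "W \<subseteq> V'" "V' \<subset> V"
    and max: "\<And>N. Lstable N \<Longrightarrow> W \<subseteq> N \<Longrightarrow> N \<subseteq> V \<Longrightarrow> N \<noteq> V \<Longrightarrow> N \<subseteq> V'"
    using layer_max[OF lay] by metis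
  have gen: "V \<subseteq> N" if "u \<in> V" "u \<notin> V'" "Lstable N" "W \<subseteq> N" "u \<in> N" for u N
  proof (rule ccontr)
    assume "\<not> V \<subseteq> N"
    then have "N \<inter> V \<subseteq> V'" using that V by (intro max Lstable_Int) auto
    then show False using that by blast
  qed
  obtain v where v: "v \<in> V" "v \<notin> V'" using V'(3) by blast
  have genv: "V \<subseteq> N" if "Lstable N" "W \<subseteq> N" "v \<in> N" for N using gen v that by blast
  have simple: "V \<subseteq> N" if "u \<in> V" "u \<notin> V'" "Lstable N" "V' \<subseteq> N" "u \<in> N" for u N
    using gen that V'(2) by blast
  obtain y where y: "y \<in> L" "cyc V' y v = V"
    using exists_cyclic_simple[OF inf perf V'(1) V(1) _ v] simple V'(3) by blast
  show ?thesis
  proof (cases "V' = W")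
    case True
    then show ?thesis using y v by blast
  next
    case False
    then have lay': "layer W V'" using lay V' unfolding layer_def by (auto 0 3)
    obtain V2 where V2: "Lstable V2" "W \<subseteq> V2" "V2 \<subset> V'"
      and max2: "\<And>N. Lstable N \<Longrightarrow> W \<subseteq> N \<Longrightarrow> N \<subseteq> V' \<Longrightarrow> N \<noteq> V' \<Longrightarrow> N \<subseteq> V2"
      using layer_max[OF lay'] by metis
    define d where "d = dim V - dim V'"
    have md: "min_deg V' y v = d \<and> dim V = dim V' + d" if "y \<in> L" "cyc V' y v = V" for y
      using dim_cyc[OF L_lin[OF that(1)] Lstable_stable[OF V'(1) that(1)], of v] that(2) by (simp add: d_def)
    show ?thesis
    proof (rule ccontr)
      assume no: "\<not> ?thesis"
      have small: "pa y \<mu> v \<in> V2"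
        if y: "y \<in> L" "cyc V' y v = V" and \<mu>: "lead_coeff \<mu> = 1" "degree \<mu> = d" "pa y \<mu> v \<in> V'" for y \<mu>
      proof (rule ccontr)
        assume n2: "pa y \<mu> v \<notin> V2"
        have irr: "irreducible \<mu>"
          by (rule simple_min_poly_irreducible[OF y(1) V'(1) V(1) v, of \<mu>]) (use simple \<mu> md[OF y] in auto)
        \<comment> \<open>\<mu>(y) V + W is a submodule of \<open>V'\<close> containing \<mu>(y) v,
          which is not in \<open>V2\<close>; so it is all of \<open>V'\<close>, as
          \<open>cyclic_lift\<close> requires.\<close>
        let ?N = "{pa y \<mu> u + w |u w. u \<in> V \<and> w \<in> W}"
        have "Lstable {u\<in>UNIV. pa y \<mu> u \<in> V'}"
          by (rule Lstable_vimage_pa[OF y(1) V'(1)]) (auto simp: Lstable_def)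
        then have "V \<subseteq> {u\<in>UNIV. pa y \<mu> u \<in> V'}"
          using \<mu>(3) V'(2) stable_pa[OF L_lin Lstable_stable, OF y(1) V'(1) y(1)] by (intro genv) auto
        then have sub: "?N \<subseteq> V'"
          using V'(2) Lstable_subspace[OF V'(1)] by (auto intro!: subspace_add)
        have LN: "Lstable ?N" using Lstable_image_pa_add[OF y(1) V(1) W] .
        have WN: "W \<subseteq> ?N"
        proof
          fix w assume w: "w \<in> W"
          have "w = pa y \<mu> 0 + w" using lin_pa[OF L_lin[OF y(1)]] by simp
          then show "w \<in> ?N" using w Lstable_subspace[OF V(1)] subspace_0 by blast
        qed
        have "pa y \<mu> v = pa y \<mu> v + 0" by simp
        then have "pa y \<mu> v \<in> ?N" using v(1) Lstable_subspace[OF W] subspace_0 by blast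
        then have "?N = V'" using max2[OF LN WN sub] n2 by blast
        then have "cyc W y v = V"
          using V' y \<mu>(3) by (intro cyclic_lift[OF lay y(1) irr V'(1) V'(2) _ v _ _ _ genv]) auto
        then show False using no y(1) v(1) by blast
      qed
      have ly: "lin y" using L_lin y(1) .
      obtain \<mu> where \<mu>: "lead_coeff \<mu> = 1" "degree \<mu> = d" "pa y \<mu> v \<in> V'"
        using min_deg_ex[OF ly Lstable_stable[OF V'(1) y(1)]] md[OF y] by metis
      have irr: "irreducible \<mu>"
        by (rule simple_min_poly_irreducible[OF y(1) V'(1) V(1) v, of \<mu>]) (use simple \<mu> md[OF y] in auto)
      have cop: "bezout_coprime \<mu> (pderiv \<mu>)" by (rule perfect_field_bezout_coprime_pderiv[OF perf irr])
      have le: "min_deg V2 y' v \<le> d" if y': "y' \<in> L" "cyc V' y' v = V" for y'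
      proof -
        obtain \<nu> where \<nu>: "lead_coeff \<nu> = 1" "degree \<nu> = d" "pa y' \<nu> v \<in> V'"
          using min_deg_ex[OF L_lin[OF y'(1)] Lstable_stable[OF V'(1) y'(1)]] md[OF y'] by metis
        have "\<nu> \<noteq> 0" using \<nu>(1) by auto
        then show ?thesis
          using min_deg_le[OF Lstable_subspace[OF V2(1)], of \<nu> y' v] small[OF y' \<nu>] \<nu>(2) by simp
      qed
      have ge: "min_deg V2 y v \<ge> d"
      proof -
        obtain \<nu> where \<nu>: "lead_coeff \<nu> = 1" "degree \<nu> = min_deg V2 y v" "pa y \<nu> v \<in> V2"
          using min_deg_ex[OF ly Lstable_stable[OF V2(1) y(1)]] by metis
        then have "\<nu> \<noteq> 0" by auto
        then show ?thesis using min_deg_le[OF Lstable_subspace[OF V'(1)], of \<nu> y v] \<nu> V2(3) md[OF y] by auto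
      qed
      have eq: "min_deg V2 y v = d" using le[OF y] ge by simp
      let ?C = "cyc V2 y v"
      have \<mu>2: "pa y \<mu> v \<in> V2" using small[OF y \<mu>] .
      have "b v \<in> ?C" if b: "b \<in> L" for b
      proof (rule bezout_coprime_mem[OF ly cop stable_cyc[OF ly Lstable_stable[OF V2(1) y(1)]]])
        \<comment> \<open>For all but finitely many \<open>c\<close> the perturbed operator still
          generates the top, and then \<open>le\<close> bounds its degree modulo \<open>V2\<close>
          by \<open>d\<close>.\<close>
        have "finite {c. cyc V' (perturb y c b) v \<noteq> V}"
          using V' v y by (intro finite_not_cyc[OF y(1) b V'(1) V(1)]) auto
        then have "infinite (UNIV - {c. cyc V' (perturb y c b) v \<noteq> V})" using inf by simp
        moreover have "UNIV - {c. cyc V' (perturb y c b) v \<noteq> V} \<subseteq>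
            {c. min_deg V2 (perturb y c b) v \<le> min_deg V2 y v}"
          using le L_perturb[OF y(1) b] eq by auto
        ultimately have "infinite {c. min_deg V2 (perturb y c b) v \<le> min_deg V2 y v}"
          using infinite_super by blast
        then show "pa y (pderiv \<mu>) (b v) \<in> ?C"
          using \<mu> \<mu>2 eq by (intro pderiv_mem_cyc[OF ly L_lin[OF b]])
            (auto simp: L_comm y(1) b Lstable_stable V2(1))
        show "pa y \<mu> (b v) \<in> ?C"
          using \<mu>2 V2(1) b subset_cyc[of V2 y v] unfolding pa_L_comm[OF y(1) b] Lstable_def by blast
      qed
      then have "Lstable ?C" using y V2 by (intro Lstable_cyc)
      then have "V \<subseteq> ?C"
        using genv[of ?C] subset_cyc[of V2 y v] V2(2) cyc_self[OF ly Lstable_subspace[OF V2(1)]] by blast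
      then have "dim V \<le> dim V2 + d"
        using dim_subset[of V ?C] dim_cyc[OF ly Lstable_stable[OF V2(1) y(1)], of v] eq by simp
      moreover have "dim V2 < dim V'"
        using V2 V'(1) by (metis dim_psubset Lstable_subspace span_eq_iff)
      ultimately show False using md[OF y] by simp
    qed
  qed
qed

end

section \<open>Quotient modules translated into subspaces and generators\<close>

section \<open>Uniserial quotients and cyclic quotients\<close>

lemma exists_irreducible_monic_factor:
  fixes f :: "'f::field poly"
  assumes "degree f > 0"
  shows "\<exists>p. irreducible p \<and> lead_coeff p = 1 \<and> p dvd f"
proof -
  have "f dvd f \<and> degree f > 0" using assms by simp
  then obtain q where q: "q dvd f \<and> degree q > 0" and min: "\<And>r. r dvd f \<and> degree r > 0 \<Longrightarrow> degree q \<le> degree r"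
    using ex_has_least_nat[of "\<lambda>q. q dvd f \<and> degree q > 0" f degree] by blast
  define p where "p = Polynomial.smult (inverse (lead_coeff q)) q"
  have q0: "lead_coeff q \<noteq> 0" using q by auto
  have pq: "p dvd q" "q dvd p" using q0 by (auto simp: p_def smult_dvd_iff dvd_smult_iff)
  have dp: "degree p = degree q" using q0 by (simp add: p_def)
  have "irreducible p"
  proof (rule irreducibleI)
    show p0: "p \<noteq> 0" using dp q by auto
    show "\<not> is_unit p" using dp q p0 by (auto simp: is_unit_iff_degree)
    fix a b assume ab: "p = a * b"
    then have n0: "a \<noteq> 0" "b \<noteq> 0" using p0 by auto
    have "a dvd f" using ab pq(1) q by (metis dvd_trans dvd_triv_left)
    then have "degree a = 0 \<or> degree q \<le> degree a" using min[of a] by auto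
    moreover have "degree p = degree a + degree b" using ab n0 by (simp add: degree_mult_eq)
    ultimately show "is_unit a \<or> is_unit b" using dp n0 by (auto simp: is_unit_iff_degree)
  qed
  moreover have "lead_coeff p = 1" using q0 by (simp add: p_def)
  ultimately show ?thesis using pq(1) q by (meson dvd_trans)
qed

lemma quot_coset_eq_iff:
  assumes "0 \<in> W" "\<And>u v. u \<in> W \<Longrightarrow> v \<in> W \<Longrightarrow> u - v \<in> (W :: 'a::ab_group_add set)"
  shows "quot_coset W a = quot_coset W b \<longleftrightarrow> a - b \<in> W"
proof
  assume eq: "quot_coset W a = quot_coset W b"
  have "a + 0 \<in> quot_coset W a" unfolding quot_coset_def using assms(1) by blast
  then have "a \<in> quot_coset W b" using eq by simp
  then show "a - b \<in> W" by (auto simp: quot_coset_def)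
next
  assume ab: "a - b \<in> W"
  have neg: "- u \<in> W" if "u \<in> W" for u using assms(2)[OF assms(1) that] by simp
  have plus: "u + v \<in> W" if "u \<in> W" "v \<in> W" for u v using assms(2)[OF that(1) neg[OF that(2)]] by simp
  have "quot_coset W a \<subseteq> quot_coset W b" if "a - b \<in> W" for a b
  proof
    fix x assume "x \<in> quot_coset W a"
    then obtain w where "w \<in> W" "x = a + w" by (auto simp: quot_coset_def)
    then have "x = b + ((a - b) + w)" "(a - b) + w \<in> W" using plus that by auto
    then show "x \<in> quot_coset W b" unfolding quot_coset_def by blast
  qed
  then show "quot_coset W a = quot_coset W b" using ab neg[OF ab] by auto
qed

lemma quot_add_coset:
  assumes "0 \<in> W" "\<And>u v. u \<in> W \<Longrightarrow> v \<in> W \<Longrightarrow> u + v \<in> (W :: 'a::ab_group_add set)"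
  shows "quot_add (quot_coset W a) (quot_coset W b) = quot_coset W (a + b)"
proof (intro equalityI subsetI)
  fix z assume "z \<in> quot_add (quot_coset W a) (quot_coset W b)"
  then obtain w w' where "w \<in> W" "w' \<in> W" "z = (a + w) + (b + w')"
    by (auto simp: quot_add_def quot_coset_def)
  then have "z = (a + b) + (w + w')" "w + w' \<in> W" using assms by (auto simp: ac_simps)
  then show "z \<in> quot_coset W (a + b)" unfolding quot_coset_def by blast
next
  fix z assume "z \<in> quot_coset W (a + b)"
  then obtain w where "w \<in> W" "z = (a + w) + (b + 0)" by (auto simp: quot_coset_def ac_simps)
  then show "z \<in> quot_add (quot_coset W a) (quot_coset W b)"
    using assms(1) unfolding quot_add_def quot_coset_def by blast
qed

context fd_space
begin

text \<open>The chain condition of uniseriality for V/W; that the quotient is nonzero is stated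
  separately where it is used.\<close>

definition chain_between :: "('u \<Rightarrow> 'u) set \<Rightarrow> 'u set \<Rightarrow> 'u set \<Rightarrow> bool" where
  "chain_between H W V \<longleftrightarrow> (\<forall>N N'. subspace N \<longrightarrow> subspace N' \<longrightarrow>
     (\<forall>h\<in>H. stable h N) \<longrightarrow> (\<forall>h\<in>H. stable h N') \<longrightarrow>
     W \<subseteq> N \<longrightarrow> N \<subseteq> V \<longrightarrow> W \<subseteq> N' \<longrightarrow> N' \<subseteq> V \<longrightarrow> N \<subseteq> N' \<or> N' \<subseteq> N)"

lemma chain_betweenD:
  assumes "chain_between H W V" "subspace N" "subspace N'" "\<forall>h\<in>H. stable h N" "\<forall>h\<in>H. stable h N'"
    "W \<subseteq> N" "N \<subseteq> V" "W \<subseteq> N'" "N' \<subseteq> V"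
  shows "N \<subseteq> N' \<or> N' \<subseteq> N"
  using assms unfolding chain_between_def by simp

lemma coset_eq_iff: "subspace W \<Longrightarrow> quot_coset W a = quot_coset W b \<longleftrightarrow> a - b \<in> W"
  by (rule quot_coset_eq_iff) (auto simp: subspace_0 subspace_diff)

lemma coset_add: "subspace W \<Longrightarrow> quot_add (quot_coset W a) (quot_coset W b) = quot_coset W (a + b)"
  by (rule quot_add_coset) (auto simp: subspace_0 subspace_add)

lemma coset_op: "lin h \<Longrightarrow> stable h W \<Longrightarrow> quot_op W h (quot_coset W v) = quot_coset W (h v)"
  by (rule quot_op_coset) (auto simp: lin_add stable_mem subspace_0 subspace_add dest: stable_subspace)

lemma coset_0 [simp]: "quot_coset W (0 :: 'u) = W"
  by (simp add: quot_coset_def)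

text \<open>The correspondence between submodules of V/W and stable subspaces between
  \<open>W\<close> and \<open>V\<close>. The scalars belong to \<open>H\<close>, so the preimage of
  a submodule is a subspace.\<close>

lemma uniserial_quotient_iff:
  assumes W: "subspace W" and V: "subspace V" "W \<subseteq> V"
    and H: "\<And>h. h \<in> H \<Longrightarrow> lin h" "\<And>h. h \<in> H \<Longrightarrow> stable h W" "\<And>h. h \<in> H \<Longrightarrow> stable h V"
    and sc: "\<And>c. sc c \<in> H"
  shows "uniserial_quotient V W H \<longleftrightarrow> W \<noteq> V \<and> chain_between H W V"
proof -
  have ne: "quot_carrier V W \<noteq> {W} \<longleftrightarrow> W \<noteq> V"
  proof
    assume "W \<noteq> V"
    then obtain v where v: "v \<in> V" "v \<notin> W" using V by blast
    then have "quot_coset W v \<noteq> quot_coset W 0" using coset_eq_iff[OF W, of v 0] by simp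
    then show "quot_carrier V W \<noteq> {W}" using v unfolding quot_carrier_def by auto
  next
    assume n: "quot_carrier V W \<noteq> {W}"
    show "W \<noteq> V"
    proof
      assume "W = V"
      have "quot_coset W v = W" if "v \<in> W" for v
        using coset_eq_iff[OF W, of v 0] that by simp
      then have "quot_carrier V W = {W}" unfolding quot_carrier_def using \<open>W = V\<close> subspace_0[OF W]
        by force
      then show False using n by blast
    qed
  qed
  let ?Q = "submodules (quot_carrier V W) W quot_add (quot_op W ` H)"
  have sub: "quot_carrier N W \<in> ?Q" if N: "subspace N" "\<forall>h\<in>H. stable h N" "N \<subseteq> V" for N
    unfolding submodules_def
  proof (intro CollectI conjI ballI)
    show "quot_carrier N W \<subseteq> quot_carrier V W" using N(3) by (auto simp: quot_carrier_def)
    show "W \<in> quot_carrier N W"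
      using subspace_0[OF N(1)] coset_0[of W] unfolding quot_carrier_def by (metis imageI)
    fix A assume A: "A \<in> quot_carrier N W"
    show "quot_add A B \<in> quot_carrier N W" if "B \<in> quot_carrier N W" for B
      using A that N(1) unfolding quot_carrier_def by (auto simp: coset_add[OF W] intro!: imageI subspace_add)
    fix k assume "k \<in> quot_op W ` H"
    then obtain h where h: "h \<in> H" "k = quot_op W h" by blast
    obtain n where n: "n \<in> N" "A = quot_coset W n" using A unfolding quot_carrier_def by blast
    have "k A = quot_coset W (h n)" unfolding h(2) n(2) by (rule coset_op[OF H(1,2)[OF h(1)]])
    moreover have "h n \<in> N" using N(2) h(1) n(1) stable_mem by blast
    ultimately show "k A \<in> quot_carrier N W" unfolding quot_carrier_def by blast
  qed
  show ?thesis
  proof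
    assume us: "uniserial_quotient V W H"
    have "chain_between H W V" unfolding chain_between_def
    proof (intro allI impI)
      fix N N' assume N: "subspace N" "subspace N'" "\<forall>h\<in>H. stable h N" "\<forall>h\<in>H. stable h N'"
        "W \<subseteq> N" "N \<subseteq> V" "W \<subseteq> N'" "N' \<subseteq> V"
      have *: "N \<subseteq> N'" if "quot_carrier N W \<subseteq> quot_carrier N' W" "W \<subseteq> N'" "subspace N'" for N N'
      proof
        fix n assume "n \<in> N"
        then have "quot_coset W n \<in> quot_carrier N' W" using that unfolding quot_carrier_def by blast
        then obtain n' where "n' \<in> N'" "quot_coset W n = quot_coset W n'" unfolding quot_carrier_def by blast
        then have "n' \<in> N'" "n - n' \<in> N'" using coset_eq_iff[OF W] that(2) by auto
        then show "n \<in> N'" using subspace_add[OF that(3)] by fastforce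
      qed
      have "quot_carrier N W \<subseteq> quot_carrier N' W \<or> quot_carrier N' W \<subseteq> quot_carrier N W"
        using us sub[of N] sub[of N'] N unfolding uniserial_quotient_def uniserial_module_def by blast
      then show "N \<subseteq> N' \<or> N' \<subseteq> N" using * N by metis
    qed
    then show "W \<noteq> V \<and> chain_between H W V"
      using us ne unfolding uniserial_quotient_def uniserial_module_def by blast
  next
    assume r: "W \<noteq> V \<and> chain_between H W V"
    show "uniserial_quotient V W H" unfolding uniserial_quotient_def uniserial_module_def
    proof (intro conjI ballI)
      show "quot_carrier V W \<noteq> {W}" using ne r by blast
      fix A B assume AB: "A \<in> ?Q" "B \<in> ?Q"
      define P where "P A = {v\<in>V. quot_coset W v \<in> A}" for A
      have P: "subspace (P A) \<and> (\<forall>h\<in>H. stable h (P A)) \<and> W \<subseteq> P A \<and> P A \<subseteq> V \<and> A = quot_coset W ` P A"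
        if A: "A \<in> ?Q" for A
      proof -
        have A1: "A \<subseteq> quot_carrier V W" "W \<in> A" "\<And>a b. a \<in> A \<Longrightarrow> b \<in> A \<Longrightarrow> quot_add a b \<in> A"
          "\<And>h a. h \<in> H \<Longrightarrow> a \<in> A \<Longrightarrow> quot_op W h a \<in> A"
          using A unfolding submodules_def by auto
        have op: "h v \<in> P A" if "h \<in> H" "v \<in> P A" for h v
          using A1(4)[OF that(1), of "quot_coset W v"] that coset_op[OF H(1,2)] stable_mem[OF H(3)]
          unfolding P_def by auto
        have s: "subspace (P A)"
        proof (rule subspaceI)
          show "0 \<in> P A" unfolding P_def using A1(2) subspace_0[OF V(1)] by simp
          show "x + y \<in> P A" if "x \<in> P A" "y \<in> P A" for x y
            using that A1(3) subspace_add[OF V(1)] unfolding P_def by (auto simp: coset_add[OF W, symmetric])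
          show "sc c x \<in> P A" if "x \<in> P A" for c x using op[OF sc that] .
        qed
        moreover have "\<forall>h\<in>H. stable h (P A)" using s op unfolding stable_def by blast
        moreover have "W \<subseteq> P A"
        proof
          fix w assume w: "w \<in> W"
          then have "quot_coset W w = W" using coset_eq_iff[OF W, of w 0] by simp
          then show "w \<in> P A" using A1(2) w V(2) unfolding P_def by auto
        qed
        moreover have "A = quot_coset W ` P A" using A1(1) unfolding P_def quot_carrier_def by blast
        ultimately show ?thesis unfolding P_def by blast
      qed
      have "P A \<subseteq> P B \<or> P B \<subseteq> P A"
        by (rule chain_betweenD[OF r[THEN conjunct2]]) (use P[OF AB(1)] P[OF AB(2)] in simp_all)
      then show "A \<subseteq> B \<or> B \<subseteq> A" using P[OF AB(1)] P[OF AB(2)] by (metis image_mono)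
    qed
  qed
qed

lemma uniserial_module_UNIV_iff:
  assumes H: "\<And>h. h \<in> H \<Longrightarrow> lin h" and sc: "\<And>c. sc c \<in> H"
  shows "uniserial_module (UNIV :: 'u set) 0 (+) H \<longleftrightarrow> (UNIV :: 'u set) \<noteq> {0} \<and> chain_between H {0} UNIV"
proof -
  have "N \<in> submodules UNIV 0 (+) H \<longleftrightarrow> subspace N \<and> (\<forall>h\<in>H. stable h N)" for N
    unfolding submodules_def stable_def subspace_def using sc by blast
  then have eq: "submodules UNIV 0 (+) H = {N. subspace N \<and> (\<forall>h\<in>H. stable h N)}" by blast
  have "{0} \<subseteq> N" if "subspace N" for N using subspace_0[OF that] by simp
  then show ?thesis unfolding uniserial_module_def chain_between_def eq by blast
qed

text \<open>A representative of the coset sent to the class of 1 generates, and its annihilator is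
  the ideal of \<open>q\<close>. From here on an isomorphism with F[X]/(q) is handled as a generator
  with known annihilator.\<close>

lemma quotient_iso_cyclic_iff:
  assumes h: "lin h" and W: "stable h W" and V: "stable h V" "W \<subseteq> V"
  shows "quotient_iso_cyclic sc h V W q \<longleftrightarrow>
    (\<exists>v\<in>V. cyc W h v = V \<and> (\<forall>f. pa h f v \<in> W \<longleftrightarrow> q dvd f))"
proof -
  define I where "I = {q * r |r. True}"
  have I: "f \<in> I \<longleftrightarrow> q dvd f" for f unfolding I_def by (auto simp: dvd_def)
  have I0: "0 \<in> I" using I by simp
  have Iadd: "f + g \<in> I" if "f \<in> I" "g \<in> I" for f g using that I by simp
  have Idiff: "f - g \<in> I" if "f \<in> I" "g \<in> I" for f g using that I by simp
  have Ieq: "quot_coset I f = quot_coset I g \<longleftrightarrow> q dvd f - g" for f g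
    using quot_coset_eq_iff[of I f g] I0 Idiff I by blast
  have Imult: "quot_op I (\<lambda>r. f * r) (quot_coset I g) = quot_coset I (f * g)" for f g
    by (rule quot_op_coset) (auto simp: I0 Iadd I algebra_simps)
  have sW: "subspace W" and sV: "subspace V" using W V by (auto dest: stable_subspace)
  have Wop: "quot_op W (pa h f) (quot_coset W v) = quot_coset W (pa h f v)" for f v
    using stable_pa[OF h W] by (intro coset_op lin_pa h) (auto simp: stable_def sW)
  show ?thesis
  proof
    assume "quotient_iso_cyclic sc h V W q"
    then obtain \<phi> where bij: "bij_betw \<phi> (quot_carrier V W) (quot_carrier UNIV I)"
      and act: "\<And>f A. A \<in> quot_carrier V W \<Longrightarrow> \<phi> (quot_op W (pa h f) A) = quot_op I (\<lambda>r. f * r) (\<phi> A)"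
      unfolding quotient_iso_cyclic_def Let_def I_def[symmetric] by blast
    have "quot_coset I 1 \<in> \<phi> ` quot_carrier V W"
      using bij by (auto simp: bij_betw_def quot_carrier_def)
    then obtain v where v: "v \<in> V" "\<phi> (quot_coset W v) = quot_coset I 1"
      unfolding quot_carrier_def by force
    have \<phi>v: "\<phi> (quot_coset W (pa h f v)) = quot_coset I f" for f
      using act[of "quot_coset W v" f] v Wop Imult[of f 1] by (simp add: quot_carrier_def)
    have inj: "a - b \<in> W" if "a \<in> V" "b \<in> V" "\<phi> (quot_coset W a) = \<phi> (quot_coset W b)" for a b
    proof -
      have "quot_coset W a = quot_coset W b"
        using bij that by (auto simp: bij_betw_def quot_carrier_def inj_on_def)
      then show ?thesis using coset_eq_iff[OF sW] by blast
    qed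
    have vV: "pa h f v \<in> V" for f using stable_pa[OF h V(1) v(1)] .
    have "w \<in> cyc W h v" if w: "w \<in> V" for w
    proof -
      have "\<phi> (quot_coset W w) \<in> quot_carrier UNIV I"
        using bij w by (auto simp: bij_betw_def quot_carrier_def)
      then obtain f where "\<phi> (quot_coset W w) = quot_coset I f" unfolding quot_carrier_def by blast
      then have "w - pa h f v \<in> W" using inj[OF w vV] \<phi>v by simp
      then show ?thesis using cycI[of "w - pa h f v" W h f v] by simp
    qed
    then have "cyc W h v = V" using cyc_subset[OF h V(1) v(1) V(2)] by blast
    moreover have "pa h f v \<in> W \<longleftrightarrow> q dvd f" for f
    proof
      assume "pa h f v \<in> W"
      then have "quot_coset W (pa h f v) = quot_coset W (pa h 0 v)"
        using coset_eq_iff[OF sW, of "pa h f v" "pa h 0 v"] by simp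
      then have "quot_coset I f = quot_coset I 0" using \<phi>v by metis
      then show "q dvd f" using Ieq[of f 0] by simp
    next
      assume "q dvd f"
      then have "quot_coset I f = quot_coset I 0" using Ieq[of f 0] by simp
      then show "pa h f v \<in> W" using inj[OF vV vV, of f 0] \<phi>v[of f] \<phi>v[of 0] by simp
    qed
    ultimately show "\<exists>v\<in>V. cyc W h v = V \<and> (\<forall>f. pa h f v \<in> W \<longleftrightarrow> q dvd f)" using v(1) by blast
  next
    assume "\<exists>v\<in>V. cyc W h v = V \<and> (\<forall>f. pa h f v \<in> W \<longleftrightarrow> q dvd f)"
    then obtain v where v: "v \<in> V" "cyc W h v = V" "\<And>f. pa h f v \<in> W \<longleftrightarrow> q dvd f" by blast
    \<comment> \<open>A coset goes to the set of all f for which f(y) v lies in it; this set is a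
      coset of \<open>I\<close>, and no representatives have to be chosen.\<close>
    define \<phi> where "\<phi> A = {f. pa h f v \<in> A}" for A
    have mem: "x \<in> quot_coset W y \<longleftrightarrow> x - y \<in> W" for x y
    proof
      assume "x - y \<in> W"
      then have "y + (x - y) \<in> quot_coset W y" unfolding quot_coset_def by (rule imageI)
      then show "x \<in> quot_coset W y" by simp
    qed (auto simp: quot_coset_def)
    have Imem: "f \<in> quot_coset I g \<longleftrightarrow> q dvd f - g" for f g
    proof
      assume "q dvd f - g"
      then have "g + (f - g) \<in> quot_coset I g" unfolding quot_coset_def using I by (intro imageI) blast
      then show "f \<in> quot_coset I g" by simp
    qed (auto simp: quot_coset_def I)
    have \<phi>v: "\<phi> (quot_coset W (pa h g v)) = quot_coset I g" for g
      unfolding \<phi>_def by (auto simp: mem Imem pa_diff[symmetric] v(3))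
    have rep: "\<exists>g. quot_coset W w = quot_coset W (pa h g v)" if w: "w \<in> V" for w
    proof -
      obtain g z where "w = pa h g v + z" "z \<in> W" using w v(2) unfolding cyc_def by blast
      then have "w - pa h g v \<in> W" by simp
      then show ?thesis using coset_eq_iff[OF sW] by blast
    qed
    have repA: "\<exists>g. A = quot_coset W (pa h g v)" if "A \<in> quot_carrier V W" for A
      using that rep unfolding quot_carrier_def by blast
    have vV: "pa h f v \<in> V" for f using stable_pa[OF h V(1) v(1)] .
    have "bij_betw \<phi> (quot_carrier V W) (quot_carrier UNIV I)"
    proof (rule bij_betw_imageI)
      show "inj_on \<phi> (quot_carrier V W)"
      proof (rule inj_onI)
        fix A B assume AB: "A \<in> quot_carrier V W" "B \<in> quot_carrier V W" "\<phi> A = \<phi> B"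
        obtain f g where fg: "A = quot_coset W (pa h f v)" "B = quot_coset W (pa h g v)"
          using repA AB by metis
        then have "q dvd f - g" using AB(3) \<phi>v Ieq by metis
        then have "pa h f v - pa h g v \<in> W" using v(3)[of "f - g"] by (simp add: pa_diff)
        then show "A = B" unfolding fg using coset_eq_iff[OF sW] by blast
      qed
      show "\<phi> ` quot_carrier V W = quot_carrier UNIV I"
      proof (intro equalityI subsetI)
        fix B assume "B \<in> \<phi> ` quot_carrier V W"
        then show "B \<in> quot_carrier UNIV I" using repA \<phi>v unfolding quot_carrier_def[of UNIV] by force
      next
        fix B assume "B \<in> quot_carrier UNIV I"
        then obtain g where "B = quot_coset I g" unfolding quot_carrier_def by blast
        then have "B = \<phi> (quot_coset W (pa h g v))" using \<phi>v by simp
        then show "B \<in> \<phi> ` quot_carrier V W" using vV unfolding quot_carrier_def by blast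
      qed
    qed
    moreover have "\<phi> (quot_add A B) = quot_add (\<phi> A) (\<phi> B)"
      if A: "A \<in> quot_carrier V W" and B: "B \<in> quot_carrier V W" for A B
    proof -
      obtain f g where fg: "A = quot_coset W (pa h f v)" "B = quot_coset W (pa h g v)"
        using repA[OF A] repA[OF B] by blast
      have 1: "quot_add A B = quot_coset W (pa h (f + g) v)" by (simp only: fg coset_add[OF sW] pa_add)
      have 2: "quot_add (quot_coset I f) (quot_coset I g) = quot_coset I (f + g)"
        by (rule quot_add_coset[OF I0 Iadd])
      show ?thesis by (simp only: 1) (simp only: fg \<phi>v 2)
    qed
    moreover have "\<phi> (quot_op W (pa h f) A) = quot_op I (\<lambda>r. f * r) (\<phi> A)"
      if A: "A \<in> quot_carrier V W" for f A
    proof -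
      obtain g where g: "A = quot_coset W (pa h g v)" using repA A by metis
      have 1: "quot_op W (pa h f) A = quot_coset W (pa h (f * g) v)" by (simp only: g Wop pa_mult[OF h])
      show ?thesis by (simp only: 1) (simp only: g \<phi>v Imult)
    qed
    ultimately show "quotient_iso_cyclic sc h V W q"
      unfolding quotient_iso_cyclic_def Let_def I_def[symmetric] by blast
  qed
qed

text \<open>The annihilator of the class of \<open>v\<close> is generated by the minimal polynomial
  \<mu>. Splitting \<mu> into a power of an irreducible p and a coprime cofactor gives two kernels
  whose sum contains \<open>v\<close>; being comparable, one of them contains \<open>v\<close>, so
  \<mu> divides one of the two factors. It is not the cofactor, because p divides \<mu>.\<close>

lemma cyclic_factor:
  assumes h: "lin h" and W: "stable h W" and V: "stable h V" "W \<subset> V"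
    and chain: "chain_between {h} W V" and v: "v \<in> V" "cyc W h v = V"
  shows "\<exists>p s. lead_coeff p = 1 \<and> irreducible p \<and> (\<forall>f. pa h f v \<in> W \<longleftrightarrow> p ^ s dvd f)"
proof -
  have sW: "subspace W" using W by (rule stable_subspace)
  obtain \<mu> where \<mu>: "lead_coeff \<mu> = 1" "degree \<mu> = min_deg W h v" "pa h \<mu> v \<in> W"
    using min_deg_ex[OF h W] by metis
  have m0: "\<mu> \<noteq> 0" using \<mu>(1) by auto
  have ann: "pa h f v \<in> W \<longleftrightarrow> \<mu> dvd f" for f
  proof
    assume f: "pa h f v \<in> W"
    have "f mod \<mu> = f - f div \<mu> * \<mu>" by (simp add: minus_div_mult_eq_mod)
    then have "pa h (f mod \<mu>) v = pa h f v - pa h (f div \<mu>) (pa h \<mu> v)"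
      by (simp only: pa_diff pa_mult[OF h])
    then have "pa h (f mod \<mu>) v \<in> W" using f stable_pa[OF h W \<mu>(3)] subspace_diff[OF sW] by simp
    then have "f mod \<mu> = 0"
      using min_deg_le[OF sW, of "f mod \<mu>" h v] degree_mod_less[OF m0, of f] \<mu>(2) by fastforce
    then show "\<mu> dvd f" by (simp add: mod_eq_0_iff_dvd)
  next
    assume "\<mu> dvd f"
    then show "pa h f v \<in> W" using stable_pa[OF h W \<mu>(3)] by (auto simp: pa_mult'[OF h] elim!: dvdE)
  qed
  have vW: "v \<notin> W" using cyc_subset[OF h W _ subset_refl, of v] v(2) V(2) by blast
  have "degree \<mu> > 0"
  proof (rule ccontr)
    assume "\<not> degree \<mu> > 0"
    then have "is_unit \<mu>" using m0 by (simp add: is_unit_iff_degree)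
    then have "pa h 1 v \<in> W" using ann by blast
    then show False using vW h by simp
  qed
  then obtain p where p: "irreducible p" "lead_coeff p = 1" "p dvd \<mu>"
    using exists_irreducible_monic_factor by blast
  obtain k q' where kq: "\<mu> = p ^ k * q'" "\<not> p dvd q'" using irreducible_power_split[OF p(1) m0] by blast
  have cop: "bezout_coprime p q'" using p(1) kq(2) by (rule irreducible_bezout_coprime)
  define K where "K f = {u\<in>V. pa h f u \<in> W}" for f
  have K: "subspace (K f)" "stable h (K f)" "W \<subseteq> K f" "K f \<subseteq> V" for f
  proof -
    show "subspace (K f)" unfolding K_def
      using subspace_vimage[OF lin_pa[OF h] sW stable_subspace[OF V(1)]] .
    then show "stable h (K f)" unfolding stable_def K_def
      using stable_mem[OF V(1)] stable_mem[OF W] pa_commute[OF h h] by auto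
    show "W \<subseteq> K f" "K f \<subseteq> V" unfolding K_def using stable_pa[OF h W] V(2) by auto
  qed
  obtain a b where ab: "\<And>u. u = pa h (a * p ^ k) u + pa h (b * q') u"
    using bezout_coprime_split[OF h bezout_coprime_power[OF cop]] by metis
  have 1: "pa h (a * p ^ k) v \<in> K q'"
  proof -
    have "pa h q' (pa h (a * p ^ k) v) = pa h a (pa h \<mu> v)"
      unfolding kq(1) pa_mult[OF h, symmetric] by (simp add: ac_simps)
    then show ?thesis unfolding K_def using stable_pa[OF h W \<mu>(3)] stable_pa[OF h V(1) v(1)] by simp
  qed
  have 2: "pa h (b * q') v \<in> K (p ^ k)"
  proof -
    have "pa h (p ^ k) (pa h (b * q') v) = pa h b (pa h \<mu> v)"
      unfolding kq(1) pa_mult[OF h, symmetric] by (simp add: ac_simps)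
    then show ?thesis unfolding K_def using stable_pa[OF h W \<mu>(3)] stable_pa[OF h V(1) v(1)] by simp
  qed
  have "K (p ^ k) \<subseteq> K q' \<or> K q' \<subseteq> K (p ^ k)"
    using chain K unfolding chain_between_def by blast
  then have "v \<in> K q' \<or> v \<in> K (p ^ k)"
    using 1 2 ab[of v] K(1) by (metis subsetD subspace_add)
  then have "\<mu> dvd q' \<or> \<mu> dvd p ^ k" unfolding K_def using ann by blast
  moreover have "\<not> \<mu> dvd q'" using p(3) kq(2) dvd_trans by blast
  ultimately have "\<mu> dvd p ^ k" by blast
  moreover have "p ^ k dvd \<mu>" using kq(1) by simp
  ultimately have "\<mu> dvd f \<longleftrightarrow> p ^ k dvd f" for f by (meson dvd_trans)
  then show ?thesis using ann p by blast
qed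

end

context comm_ops
begin

text \<open>\<open>b v\<close> equals f(y) v modulo \<open>W\<close> for some f, and since
  \<open>b\<close> commutes with \<open>y\<close> it acts as f(y) on the whole cyclic
  quotient.\<close>

lemma cyclic_stable_Lstable:
  assumes lay: "layer W V" and y: "y \<in> L" and v: "v \<in> V" "cyc W y v = V"
    and N: "stable y N" "W \<subseteq> N" "N \<subseteq> V"
  shows "Lstable N"
  unfolding Lstable_def
proof (intro conjI ballI)
  have W: "Lstable W" and V: "Lstable V" using lay unfolding layer_def by auto
  have ly: "lin y" using y by (rule L_lin)
  show sN: "subspace N" using N(1) by (rule stable_subspace)
  fix b u assume b: "b \<in> L" and u: "u \<in> N"
  have "b v \<in> V" using V b v(1) unfolding Lstable_def by blast
  then obtain f w where bv: "b v = pa y f v + w" "w \<in> W" using v(2) unfolding cyc_def by blast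
  obtain g w' where gu: "u = pa y g v + w'" "w' \<in> W" using u N(3) v(2) unfolding cyc_def by blast
  have "b u = pa y g (b v) + b w'" unfolding gu(1) by (simp add: lin_add L_lin b pa_L_comm y)
  also have "\<dots> = pa y g (pa y f v) + pa y g w + b w'" unfolding bv(1) by (simp add: lin_add lin_pa ly)
  also have "pa y g (pa y f v) = pa y f (pa y g v)" by (simp add: pa_mult[OF ly, symmetric] mult.commute)
  also have "pa y g v = u - w'" using gu(1) by simp
  finally have eq: "b u = pa y f (u - w') + pa y g w + b w'" .
  have "u - w' \<in> N" using u gu(2) N(2) subspace_diff[OF sN] by blast
  then have "pa y f (u - w') \<in> N" using stable_pa[OF ly N(1)] by blast
  moreover have "pa y g w \<in> N" "b w' \<in> N"
    using stable_pa[OF ly Lstable_stable[OF W y] bv(2)] stable_mem[OF Lstable_stable[OF W b] gu(2)] N(2) by auto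
  ultimately show "b u \<in> N" unfolding eq using subspace_add[OF sN] by blast
qed

lemma cyclic_chain_between:
  assumes lay: "layer W V" and y: "y \<in> L" and v: "v \<in> V" "cyc W y v = V"
  shows "chain_between {y} W V"
  unfolding chain_between_def
  using cyclic_stable_Lstable[OF assms] lay unfolding layer_def by simp

text \<open>The cyclic subspace of a vector outside the largest proper submodule is itself a
  submodule here, so it is everything.\<close>

lemma exists_cyclic_single:
  assumes lay: "layer W V" and y: "y \<in> L" and single: "\<And>N. stable y N \<Longrightarrow> Lstable N"
  shows "\<exists>v\<in>V. cyc W y v = V"
proof -
  obtain V' where V': "Lstable V'" "W \<subseteq> V'" "V' \<subset> V"
    and max: "\<And>N. Lstable N \<Longrightarrow> W \<subseteq> N \<Longrightarrow> N \<subseteq> V \<Longrightarrow> N \<noteq> V \<Longrightarrow> N \<subseteq> V'"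
    using layer_max[OF lay] by metis
  have W: "Lstable W" and V: "Lstable V" "W \<subseteq> V" using lay unfolding layer_def by auto
  have ly: "lin y" using y by (rule L_lin)
  obtain v where v: "v \<in> V" "v \<notin> V'" using V'(3) by blast
  have C: "Lstable (cyc W y v)" by (rule single[OF stable_cyc[OF ly Lstable_stable[OF W y]]])
  have "cyc W y v \<subseteq> V" using cyc_subset[OF ly Lstable_stable[OF V(1) y] v(1) V(2)] .
  moreover have "v \<in> cyc W y v" using cyc_self[OF ly Lstable_subspace[OF W]] .
  ultimately have "cyc W y v = V" using max[OF C subset_cyc] v(2) by blast
  then show ?thesis using v(1) by blast
qed

end

lemma pcompose_shift_shift:
  "(f \<circ>\<^sub>p [:a, 1:]) \<circ>\<^sub>p [:b, 1:] = f \<circ>\<^sub>p [:a + b, 1 :: 'a::field:]"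
  by (simp add: pcompose_assoc[symmetric] pcompose_pCons add.commute)

section \<open>Shifted polynomials, primary components and weight operators in a tower of cyclic
  factors\<close>

section \<open>Towers of cyclic factors linked by an operator of weight one\<close>

text \<open>The linear algebra extracted from the Lie module: \<open>Y\<close> and \<open>V\<close>
  are the actions of y and v, \<open>Us\<close> is the nilpotency series, and \<open>e i\<close>
  generates the i-th factor. \<open>V_inj\<close> says that \<open>V\<close> induces an injection of
  each factor after the first into the preceding one.\<close>

locale tower = fd_space sc for sc :: "'f::field \<Rightarrow> 'u::ab_group_add \<Rightarrow> 'u" +
  fixes Y V :: "'u \<Rightarrow> 'u" and Us :: "nat \<Rightarrow> 'u set" and m :: nat
    and p :: "nat \<Rightarrow> 'f poly" and s :: "nat \<Rightarrow> nat" and e :: "nat \<Rightarrow> 'u"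
  assumes Y_lin: "lin Y" and V_lin: "lin V"
    and twist: "Y (V w) = V (Y w) + V w"
    and m_gt_1: "m > 1"
    and Us_0: "Us 0 = {0}" and Us_m: "Us m = UNIV"
    and Us_mono: "i < m \<Longrightarrow> Us i \<subset> Us (Suc i)"
    and Us_stable: "i \<le> m \<Longrightarrow> stable Y (Us i)"
    and V_down: "i < m \<Longrightarrow> w \<in> Us (Suc i) \<Longrightarrow> V w \<in> Us i"
    and V_inj: "Suc i < m \<Longrightarrow> w \<in> Us (Suc (Suc i)) \<Longrightarrow> V w \<in> Us i \<Longrightarrow> w \<in> Us (Suc i)"
    and p_irr: "i \<in> {1..m} \<Longrightarrow> irreducible (p i)"
    and p_monic: "i \<in> {1..m} \<Longrightarrow> lead_coeff (p i) = 1"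
    and e_mem: "i \<in> {1..m} \<Longrightarrow> e i \<in> Us i"
    and e_cyc: "i \<in> {1..m} \<Longrightarrow> cyc (Us (i - 1)) Y (e i) = Us i"
    and e_ann: "i \<in> {1..m} \<Longrightarrow> pa Y f (e i) \<in> Us (i - 1) \<longleftrightarrow> p i ^ s i dvd f"
begin

lemma Us_subspace: "i \<le> m \<Longrightarrow> subspace (Us i)"
  using Us_stable by (rule stable_subspace)

lemma Us_pa: "i \<le> m \<Longrightarrow> w \<in> Us i \<Longrightarrow> pa Y f w \<in> Us i"
  using stable_pa[OF Y_lin Us_stable] by blast

lemma Us_le: "i \<le> j \<Longrightarrow> j \<le> m \<Longrightarrow> Us i \<subseteq> Us j"
proof (induction j rule: dec_induct)
  case (step n)
  then show ?case using Us_mono[of n] by simp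
qed simp

lemma Us_rep:
  assumes "i < m" "w \<in> Us (Suc i)"
  obtains f z where "w = pa Y f (e (Suc i)) + z" "z \<in> Us i"
proof -
  have "w \<in> cyc (Us i) Y (e (Suc i))" using e_cyc[of "Suc i"] assms by simp
  then show thesis using that unfolding cyc_def by blast
qed

lemma Us_kill:
  assumes i: "i < m" and w: "w \<in> Us (Suc i)"
  shows "pa Y (p (Suc i) ^ s (Suc i)) w \<in> Us i"
proof -
  obtain f z where fz: "w = pa Y f (e (Suc i)) + z" "z \<in> Us i" using Us_rep[OF assms] .
  have "pa Y (p (Suc i) ^ s (Suc i) * f) (e (Suc i)) \<in> Us i" using e_ann[of "Suc i"] i by simp
  moreover have "pa Y (p (Suc i) ^ s (Suc i)) z \<in> Us i" using Us_pa fz(2) i by simp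
  ultimately show ?thesis
    unfolding fz(1) using Us_subspace[of i] i
    by (simp add: lin_add[OF lin_pa[OF Y_lin]] pa_mult[OF Y_lin] subspace_add)
qed

lemma V_pa: "pa Y f (V w) = V (pa Y (f \<circ>\<^sub>p [:1, 1:]) w)"
  by (rule pa_twist[OF Y_lin V_lin]) (simp add: twist)

lemma s_pos: assumes "i \<in> {1..m}" shows "s i \<ge> 1"
proof (rule ccontr)
  assume "\<not> s i \<ge> 1"
  then have "s i = 0" by simp
  then have "pa Y 1 (e i) \<in> Us (i - 1)" using e_ann[OF assms, of 1] by simp
  then have "e i \<in> Us (i - 1)" using Y_lin by simp
  then have "cyc (Us (i - 1)) Y (e i) \<subseteq> Us (i - 1)"
    using assms by (intro cyc_subset[OF Y_lin Us_stable]) auto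
  moreover obtain k where "i = Suc k" using assms by (cases i) auto
  ultimately show False using e_cyc[OF assms] Us_mono[of k] assms by auto
qed

text \<open>\<open>V\<close> sends the generator of factor i + 1 into factor i, which p_i^s_i
  annihilates. Passing this polynomial through \<open>V\<close> shifts it, and injectivity of
  \<open>V\<close> shows that p_(i+1)^s_(i+1) divides p_i(X + 1)^s_i. Both bases are monic and
  irreducible, hence equal, and the exponents compare.\<close>

lemma p_s_Suc:
  assumes i: "i \<in> {1..<m}"
  shows "p (Suc i) = p i \<circ>\<^sub>p [:1, 1:]" and "s (Suc i) \<le> s i"
proof -
  obtain k where k: "i = Suc k" using i by (cases i) auto
  let ?e = "e (Suc i)" and ?q = "p i \<circ>\<^sub>p [:1, 1:]"
  have iS: "Suc i \<in> {1..m}" and i1: "i \<in> {1..m}" using i by auto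
  have "V ?e \<in> Us i" using V_down[of i ?e] e_mem[OF iS] i by simp
  then have "pa Y (p i ^ s i) (V ?e) \<in> Us k" using Us_kill[of k "V ?e"] i k by simp
  then have "V (pa Y (?q ^ s i) ?e) \<in> Us k" by (simp add: V_pa pcompose_power)
  moreover have "pa Y (?q ^ s i) ?e \<in> Us (Suc (Suc k))"
    using Us_pa[of "Suc i"] e_mem[OF iS] i k by simp
  ultimately have "pa Y (?q ^ s i) ?e \<in> Us i" using V_inj[of k] i k by simp
  then have dvd: "p (Suc i) ^ s (Suc i) dvd ?q ^ s i" using e_ann[OF iS] by simp
  have "p (Suc i) dvd ?q ^ s i"
    using dvd s_pos[OF iS] dvd_trans[OF dvd_power[of "s (Suc i)" "p (Suc i)"]] by simp
  then have "p (Suc i) dvd ?q"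
    using irreducible_prime_elem[OF p_irr[OF iS]] prime_elem_dvd_power by blast
  then show eq: "p (Suc i) = ?q"
    using irreducible_monic_dvd_eq[OF p_irr[OF iS] irreducible_pcompose_shift[OF p_irr[OF i1]] p_monic[OF iS]]
      p_monic[OF i1] monic_pcompose_shift[of "p i" 1] by simp
  have "p (Suc i) \<noteq> 0" "\<not> is_unit (p (Suc i))" using p_irr[OF iS] by (auto simp: irreducible_def)
  then show "s (Suc i) \<le> s i" using dvd eq by (metis dvd_power_iff)
qed

lemma p_shift: "i \<in> {1..m} \<Longrightarrow> p i = p 1 \<circ>\<^sub>p [:of_nat (i - 1), 1:]"
proof (induction i)
  case (Suc i)
  show ?case
  proof (cases "i = 0")
    case True
    then show ?thesis by (simp add: pcompose_idR)
  next
    case False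
    then have "p (Suc i) = (p 1 \<circ>\<^sub>p [:of_nat (i - 1), 1:]) \<circ>\<^sub>p [:1, 1:]"
      using p_s_Suc(1)[of i] Suc by simp
    also have "\<dots> = p 1 \<circ>\<^sub>p [:of_nat i, 1:]"
      using False by (simp add: pcompose_shift_shift of_nat_diff)
    finally show ?thesis by simp
  qed
qed simp

lemma degree_p: "i \<in> {1..m} \<Longrightarrow> degree (p i) = degree (p 1)"
  by (subst p_shift) (simp_all add: degree_pcompose)

lemma s_antimono: "i \<le> j \<Longrightarrow> 1 \<le> i \<Longrightarrow> j \<le> m \<Longrightarrow> s j \<le> s i"
proof (induction j rule: dec_induct)
  case (step n)
  then show ?case using p_s_Suc(2)[of n] by simp
qed simp

end

text \<open>The forms in which the hypotheses on stabilizer and characteristic are used: no nonzero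
  shift fixes p_1, and 0, ..., m - 1 are distinct in the field.\<close>

locale separated_tower = tower +
  assumes stab: "p 1 \<circ>\<^sub>p [:c, 1:] = p 1 \<Longrightarrow> c = 0"
    and of_nat_inj: "i < m \<Longrightarrow> j < m \<Longrightarrow> of_nat i = (of_nat j :: 'a) \<Longrightarrow> i = j"
begin

text \<open>All p_i are shifts of p_1 and shifts add up, so two shifts of p_1 that agree differ by
  an element of its trivial stabilizer.\<close>

lemma shift_eq:
  assumes i: "i \<in> {1..m}" and j: "j \<in> {1..m}" and eq: "p j \<circ>\<^sub>p [:c, 1:] = p i"
  shows "c + of_nat (j - 1) = of_nat (i - 1)"
proof -
  have "p 1 \<circ>\<^sub>p [:c + of_nat (j - 1) - of_nat (i - 1), 1:]
      = ((p 1 \<circ>\<^sub>p [:of_nat (j - 1), 1:]) \<circ>\<^sub>p [:c, 1:]) \<circ>\<^sub>p [:- of_nat (i - 1), 1:]"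
    by (simp add: pcompose_shift_shift algebra_simps)
  also have "\<dots> = (p 1 \<circ>\<^sub>p [:of_nat (i - 1), 1:]) \<circ>\<^sub>p [:- of_nat (i - 1), 1:]"
    using eq p_shift[OF i] p_shift[OF j] by metis
  also have "\<dots> = p 1" by (simp add: pcompose_shift_shift pcompose_idR)
  finally have "c + of_nat (j - 1) - of_nat (i - 1) = 0" by (rule stab)
  then show ?thesis by simp
qed

lemma p_distinct:
  assumes "i \<in> {1..m}" "j \<in> {1..m}" "p i = p j"
  shows "i = j"
proof -
  have "p j \<circ>\<^sub>p [:0, 1:] = p i" using assms(3) by (simp add: pcompose_idR)
  then have eq: "of_nat (j - 1) = (of_nat (i - 1) :: 'a)" using shift_eq[OF assms(1,2), of 0] by simp
  have "j - 1 = i - 1" by (rule of_nat_inj[OF _ _ eq]) (use assms in auto)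
  moreover have "1 \<le> i" "1 \<le> j" using assms(1,2) by auto
  ultimately show ?thesis by linarith
qed

text \<open>The primary component of p_i. By \<open>primary_component\<close> a vector annihilated
  by some power of p_i lies in \<open>Us i\<close> and is already annihilated by the exponent
  \<open>s i\<close>.\<close>

definition Uc :: "nat \<Rightarrow> 'b set" where
  "Uc i = {w \<in> Us i. pa Y (p i ^ s i) w = 0}"

lemma Uc_subset: "Uc i \<subseteq> Us i"
  unfolding Uc_def by blast

lemma Uc_stable: assumes "i \<le> m" shows "stable Y (Uc i)"
proof -
  have "subspace {w\<in>Us i. pa Y (p i ^ s i) w \<in> {0}}"
    by (rule subspace_vimage[OF lin_pa[OF Y_lin]]) (use Us_subspace[OF assms] in auto)
  then have "subspace (Uc i)" unfolding Uc_def by simp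
  then show ?thesis unfolding stable_def Uc_def
    using stable_mem[OF Us_stable[OF assms]] pa_commute[OF Y_lin Y_lin] Y_lin by auto
qed

lemma Uc_subspace: "i \<le> m \<Longrightarrow> subspace (Uc i)"
  using Uc_stable by (rule stable_subspace)

lemma Uc_pa: "i \<le> m \<Longrightarrow> w \<in> Uc i \<Longrightarrow> pa Y f w \<in> Uc i"
  using stable_pa[OF Y_lin Uc_stable] by blast

text \<open>Descend along the series. If q differs from the polynomial of the top factor, its powers
  are injective there, so \<open>w\<close> drops one step. If it agrees, p^s applied to
  \<open>w\<close> lies one step lower and is still annihilated by a power of q, but all polynomials
  below are different from q, so it is zero.\<close>

lemma primary_component:
  assumes "irreducible q" "lead_coeff q = 1"
  shows "i \<le> m \<Longrightarrow> w \<in> Us i \<Longrightarrow> pa Y (q ^ k) w = 0 \<Longrightarrow> w = 0 \<or> (\<exists>j\<in>{1..i}. q = p j \<and> w \<in> Uc j)"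
proof (induction i arbitrary: w k)
  case 0
  then show ?case using Us_0 by simp
next
  case (Suc i)
  have iS: "Suc i \<in> {1..m}" and i: "i < m" using Suc.prems by auto
  show ?case
  proof (cases "q = p (Suc i)")
    case False
    obtain f z where fz: "w = pa Y f (e (Suc i)) + z" "z \<in> Us i" using Us_rep[OF i Suc.prems(2)] .
    have "pa Y (q ^ k) (pa Y f (e (Suc i))) = - pa Y (q ^ k) z"
      using Suc.prems(3) unfolding fz(1) by (simp add: lin_add[OF lin_pa[OF Y_lin]] eq_neg_iff_add_eq_0)
    also have "\<dots> \<in> Us i" using Us_pa[of i z] fz(2) i Us_subspace[of i] by (simp add: subspace_neg)
    finally have "pa Y (q ^ k * f) (e (Suc i)) \<in> Us i" by (simp add: pa_mult[OF Y_lin])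
    then have "p (Suc i) ^ s (Suc i) dvd q ^ k * f" using e_ann[OF iS] by simp
    moreover have "bezout_coprime (p (Suc i)) q"
      using irreducible_bezout_coprime_distinct p_irr[OF iS] p_monic[OF iS] assms False by metis
    ultimately have "p (Suc i) ^ s (Suc i) dvd f"
      using bezout_coprime_dvd_mult[OF bezout_coprime_powers] by blast
    then have "pa Y f (e (Suc i)) \<in> Us i" using e_ann[OF iS] by simp
    then have "w \<in> Us i" unfolding fz(1) using fz(2) Us_subspace[of i] i by (simp add: subspace_add)
    then have "w = 0 \<or> (\<exists>j\<in>{1..i}. q = p j \<and> w \<in> Uc j)" using Suc.IH[of w k] Suc.prems i by simp
    then show ?thesis by auto
  next
    case True
    let ?w = "pa Y (p (Suc i) ^ s (Suc i)) w"
    have "?w \<in> Us i" using Us_kill[OF i Suc.prems(2)] .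
    moreover have "pa Y (q ^ k) ?w = 0"
    proof -
      have "pa Y (q ^ k) ?w = pa Y (p (Suc i) ^ s (Suc i)) (pa Y (q ^ k) w)"
        by (simp only: pa_mult[OF Y_lin, symmetric] mult.commute)
      then show ?thesis using Suc.prems(3) lin_pa[OF Y_lin] by simp
    qed
    ultimately have "?w = 0 \<or> (\<exists>j\<in>{1..i}. q = p j \<and> ?w \<in> Uc j)" using Suc.IH[of ?w k] i by simp
    moreover have "q \<noteq> p j" if "j \<in> {1..i}" for j
      using p_distinct[OF iS, of j] that True i by auto
    ultimately have "?w = 0" by blast
    then have "w \<in> Uc (Suc i)" unfolding Uc_def using Suc.prems(2) by simp
    then show ?thesis using True by auto
  qed
qed

lemma Uc_Int_lower:
  assumes "i < m" "w \<in> Us i" "pa Y (p (Suc i) ^ k) w = 0"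
  shows "w = 0"
proof -
  have iS: "Suc i \<in> {1..m}" using assms(1) by auto
  have "w = 0 \<or> (\<exists>j\<in>{1..i}. p (Suc i) = p j \<and> w \<in> Uc j)"
    using primary_component[OF p_irr[OF iS] p_monic[OF iS], of i w k] assms by simp
  moreover have "p (Suc i) \<noteq> p j" if "j \<in> {1..i}" for j
    using p_distinct[OF iS, of j] that assms(1) by auto
  ultimately show ?thesis by blast
qed

lemma Us_annihilated: "i \<le> m \<Longrightarrow> w \<in> Us i \<Longrightarrow> pa Y (\<Prod>l\<in>{1..i}. p l ^ s l) w = 0"
proof (induction i arbitrary: w)
  case 0
  then show ?case using Us_0 Y_lin by simp
next
  case (Suc i)
  have "pa Y (p (Suc i) ^ s (Suc i)) w \<in> Us i" using Us_kill Suc.prems by simp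
  then have "pa Y (\<Prod>l\<in>{1..i}. p l ^ s l) (pa Y (p (Suc i) ^ s (Suc i)) w) = 0" using Suc by simp
  then show ?case by (simp add: pa_mult[OF Y_lin])
qed

text \<open>The product of the lower prime powers annihilates \<open>Us i\<close> and is coprime to
  the new one. In the resulting decomposition of \<open>w\<close> one part is annihilated by the new
  prime power, the other is a multiple of its value at \<open>w\<close> and so lies in
  \<open>Us i\<close>.\<close>

lemma Us_split:
  assumes i: "i < m" and w: "w \<in> Us (Suc i)"
  obtains u z where "w = u + z" "u \<in> Uc (Suc i)" "z \<in> Us i"
proof -
  let ?Q = "\<Prod>l\<in>{1..i}. p l ^ s l" and ?P = "p (Suc i) ^ s (Suc i)"
  have iS: "Suc i \<in> {1..m}" using i by auto
  have "bezout_coprime (p l ^ s l) ?P" if "l \<in> {1..i}" for l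
  proof -
    have l: "l \<in> {1..m}" "p l \<noteq> p (Suc i)" using that i p_distinct[OF iS, of l] by auto
    then show ?thesis
      using irreducible_bezout_coprime_distinct[OF p_irr[OF l(1)] p_irr[OF iS] p_monic[OF l(1)] p_monic[OF iS]]
      by (intro bezout_coprime_powers)
  qed
  then have "bezout_coprime ?Q ?P" by (intro bezout_coprime_prod) auto
  then obtain a b where ab: "\<And>u. u = pa Y (a * ?Q) u + pa Y (b * ?P) u"
    using bezout_coprime_split[OF Y_lin] by metis
  have Pw: "pa Y ?P w \<in> Us i" using Us_kill[OF i w] .
  have "pa Y ?P (pa Y (a * ?Q) w) = pa Y a (pa Y ?Q (pa Y ?P w))"
    by (simp only: pa_mult[OF Y_lin, symmetric] ac_simps)
  also have "\<dots> = 0" using Us_annihilated[of i, OF _ Pw] i lin_pa[OF Y_lin] by simp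
  finally have "pa Y (a * ?Q) w \<in> Uc (Suc i)" unfolding Uc_def using Us_pa[of "Suc i" w] w i by simp
  moreover have "pa Y (b * ?P) w \<in> Us i" using Us_pa[of i "pa Y ?P w"] Pw i by (simp add: pa_mult[OF Y_lin])
  ultimately show thesis using that ab by blast
qed

lemma Us_sum_Uc:
  assumes "i \<le> m" "w \<in> Us i"
  shows "\<exists>u. (\<forall>j\<in>{1..i}. u j \<in> Uc j) \<and> w = (\<Sum>j\<in>{1..i}. u j)"
  using assms
proof (induction i arbitrary: w)
  case 0
  then show ?case using Us_0 by simp
next
  case (Suc i)
  obtain u0 z where uz: "w = u0 + z" "u0 \<in> Uc (Suc i)" "z \<in> Us i" using Us_split Suc.prems by (metis Suc_le_lessD)
  obtain u where u: "\<forall>j\<in>{1..i}. u j \<in> Uc j" "z = (\<Sum>j\<in>{1..i}. u j)" using Suc.IH[of z] uz(3) Suc.prems by auto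
  have "(\<Sum>j\<in>{1..i}. (u(Suc i := u0)) j) = (\<Sum>j\<in>{1..i}. u j)" by (rule sum.cong) auto
  then have "w = (\<Sum>j\<in>{1..Suc i}. (u(Suc i := u0)) j)" using uz(1) u(2) by (simp add: add.commute)
  moreover have "\<forall>j\<in>{1..Suc i}. (u(Suc i := u0)) j \<in> Uc j" using u(1) uz(2) by auto
  ultimately show ?case by blast
qed

lemma Uc_sum_eq_0:
  assumes "i \<le> m" "\<forall>j\<in>{1..i}. u j \<in> Uc j" "(\<Sum>j\<in>{1..i}. u j) = 0"
  shows "\<forall>j\<in>{1..i}. u j = 0"
  using assms
proof (induction i)
  case (Suc i)
  have mem: "(\<Sum>j\<in>{1..i}. u j) \<in> Us i"
  proof (rule subspace_sum)
    show "subspace (Us i)" using Us_subspace Suc.prems by simp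
    fix j assume j: "j \<in> {1..i}"
    then have "u j \<in> Uc j" using Suc.prems(2) by simp
    then show "u j \<in> Us i" using Uc_subset[of j] Us_le[of j i] Suc.prems(1) j by auto
  qed
  have "u (Suc i) = - (\<Sum>j\<in>{1..i}. u j)" using Suc.prems(3) by (simp add: eq_neg_iff_add_eq_0 add.commute)
  also have "\<dots> \<in> Us i" using mem Us_subspace[of i] Suc.prems by (simp add: subspace_neg)
  finally have "u (Suc i) \<in> Us i" .
  moreover have "pa Y (p (Suc i) ^ s (Suc i)) (u (Suc i)) = 0" using Suc.prems(2) unfolding Uc_def by simp
  ultimately have 0: "u (Suc i) = 0" using Uc_Int_lower[of i] Suc.prems(1) by simp
  have "(\<Sum>j\<in>{1..i}. u j) = 0" using Suc.prems(3) 0 by simp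
  then have "\<forall>j\<in>{1..i}. u j = 0" by (intro Suc.IH) (use Suc.prems(1,2) in simp_all)
  then show ?case using 0 by (auto simp: le_Suc_eq)
qed simp

lemma lin_eqI:
  assumes "lin h" "lin k" "\<And>i w. i \<in> {1..m} \<Longrightarrow> w \<in> Uc i \<Longrightarrow> h w = k w"
  shows "h w = k w"
proof -
  obtain u where u: "\<forall>j\<in>{1..m}. u j \<in> Uc j" "w = (\<Sum>j\<in>{1..m}. u j)"
    using Us_sum_Uc[of m w] Us_m by auto
  then show ?thesis using assms by (simp add: lin_sum)
qed

text \<open>The shift of p_i by one is p_(i+1), so \<open>V\<close> lowers the component by one. If
  \<open>V w\<close> vanishes, \<open>V_inj\<close> puts \<open>w\<close> into \<open>Us i\<close>,
  which meets the component of index i + 1 only in zero.\<close>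

lemma V_Uc:
  assumes "i < m" "w \<in> Uc (Suc i)"
  shows "i = 0 \<Longrightarrow> V w = 0" and "i > 0 \<Longrightarrow> V w \<in> Uc i" and "i > 0 \<Longrightarrow> V w = 0 \<Longrightarrow> w = 0"
proof -
  have wU: "w \<in> Us (Suc i)" using assms(2) Uc_subset by blast
  have Vw: "V w \<in> Us i" using V_down[OF assms(1) wU] .
  show "i = 0 \<Longrightarrow> V w = 0" using Vw Us_0 by simp
  show "V w \<in> Uc i" if "i > 0"
  proof -
    have i: "i \<in> {1..<m}" "i \<in> {1..m}" using that assms(1) by auto
    have "pa Y (p i ^ s i) (V w) = V (pa Y (p (Suc i) ^ s i) w)"
      using p_s_Suc(1)[OF i(1)] by (simp add: V_pa pcompose_power)
    also have "p (Suc i) ^ s i = p (Suc i) ^ (s i - s (Suc i)) * p (Suc i) ^ s (Suc i)"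
      using p_s_Suc(2)[OF i(1)] by (simp add: power_add[symmetric])
    also have "pa Y \<dots> w = 0" using assms(2) lin_pa[OF Y_lin] unfolding Uc_def by (simp add: pa_mult[OF Y_lin])
    finally show ?thesis using Vw V_lin unfolding Uc_def by simp
  qed
  show "w = 0" if "i > 0" "V w = 0"
  proof -
    from that(1) obtain k where k: "i = Suc k" by (cases i) auto
    have "V w \<in> Us k" using that(2) Us_subspace[of k] assms(1) k by (simp add: subspace_0)
    then have "w \<in> Us i" using V_inj[of k w] k assms(1) wU by simp
    then show ?thesis using Uc_Int_lower[OF assms(1)] assms(2) unfolding Uc_def by blast
  qed
qed

subsection \<open>Weight operators\<close>

text \<open>What is retained of the action of an eigenvector of ad y in the ideal, with eigenvalue
  \<open>d\<close>; that it commutes with \<open>V\<close> reflects that the ideal is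
  abelian.\<close>

definition weight_op :: "'a \<Rightarrow> ('b \<Rightarrow> 'b) \<Rightarrow> bool" where
  "weight_op d u \<longleftrightarrow> lin u \<and> (\<forall>w. Y (u w) = u (Y w) + sc d (u w)) \<and>
     (\<forall>i\<le>m. \<forall>w\<in>Us i. u w \<in> Us i) \<and> (\<forall>w. u (V w) = V (u w))"

text \<open>\<open>u w\<close> is annihilated by a power of p_i(X - d). Being nonzero it lies in a
  component U_j whose p_j is that polynomial, and \<open>shift_eq\<close> turns this into d = i -
  j.\<close>

lemma weight_op_component:
  assumes u: "weight_op d u" and i: "i \<in> {1..m}" and w: "w \<in> Uc i" and nz: "u w \<noteq> 0"
  shows "\<exists>j\<in>{1..i}. d = of_nat (i - j) \<and> u w \<in> Uc j"
proof -
  have lu: "lin u" and tw: "\<And>w. Y (u w) = u (Y w) + sc d (u w)" and Uu: "u w \<in> Us i"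
    using u i w Uc_subset[of i] unfolding weight_op_def by auto
  define q where "q = p i \<circ>\<^sub>p [:- d, 1:]"
  have qd: "q \<circ>\<^sub>p [:d, 1:] = p i" unfolding q_def by (simp add: pcompose_shift_shift pcompose_idR)
  have q: "irreducible q" "lead_coeff q = 1"
    unfolding q_def
    using irreducible_pcompose_shift[OF p_irr[OF i]] monic_pcompose_shift[of "p i" "- d"] p_monic[OF i] by metis+
  have "pa Y (q ^ s i) (u w) = u (pa Y (p i ^ s i) w)"
    using pa_twist[OF Y_lin lu tw] by (simp add: pcompose_power qd)
  also have "\<dots> = 0" using w lu unfolding Uc_def by simp
  finally have "\<exists>j\<in>{1..i}. q = p j \<and> u w \<in> Uc j"
    using primary_component[OF q, of i "u w" "s i"] Uu i nz by auto
  then obtain j where j: "j \<in> {1..i}" "q = p j" "u w \<in> Uc j" by blast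
  have "d + of_nat (j - 1) = of_nat (i - 1)" using shift_eq[OF i, of j d] j(1,2) qd i by auto
  then have "d = of_nat (i - 1) - of_nat (j - 1)" by (simp add: eq_diff_eq)
  also have "\<dots> = of_nat (i - 1 - (j - 1))" by (rule of_nat_diff[symmetric]) (use j(1) in auto)
  also have "i - 1 - (j - 1) = i - j" using j(1) by auto
  finally show ?thesis using j by blast
qed

lemma weight_op_of_nat:
  assumes u: "weight_op (of_nat k) u" and k: "k < m" and i: "i \<in> {1..m}" and w: "w \<in> Uc i"
  shows "i \<le> k \<Longrightarrow> u w = 0" and "k < i \<Longrightarrow> u w \<in> Uc (i - k)"
proof -
  have *: "u w = 0 \<or> (k < i \<and> u w \<in> Uc (i - k))"
  proof (cases "u w = 0")
    case False
    then obtain j where j: "j \<in> {1..i}" "of_nat k = (of_nat (i - j) :: 'a)" "u w \<in> Uc j"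
      using weight_op_component[OF u i w] by blast
    then have "k = i - j" using of_nat_inj[OF k, of "i - j"] i by auto
    then show ?thesis using j by auto
  qed simp
  then show "i \<le> k \<Longrightarrow> u w = 0" by auto
  show "u w \<in> Uc (i - k)" if "k < i"
    using * subspace_0[OF Uc_subspace[of "i - k"]] i that by auto
qed

lemma weight_op_nonzero:
  assumes u: "weight_op d u" and nz: "u w \<noteq> 0"
  shows "\<exists>j<m. d = of_nat j"
proof -
  have lu: "lin u" using u unfolding weight_op_def by blast
  have "\<exists>i\<in>{1..m}. \<exists>w\<in>Uc i. u w \<noteq> 0"
  proof (rule ccontr)
    assume "\<not> ?thesis"
    then have "u w = 0" using lin_eqI[OF lu lin_zero] by blast
    then show False using nz by blast
  qed
  then obtain i w where "i \<in> {1..m}" "w \<in> Uc i" "u w \<noteq> 0" by blast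
  then obtain j where "j \<in> {1..i}" "d = of_nat (i - j)" using weight_op_component[OF u] by blast
  moreover have "i - j < m" using \<open>j \<in> {1..i}\<close> \<open>i \<in> {1..m}\<close> by auto
  ultimately show ?thesis by blast
qed

subsection \<open>Adapted generators\<close>

definition generates :: "nat \<Rightarrow> 'b \<Rightarrow> bool" where
  "generates i w \<longleftrightarrow> w \<in> Uc i \<and> (\<forall>u\<in>Uc i. \<exists>f. u = pa Y f w) \<and> (\<forall>f. pa Y f w = 0 \<longleftrightarrow> p i ^ s i dvd f)"

text \<open>Take the part of \<open>e (Suc i)\<close> in the component. The discarded part lies in
  \<open>Us i\<close>, which the component meets only in zero, so the annihilator and the generating
  property carry over.\<close>

lemma exists_generator:
  assumes i: "i < m"
  shows "\<exists>w. generates (Suc i) w"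
proof -
  have iS: "Suc i \<in> {1..m}" using i by auto
  obtain u z where uz: "e (Suc i) = u + z" "u \<in> Uc (Suc i)" "z \<in> Us i" using Us_split[OF i] e_mem[OF iS] by metis
  have sU: "subspace (Us i)" using Us_subspace i by simp
  have zf: "pa Y f z \<in> Us i" for f using Us_pa uz(3) i by simp
  have fe: "pa Y f (e (Suc i)) = pa Y f u + pa Y f z" for f unfolding uz(1) by (simp add: lin_add lin_pa Y_lin)
  have "pa Y f u = 0 \<longleftrightarrow> p (Suc i) ^ s (Suc i) dvd f" for f
  proof
    assume "pa Y f u = 0"
    then have "pa Y f (e (Suc i)) \<in> Us i" using fe zf by simp
    then show "p (Suc i) ^ s (Suc i) dvd f" using e_ann[OF iS] by simp
  next
    assume "p (Suc i) ^ s (Suc i) dvd f"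
    then obtain g where "f = p (Suc i) ^ s (Suc i) * g" by blast
    then show "pa Y f u = 0" using uz(2) lin_pa[OF Y_lin] unfolding Uc_def by (simp add: pa_mult'[OF Y_lin])
  qed
  moreover have "\<exists>f. w = pa Y f u" if w: "w \<in> Uc (Suc i)" for w
  proof -
    obtain f z' where fz: "w = pa Y f (e (Suc i)) + z'" "z' \<in> Us i" using Us_rep[OF i] w Uc_subset by blast
    have "w - pa Y f u = pa Y f z + z'" unfolding fz(1) fe by simp
    then have 1: "w - pa Y f u \<in> Us i" using zf fz(2) subspace_add[OF sU] by simp
    have "w - pa Y f u \<in> Uc (Suc i)"
      using w uz(2) Uc_pa[of "Suc i" u f] Uc_subspace[of "Suc i"] i by (simp add: subspace_diff)
    then have "w - pa Y f u = 0" using Uc_Int_lower[OF i 1] unfolding Uc_def by blast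
    then show ?thesis by auto
  qed
  ultimately show ?thesis unfolding generates_def using uz(2) by blast
qed

text \<open>Start from any generator \<open>w0\<close> and write \<open>V w0\<close> as h(y) w.
  Comparing annihilators shows that h is p_i^(s_i - s_(i+1)) times a polynomial k prime to p_i.
  Inverting k modulo p_i^s_i and moving the inverse through \<open>V\<close> corrects
  \<open>w0\<close>.\<close>

lemma lift_generator:
  assumes i: "i \<in> {1..<m}" and w: "generates i w"
  shows "\<exists>w'. generates (Suc i) w' \<and> V w' = pa Y (p i ^ (s i - s (Suc i))) w"
proof -
  have im: "i < m" "i > 0" and iS: "Suc i \<in> {1..m}" and i1: "i \<in> {1..m}" using i by auto
  obtain w0 where w0: "generates (Suc i) w0" using exists_generator[OF im(1)] by blast
  have wU: "w \<in> Uc i" and ann: "\<And>f. pa Y f w = 0 \<longleftrightarrow> p i ^ s i dvd f"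
    and rep: "\<And>u. u \<in> Uc i \<Longrightarrow> \<exists>f. u = pa Y f w" using w unfolding generates_def by auto
  have w0U: "w0 \<in> Uc (Suc i)" and ann0: "\<And>f. pa Y f w0 = 0 \<longleftrightarrow> p (Suc i) ^ s (Suc i) dvd f"
    and rep0: "\<And>u. u \<in> Uc (Suc i) \<Longrightarrow> \<exists>f. u = pa Y f w0" using w0 unfolding generates_def by auto
  have shift_back: "(f \<circ>\<^sub>p [:-1, 1:]) \<circ>\<^sub>p [:1, 1:] = f" for f :: "'a poly"
    by (simp add: pcompose_shift_shift pcompose_idR)
  have pS: "p (Suc i) = p i \<circ>\<^sub>p [:1, 1:]" and le: "s (Suc i) \<le> s i" using p_s_Suc[OF i] by auto
  have p0: "p i \<noteq> 0" "\<not> is_unit (p i)" using p_irr[OF i1] by (auto simp: irreducible_def)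
  have annV: "pa Y f (V w0) = 0 \<longleftrightarrow> p i ^ s (Suc i) dvd f" for f
  proof -
    have "pa Y f (V w0) = 0 \<longleftrightarrow> pa Y (f \<circ>\<^sub>p [:1, 1:]) w0 = 0"
      using V_Uc(3)[OF im(1) Uc_pa[OF _ w0U] im(2)] im V_lin by (auto simp: V_pa)
    also have "\<dots> \<longleftrightarrow> (p i ^ s (Suc i)) \<circ>\<^sub>p [:1, 1:] dvd f \<circ>\<^sub>p [:1, 1:]"
      by (simp add: ann0 pS pcompose_power)
    also have "\<dots> \<longleftrightarrow> p i ^ s (Suc i) dvd f"
    proof
      assume "(p i ^ s (Suc i)) \<circ>\<^sub>p [:1, 1:] dvd f \<circ>\<^sub>p [:1, 1:]"
      then obtain g where "f \<circ>\<^sub>p [:1, 1:] = (p i ^ s (Suc i)) \<circ>\<^sub>p [:1, 1:] * g" by blast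
      then have "(f \<circ>\<^sub>p [:1, 1:]) \<circ>\<^sub>p [:-1, 1:] = ((p i ^ s (Suc i)) \<circ>\<^sub>p [:1, 1:]) \<circ>\<^sub>p [:-1, 1:] * (g \<circ>\<^sub>p [:-1, 1:])"
        by (simp add: pcompose_mult)
      then have "f = p i ^ s (Suc i) * (g \<circ>\<^sub>p [:-1, 1:])" by (simp add: pcompose_shift_shift pcompose_idR)
      then show "p i ^ s (Suc i) dvd f" by simp
    qed (auto simp: pcompose_mult elim!: dvdE)
    finally show ?thesis .
  qed
  obtain h where h: "V w0 = pa Y h w" using rep[OF V_Uc(2)[OF im(1) w0U im(2)]] by blast
  have annh: "p i ^ s i dvd f * h \<longleftrightarrow> p i ^ s (Suc i) dvd f" for f
    using annV[of f] unfolding h by (simp add: pa_mult[OF Y_lin, symmetric] ann)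
  have "p i ^ (s (Suc i) + (s i - s (Suc i))) dvd p i ^ s (Suc i) * h" using annh[of "p i ^ s (Suc i)"] le by simp
  then have "p i ^ (s i - s (Suc i)) dvd h" using p0 by (simp add: power_add)
  then obtain k where k: "h = p i ^ (s i - s (Suc i)) * k" by blast
  have "\<not> p i dvd k"
  proof
    assume "p i dvd k"
    then obtain l where l: "k = p i * l" by blast
    obtain t where t: "s (Suc i) = Suc t" using s_pos[OF iS] by (cases "s (Suc i)") auto
    have "p i ^ t * h = p i ^ (t + (s i - s (Suc i)) + 1) * l" unfolding k l by (simp add: power_add ac_simps)
    also have "t + (s i - s (Suc i)) + 1 = s i" using t le by simp
    finally have "p i ^ s (Suc i) dvd p i ^ t" using annh[of "p i ^ t"] by simp
    then have "s (Suc i) \<le> t" using p0 by (metis dvd_power_iff)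
    then show False using t by simp
  qed
  then have "bezout_coprime k (p i ^ s i)"
    using irreducible_bezout_coprime[OF p_irr[OF i1]] bezout_coprime_power bezout_coprime_sym by blast
  then obtain k' b where kb: "k' * k + b * p i ^ s i = 1" unfolding bezout_coprime_def by blast
  have wk: "pa Y (k' * k) w = w"
  proof -
    have "w = pa Y (k' * k + b * p i ^ s i) w" using kb Y_lin by simp
    also have "\<dots> = pa Y (k' * k) w" using ann[of "b * p i ^ s i"] by (simp add: pa_add)
    finally show ?thesis by simp
  qed
  \<comment> \<open>The inverse \<open>k'\<close> has to act on \<open>w0\<close>, on the other side
    of \<open>V\<close>; there it appears shifted by one.\<close>
  define K where "K = k' \<circ>\<^sub>p [:1, 1:]"
  define w' where "w' = pa Y K w0"
  have Vw': "V w' = pa Y (p i ^ (s i - s (Suc i))) w"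
  proof -
    have "V w' = pa Y k' (V w0)" unfolding w'_def K_def by (simp add: V_pa)
    also have "\<dots> = pa Y (p i ^ (s i - s (Suc i))) (pa Y (k' * k) w)"
      unfolding h k by (simp only: pa_mult[OF Y_lin, symmetric] ac_simps)
    finally show ?thesis using wk by simp
  qed
  have gen: "(\<forall>f. pa Y f w' = 0 \<longleftrightarrow> p (Suc i) ^ s (Suc i) dvd f) \<and> (\<exists>f. u = pa Y f w')"
    if u: "u \<in> Uc (Suc i)" for u
  proof -
    have pi: "(p i ^ s (Suc i)) \<circ>\<^sub>p [:1, 1:] = p (Suc i) ^ s (Suc i)" by (simp add: pS pcompose_power)
    have "(k' * k + b * p i ^ s i) \<circ>\<^sub>p [:1, 1:] = 1" using kb by (simp add: pcompose_1)
    then have "K * (k \<circ>\<^sub>p [:1, 1:]) + (b \<circ>\<^sub>p [:1, 1:] * p (Suc i) ^ (s i - s (Suc i))) * p (Suc i) ^ s (Suc i) = 1"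
      using le by (simp add: K_def pcompose_add pcompose_mult pcompose_power pS[symmetric] mult.assoc power_add[symmetric])
    then obtain c d where cd: "c * K + d * p (Suc i) ^ s (Suc i) = 1" by (metis mult.commute)
    then have cop: "bezout_coprime (p (Suc i) ^ s (Suc i)) K"
      unfolding bezout_coprime_def by (metis add.commute)
    have 1: "pa Y f w' = 0 \<longleftrightarrow> p (Suc i) ^ s (Suc i) dvd f" for f
      unfolding w'_def pa_mult[OF Y_lin, symmetric] ann0
      using bezout_coprime_dvd_mult[OF cop, of f] by (auto simp: mult.commute)
    obtain f where f: "u = pa Y f w0" using rep0[OF u] by blast
    have "w0 = pa Y (c * K + d * p (Suc i) ^ s (Suc i)) w0" using cd Y_lin by simp
    also have "\<dots> = pa Y c w'" using ann0[of "d * p (Suc i) ^ s (Suc i)"]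
      by (simp add: pa_add w'_def pa_mult[OF Y_lin, of c K])
    finally have "u = pa Y (f * c) w'" using f by (simp add: pa_mult[OF Y_lin])
    then show ?thesis using 1 by blast
  qed
  have "generates (Suc i) w'" unfolding generates_def
    using gen[OF w0U] gen Uc_pa[of "Suc i" w0 K] w0U im(1) unfolding w'_def[symmetric] by auto
  then show ?thesis using Vw' by blast
qed

lemma exists_generators:
  "\<exists>g. \<forall>i\<in>{1..m}. generates i (g i) \<and> (i > 1 \<longrightarrow> V (g i) = pa Y (p (i - 1) ^ (s (i - 1) - s i)) (g (i - 1)))"
proof -
  have "\<exists>g. \<forall>i\<in>{1..n}. generates i (g i) \<and> (i > 1 \<longrightarrow> V (g i) = pa Y (p (i - 1) ^ (s (i - 1) - s i)) (g (i - 1)))"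
    if "n \<le> m" for n
    using that
  proof (induction n)
    case (Suc n)
    then obtain g where g: "\<forall>i\<in>{1..n}. generates i (g i) \<and>
      (i > 1 \<longrightarrow> V (g i) = pa Y (p (i - 1) ^ (s (i - 1) - s i)) (g (i - 1)))" by auto
    have "\<exists>w. generates (Suc n) w \<and> (n > 0 \<longrightarrow> V w = pa Y (p n ^ (s n - s (Suc n))) (g n))"
    proof (cases "n = 0")
      case True
      then show ?thesis using exists_generator[of 0] m_gt_1 by simp
    next
      case False
      then show ?thesis using lift_generator[of n "g n"] g Suc.prems by simp
    qed
    then obtain w where w: "generates (Suc n) w" "n > 0 \<longrightarrow> V w = pa Y (p n ^ (s n - s (Suc n))) (g n)" by blast
    have "\<forall>i\<in>{1..Suc n}. generates i ((g(Suc n := w)) i) \<and>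
      (i > 1 \<longrightarrow> V ((g(Suc n := w)) i) = pa Y (p (i - 1) ^ (s (i - 1) - s i)) ((g(Suc n := w)) (i - 1)))"
      using g w by (auto simp: le_Suc_eq)
    then show ?case by blast
  qed simp
  then show ?thesis by blast
qed

end

section \<open>Block indices and block matrices\<close>

section \<open>Block matrices\<close>

lemma block_pos_offset:
  "i < length ns \<Longrightarrow> a < ns ! i \<Longrightarrow> block_pos ns (sum_list (take i ns) + a) = (i, a)"
proof (induction ns arbitrary: i)
  case (Cons n ns)
  then show ?case by (cases i) (auto simp: add.assoc)
qed simp

lemma offset_less: "i < length ns \<Longrightarrow> a < ns ! i \<Longrightarrow> sum_list (take i ns) + a < sum_list (ns :: nat list)"
proof (induction ns arbitrary: i)
  case (Cons n ns)
  show ?case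
  proof (cases i)
    case (Suc j)
    then show ?thesis using Cons.IH[of j] Cons.prems by simp
  qed (use Cons.prems in simp)
qed simp

lemma block_pos_bound:
  "r < sum_list ns \<Longrightarrow> fst (block_pos ns r) < length ns \<and> snd (block_pos ns r) < ns ! fst (block_pos ns r) \<and>
     sum_list (take (fst (block_pos ns r)) ns) + snd (block_pos ns r) = r"
proof (induction ns arbitrary: r)
  case (Cons n ns)
  show ?case
  proof (cases "r < n")
    case False
    then have "r - n < sum_list ns" using Cons.prems by simp
    from Cons.IH[OF this] show ?thesis using False by (auto simp: case_prod_beta Let_def)
  qed simp
qed simp

lemma block_pos_bij:
  "bij_betw (block_pos ns) {..<sum_list ns} (SIGMA i:{..<length ns}. {..<ns ! i})"
proof (rule bij_betw_byWitness[where f' = "\<lambda>ia. sum_list (take (fst ia) ns) + snd ia"])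
  show "block_pos ns ` {..<sum_list ns} \<subseteq> (SIGMA i:{..<length ns}. {..<ns ! i})"
  proof
    fix x assume "x \<in> block_pos ns ` {..<sum_list ns}"
    then obtain r where "r < sum_list ns" "x = block_pos ns r" by blast
    moreover obtain i a where "block_pos ns r = (i, a)" by (cases "block_pos ns r")
    ultimately show "x \<in> (SIGMA i:{..<length ns}. {..<ns ! i})"
      using block_pos_bound[of r ns] by simp
  qed
qed (auto simp: block_pos_bound block_pos_offset offset_less)

lemma sum_block_pos:
  "(\<Sum>r<sum_list ns. F (block_pos ns r)) = (\<Sum>i<length ns. \<Sum>a<ns ! i. F (i, a))"
proof -
  have "(\<Sum>r<sum_list ns. F (block_pos ns r)) = (\<Sum>x\<in>(SIGMA i:{..<length ns}. {..<ns ! i}). F x)"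
    by (rule sum.reindex_bij_betw[OF block_pos_bij])
  also have "\<dots> = (\<Sum>i<length ns. \<Sum>a<ns ! i. F (i, a))"
    by (subst sum.Sigma) (auto simp: case_prod_beta)
  finally show ?thesis .
qed

lemma block_mat_carrier: "block_mat ns B \<in> carrier_mat (sum_list ns) (sum_list ns)"
  unfolding block_mat_def by simp

lemma block_mat_index:
  "r < sum_list ns \<Longrightarrow> c < sum_list ns \<Longrightarrow> block_mat ns B $$ (r, c) =
    B (fst (block_pos ns r)) (fst (block_pos ns c)) $$ (snd (block_pos ns r), snd (block_pos ns c))"
  unfolding block_mat_def by (simp add: case_prod_beta Let_def)

lemma block_mat_cong:
  assumes "\<And>i k. i < length ns \<Longrightarrow> k < length ns \<Longrightarrow> B i k = B' i k"
  shows "block_mat ns B = block_mat ns B'"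
proof (rule eq_matI)
  fix r c assume "r < dim_row (block_mat ns B')" "c < dim_col (block_mat ns B')"
  then have rc: "r < sum_list ns" "c < sum_list ns" by (simp_all add: block_mat_def)
  show "block_mat ns B $$ (r, c) = block_mat ns B' $$ (r, c)"
    using assms block_pos_bound[OF rc(1)] block_pos_bound[OF rc(2)] by (simp add: block_mat_index rc)
qed (simp_all add: block_mat_def)

text \<open>This brings the block diagonal A and E into the form in which T is defined, so that one
  indexing of the basis serves all three.\<close>

lemma diag_block_mat_eq_block_mat:
  assumes "length Bs = length ns" "\<And>i. i < length ns \<Longrightarrow> Bs ! i \<in> carrier_mat (ns ! i) (ns ! i)"
  shows "diag_block_mat Bs = block_mat ns (\<lambda>i k. if i = k then Bs ! i else 0\<^sub>m (ns ! i) (ns ! k))"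
  using assms
proof (induction Bs arbitrary: ns)
  case Nil
  then show ?case by (intro eq_matI) (auto simp: block_mat_def)
next
  case (Cons B Bs)
  then obtain n ns' where ns: "ns = n # ns'" by (cases ns) auto
  have BC: "B \<in> carrier_mat n n" using Cons.prems(2)[of 0] ns by simp
  have "Bs ! i \<in> carrier_mat (ns' ! i) (ns' ! i)" if "i < length ns'" for i
    using Cons.prems(2)[of "Suc i"] that ns by simp
  then have IH: "diag_block_mat Bs = block_mat ns' (\<lambda>i k. if i = k then Bs ! i else 0\<^sub>m (ns' ! i) (ns' ! k))"
    using Cons.IH[of ns'] Cons.prems(1) ns by simp
  let ?D = "diag_block_mat Bs"
  have DC: "?D \<in> carrier_mat (sum_list ns') (sum_list ns')" unfolding IH by (rule block_mat_carrier)
  show ?case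
  proof (rule eq_matI)
    fix r c
    assume "r < dim_row (block_mat ns (\<lambda>i k. if i = k then (B # Bs) ! i else 0\<^sub>m (ns ! i) (ns ! k)))"
      and "c < dim_col (block_mat ns (\<lambda>i k. if i = k then (B # Bs) ! i else 0\<^sub>m (ns ! i) (ns ! k)))"
    then have rc: "r < n + sum_list ns'" "c < n + sum_list ns'" by (auto simp: block_mat_def ns)
    have L: "diag_block_mat (B # Bs) $$ (r, c) = (if r < n then if c < n then B $$ (r, c) else 0
        else if c < n then 0 else ?D $$ (r - n, c - n))"
      using rc BC DC by (auto simp: Let_def)
    have bd: "fst (block_pos ns' x) < length ns' \<and> snd (block_pos ns' x) < ns' ! fst (block_pos ns' x)"
      if "x < sum_list ns'" for x using block_pos_bound[OF that] by blast
    have "block_mat ns (\<lambda>i k. if i = k then (B # Bs) ! i else 0\<^sub>m (ns ! i) (ns ! k)) $$ (r, c) =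
        (if r < n then if c < n then B $$ (r, c) else 0 else if c < n then 0 else ?D $$ (r - n, c - n))"
    proof -
      have rn: "r - n < sum_list ns'" if "\<not> r < n" using that rc by simp
      have cn: "c - n < sum_list ns'" if "\<not> c < n" using that rc by simp
      show ?thesis
        using rc bd[of "r - n"] bd[of "c - n"] rn cn
        by (subst block_mat_index) (auto simp: ns IH block_mat_index case_prod_beta Let_def)
    qed
    then show "diag_block_mat (B # Bs) $$ (r, c) =
        block_mat ns (\<lambda>i k. if i = k then (B # Bs) ! i else 0\<^sub>m (ns ! i) (ns ! k)) $$ (r, c)"
      using L by simp
  qed (use BC DC in \<open>auto simp: Let_def block_mat_def ns\<close>)
qed

lemma mem_polys_below_iff: "f \<in> polys_below n \<longleftrightarrow> (\<forall>k\<ge>n. coeff f k = 0)"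
proof
  assume "f \<in> polys_below n"
  then show "\<forall>k\<ge>n. coeff f k = 0" unfolding polys_below_def by (auto simp: coeff_sum)
next
  assume f: "\<forall>k\<ge>n. coeff f k = 0"
  have "f = (\<Sum>k<n. monom (coeff f k) k)"
    by (rule poly_eqI) (use f in \<open>auto simp: coeff_sum if_distrib cong: if_cong\<close>)
  then show "f \<in> polys_below n" unfolding polys_below_def by (intro CollectI exI[of _ "coeff f"]) simp
qed

section \<open>Matrices of linear operators\<close>

context fd_space
begin

lemma is_basis_listI:
  assumes ind: "\<And>c. (\<Sum>r<length bs. sc (c r) (bs ! r)) = 0 \<Longrightarrow> \<forall>r<length bs. c r = 0"
    and spn: "\<And>w. \<exists>c. w = (\<Sum>r<length bs. sc (c r) (bs ! r))"
  shows "is_basis_list sc bs"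
proof -
  have dist: "distinct bs" unfolding distinct_conv_nth
  proof (intro allI impI notI)
    fix i j assume ij: "i < length bs" "j < length bs" "i \<noteq> j" "bs ! i = bs ! j"
    let ?c = "\<lambda>r. if r = i then 1 else if r = j then -1 else 0"
    have "(\<Sum>r<length bs. sc (?c r) (bs ! r)) = (\<Sum>r\<in>{i, j}. sc (?c r) (bs ! r))"
      by (rule sum.mono_neutral_right) (use ij in auto)
    also have "\<dots> = 0" using ij by simp
    finally show False using ind[of ?c, rule_format, OF _ ij(1)] by simp
  qed
  have re: "(\<Sum>b\<in>set bs. F b) = (\<Sum>r<length bs. F (bs ! r))" for F :: "'u \<Rightarrow> 'u"
    using sum.reindex_bij_betw[OF bij_betw_nth[OF dist refl refl], of F] by simp
  have "independent (set bs)"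
  proof
    assume "dependent (set bs)"
    then obtain u b where u: "(\<Sum>v\<in>set bs. sc (u v) v) = 0" "b \<in> set bs" "u b \<noteq> 0"
      unfolding dependent_finite[OF finite_set] by blast
    then have "\<forall>r<length bs. u (bs ! r) = 0" using ind[of "\<lambda>r. u (bs ! r)"] re[of "\<lambda>v. sc (u v) v"] by simp
    then show False using u(2,3) by (metis in_set_conv_nth)
  qed
  moreover have "w \<in> span (set bs)" for w
  proof -
    obtain c where w: "w = (\<Sum>r<length bs. sc (c r) (bs ! r))" using spn by blast
    show ?thesis unfolding w by (intro span_sum span_scale span_base) simp
  qed
  ultimately show ?thesis unfolding is_basis_list_def using dist by auto
qed

end

locale basis_list = fd_space sc for sc :: "'f::field \<Rightarrow> 'u::ab_group_add \<Rightarrow> 'u" +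
  fixes bs :: "'u list"
  assumes basis: "is_basis_list sc bs"
begin

abbreviation "mx \<equiv> matrix_in_basis sc bs"
abbreviation "n \<equiv> length bs"

lemma bs: "distinct bs" "independent (set bs)" "span (set bs) = UNIV"
  using basis unfolding is_basis_list_def by auto

lemma sum_bs: "(\<Sum>b\<in>set bs. F b) = (\<Sum>r<n. F (bs ! r))"
  by (rule sum.reindex_bij_betw[OF bij_betw_nth[OF bs(1) refl refl], symmetric])

definition coord :: "'u \<Rightarrow> nat \<Rightarrow> 'f" where
  "coord w r = representation (set bs) w (bs ! r)"

lemma coord_expand: "w = (\<Sum>r<n. sc (coord w r) (bs ! r))"
proof -
  have "w = (\<Sum>b\<in>set bs. sc (representation (set bs) w b) b)"
    by (rule sum_representation_eq[symmetric]) (use bs in auto)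
  then show ?thesis unfolding sum_bs coord_def by simp
qed

lemma coord_add: "coord (u + w) r = coord u r + coord w r"
  and coord_scale: "coord (sc c w) r = c * coord w r"
  unfolding coord_def using bs by (simp_all add: representation_add representation_scale)

lemma coord_0: "coord 0 r = 0"
  using coord_scale[of 0 0 r] by simp

lemma coord_sum: "coord (\<Sum>a\<in>A. F a) r = (\<Sum>a\<in>A. coord (F a) r)"
  by (induction A rule: infinite_finite_induct) (auto simp: coord_add coord_0)

lemma coord_bs: "r < n \<Longrightarrow> i < n \<Longrightarrow> coord (bs ! r) i = (if i = r then 1 else 0)"
  unfolding coord_def using bs by (simp add: representation_basis nth_eq_iff_index_eq)

lemma coord_lincomb: "i < n \<Longrightarrow> coord (\<Sum>r<n. sc (c r) (bs ! r)) i = c i"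
  by (simp add: coord_sum coord_scale coord_bs if_distrib cong: if_cong)

lemma mx_index: "r < n \<Longrightarrow> c < n \<Longrightarrow> mx h $$ (r, c) = coord (h (bs ! c)) r"
  unfolding matrix_in_basis_def coord_def by simp

lemma mx_carrier: "mx h \<in> carrier_mat n n"
  unfolding matrix_in_basis_def by simp

lemma mx_dim [simp]: "dim_row (mx h) = n" "dim_col (mx h) = n"
  unfolding matrix_in_basis_def by simp_all

lemma mx_expand: "c < n \<Longrightarrow> h (bs ! c) = (\<Sum>r<n. sc (mx h $$ (r, c)) (bs ! r))"
  using coord_expand[of "h (bs ! c)"] by (simp add: mx_index)

lemma mx_eqI:
  assumes "M \<in> carrier_mat n n" "\<And>c. c < n \<Longrightarrow> h (bs ! c) = (\<Sum>r<n. sc (M $$ (r, c)) (bs ! r))"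
  shows "mx h = M"
  by (rule eq_matI) (use assms in \<open>auto simp: mx_index coord_lincomb\<close>)

lemma lin_eq_bs:
  assumes "lin h" "lin k" "\<And>c. c < n \<Longrightarrow> h (bs ! c) = k (bs ! c)"
  shows "h w = k w"
proof -
  have "h (\<Sum>r<n. sc (coord w r) (bs ! r)) = k (\<Sum>r<n. sc (coord w r) (bs ! r))"
    using assms by (simp add: lin_sum lin_scale)
  then show ?thesis using coord_expand[of w] by simp
qed

lemma mx_inject: "lin h \<Longrightarrow> lin k \<Longrightarrow> mx h = mx k \<Longrightarrow> h w = k w"
  by (rule lin_eq_bs) (auto simp: mx_expand)

lemma exists_op:
  assumes "M \<in> carrier_mat n n"
  shows "\<exists>h. lin h \<and> mx h = M"
proof -
  define h where "h w = (\<Sum>c<n. sc (coord w c) (\<Sum>r<n. sc (M $$ (r, c)) (bs ! r)))" for w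
  have "lin h" unfolding lin_def h_def
    by (simp add: coord_add coord_scale distrib_right scale_left_distrib sum.distrib scale_sum_right mult.assoc)
  moreover have "mx h = M"
  proof (rule mx_eqI[OF assms])
    fix c assume c: "c < n"
    have "h (bs ! c) = (\<Sum>c'<n. if c' = c then (\<Sum>r<n. sc (M $$ (r, c)) (bs ! r)) else 0)"
      unfolding h_def by (rule sum.cong) (use c in \<open>auto simp: coord_bs\<close>)
    then show "h (bs ! c) = (\<Sum>r<n. sc (M $$ (r, c)) (bs ! r))" using c by simp
  qed
  ultimately show ?thesis by blast
qed

lemma mx_add: "mx (\<lambda>w. h w + k w) = mx h + mx k"
  by (rule eq_matI) (auto simp: mx_index coord_add)

lemma mx_smult: "mx (\<lambda>w. sc c (h w)) = c \<cdot>\<^sub>m mx h"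
  by (rule eq_matI) (auto simp: mx_index coord_scale)

lemma mx_zero: "mx (\<lambda>w. 0) = 0\<^sub>m n n"
  by (rule eq_matI) (auto simp: mx_index coord_0)

lemma mx_id: "mx (\<lambda>w. w) = 1\<^sub>m n"
  by (rule eq_matI) (auto simp: mx_index coord_bs)

lemma mx_comp: assumes "lin h" shows "mx (\<lambda>w. h (k w)) = mx h * mx k"
proof (rule mx_eqI)
  show "mx h * mx k \<in> carrier_mat n n" using mx_carrier by auto
  fix c assume c: "c < n"
  have "h (k (bs ! c)) = h (\<Sum>r<n. sc (mx k $$ (r, c)) (bs ! r))" using mx_expand[OF c, of k] by simp
  also have "\<dots> = (\<Sum>r<n. sc (mx k $$ (r, c)) (h (bs ! r)))" using assms by (simp add: lin_sum lin_scale)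
  also have "\<dots> = (\<Sum>r<n. sc (mx k $$ (r, c)) (\<Sum>q<n. sc (mx h $$ (q, r)) (bs ! q)))"
    by (rule sum.cong) (auto simp: mx_expand[of _ h])
  also have "\<dots> = (\<Sum>r<n. \<Sum>q<n. sc (mx h $$ (q, r) * mx k $$ (r, c)) (bs ! q))"
    by (simp add: scale_sum_right mult.commute)
  also have "\<dots> = (\<Sum>q<n. \<Sum>r<n. sc (mx h $$ (q, r) * mx k $$ (r, c)) (bs ! q))" by (rule sum.swap)
  also have "\<dots> = (\<Sum>q<n. sc ((mx h * mx k) $$ (q, c)) (bs ! q))"
    using c by (intro sum.cong) (auto simp: scalar_prod_def scale_sum_left atLeast0LessThan)
  finally show "h (k (bs ! c)) = (\<Sum>r<n. sc ((mx h * mx k) $$ (r, c)) (bs ! r))" .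
qed

lemma mx_funpow: assumes "lin h" shows "mx (h ^^ k) = mx h ^\<^sub>m k"
proof (induction k)
  case 0
  then show ?case using mx_id by (simp add: id_def)
next
  case (Suc k)
  have "h ^^ Suc k = (\<lambda>w. (h ^^ k) (h w))" by (simp add: fun_eq_iff funpow_swap1)
  then show ?case using Suc mx_comp[OF lin_funpow[OF assms], of k h] by (simp del: funpow.simps)
qed

lemma mat_poly_mx: assumes "lin h" shows "mat_poly f (mx h) = mx (pa h f)"
proof (rule eq_matI)
  fix i k assume "i < dim_row (mx (pa h f))" "k < dim_col (mx (pa h f))"
  then have ik: "i < n" "k < n" by auto
  then show "mat_poly f (mx h) $$ (i, k) = mx (pa h f) $$ (i, k)"
    unfolding mat_poly_def poly_op_def
    by (simp add: mx_index coord_sum coord_scale mx_funpow[OF assms, symmetric])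
qed (simp_all add: mat_poly_def)

end

section \<open>The adapted basis and the operators behind A, T and E\<close>

section \<open>The matrix representation\<close>

lemma (in fd_space) pa_expand:
  assumes "\<forall>k\<ge>n. coeff f k = 0"
  shows "pa h f u = (\<Sum>k<n. sc (coeff f k) ((h ^^ k) u))"
proof -
  have "pa h f u = (\<Sum>k\<le>max n (degree f). sc (coeff f k) ((h ^^ k) u))" by (rule pa_eq_sum) simp
  also have "\<dots> = (\<Sum>k<n. sc (coeff f k) ((h ^^ k) u))"
    by (rule sum.mono_neutral_right) (use assms in auto)
  finally show ?thesis .
qed

text \<open>The normalization \<open>V_g\<close> fixes the generators relative to each other; it is
  what makes the matrix of \<open>V\<close> equal to T exactly.\<close>

locale gen_tower = separated_tower +
  fixes g :: "nat \<Rightarrow> 'b"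
  assumes gens: "i \<in> {1..m} \<Longrightarrow> generates i (g i)"
    and V_g: "i \<in> {1..<m} \<Longrightarrow> V (g (Suc i)) = pa Y (p i ^ (s i - s (Suc i))) (g i)"
begin

definition deg :: nat where "deg = degree (p 1)"

definition sizes :: "nat list" where "sizes = map (\<lambda>i. deg * s i) [1..<Suc m]"

text \<open>Blocks and positions are counted from 0, as by \<open>block_pos\<close>, while the
  generators are numbered from 1; hence the \<open>Suc\<close>.\<close>

definition bvec :: "nat \<times> nat \<Rightarrow> 'b" where "bvec ia = (Y ^^ snd ia) (g (Suc (fst ia)))"

definition blist :: "'b list" where "blist = map (\<lambda>r. bvec (block_pos sizes r)) [0..<sum_list sizes]"

lemma length_sizes [simp]: "length sizes = m"
  by (simp add: sizes_def)

lemma sizes_nth [simp]: "i < m \<Longrightarrow> sizes ! i = deg * s (Suc i)"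
  unfolding sizes_def by (subst nth_map) (auto simp del: upt_Suc)

lemma length_blist [simp]: "length blist = sum_list sizes"
  by (simp add: blist_def)

lemma blist_nth: "r < sum_list sizes \<Longrightarrow> blist ! r = bvec (block_pos sizes r)"
  by (simp add: blist_def)

lemma g_Uc: "i \<in> {1..m} \<Longrightarrow> g i \<in> Uc i"
  and g_ann: "i \<in> {1..m} \<Longrightarrow> pa Y f (g i) = 0 \<longleftrightarrow> p i ^ s i dvd f"
  and g_rep: "i \<in> {1..m} \<Longrightarrow> w \<in> Uc i \<Longrightarrow> \<exists>f. w = pa Y f (g i)"
  using gens unfolding generates_def by blast+

lemma degree_p_power: "i \<in> {1..m} \<Longrightarrow> degree (p i ^ k) = deg * k"
  using degree_monic_power[OF p_monic, of i k] degree_p[of i] by (simp add: deg_def)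

lemma lead_p_power: "i \<in> {1..m} \<Longrightarrow> lead_coeff (p i ^ k) = 1"
  using p_monic by (simp add: lead_coeff_power)

lemma p_nz: "i \<in> {1..m} \<Longrightarrow> p i \<noteq> 0"
  using p_irr by auto

lemma deg_pos: "deg > 0"
  unfolding deg_def by (rule irreducible_degree_pos[OF p_irr]) (use m_gt_1 in auto)

lemma g_ann_low:
  assumes "i \<in> {1..m}" "\<forall>k\<ge>deg * s i. coeff f k = 0" "pa Y f (g i) = 0"
  shows "f = 0"
proof (rule ccontr)
  assume f: "f \<noteq> 0"
  have "p i ^ s i dvd f" using g_ann assms by blast
  then have "deg * s i \<le> degree f" using f dvd_imp_degree_le degree_p_power[OF assms(1)] by metis
  then have "coeff f (degree f) = 0" using assms(2) by blast
  then show False using f by simp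
qed

lemma g_rep_low:
  assumes i: "i \<in> {1..m}" and w: "w \<in> Uc i"
  shows "\<exists>f. (\<forall>k\<ge>deg * s i. coeff f k = 0) \<and> w = pa Y f (g i)"
proof -
  obtain f where f: "w = pa Y f (g i)" using g_rep[OF assms] by blast
  let ?q = "p i ^ s i" and ?f = "f mod p i ^ s i"
  have q0: "?q \<noteq> 0" using p_nz[OF i] by simp
  have "pa Y (f div ?q * ?q + ?f) (g i) = pa Y ?f (g i)"
    using g_ann[OF i, of "f div ?q * ?q"] by (simp add: pa_add del: div_mult_mod_eq)
  then have "w = pa Y ?f (g i)" unfolding f div_mult_mod_eq .
  moreover have "coeff ?f k = 0" if "k \<ge> deg * s i" for k
    using degree_mod_less[OF q0, of f] that degree_p_power[OF i, of "s i"] by (auto intro: coeff_eq_0)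
  ultimately show ?thesis by blast
qed

lemma sum_blist:
  "(\<Sum>r<sum_list sizes. sc (c (block_pos sizes r)) (blist ! r)) =
    (\<Sum>i<m. \<Sum>a<deg * s (Suc i). sc (c (i, a)) (bvec (i, a)))"
proof -
  have "(\<Sum>r<sum_list sizes. sc (c (block_pos sizes r)) (blist ! r)) =
      (\<Sum>r<sum_list sizes. sc (c (block_pos sizes r)) (bvec (block_pos sizes r)))"
    by (rule sum.cong) (auto simp: blist_nth)
  then show ?thesis using sum_block_pos[where ns = sizes and F = "\<lambda>x. sc (c x) (bvec x)"] by simp
qed

text \<open>U is the direct sum of its components, and in F[X]/(p_i^s_i) the powers of X below the
  degree form a basis. A relation becomes one polynomial per component, of too small a degree to
  annihilate the generator unless it is zero.\<close>

lemma basis_blist: "is_basis_list sc blist"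
proof (rule is_basis_listI)
  let ?off = "\<lambda>ia. sum_list (take (fst ia) sizes) + snd ia"
  have off: "?off (block_pos sizes r) = r" if "r < sum_list sizes" for r
    using block_pos_bound[OF that] by simp
  have to_blocks: "(\<Sum>r<length blist. sc (c r) (blist ! r)) =
      (\<Sum>i<m. pa Y (\<Sum>a<deg * s (Suc i). monom (c (?off (i, a))) a) (g (Suc i)))" for c
  proof -
    have "(\<Sum>r<length blist. sc (c r) (blist ! r)) =
        (\<Sum>r<sum_list sizes. sc (c (?off (block_pos sizes r))) (blist ! r))"
      by (rule sum.cong) (use off in auto)
    also have "\<dots> = (\<Sum>i<m. \<Sum>a<deg * s (Suc i). sc (c (?off (i, a))) (bvec (i, a)))"
      by (rule sum_blist[of "\<lambda>x. c (?off x)"])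
    finally show ?thesis by (simp add: pa_sum pa_monom[OF Y_lin] bvec_def)
  qed
  fix c assume 0: "(\<Sum>r<length blist. sc (c r) (blist ! r)) = 0"
  define F where "F i = (\<Sum>a<deg * s (Suc i). monom (c (?off (i, a))) a)" for i
  have cF: "coeff (F i) a = (if a < deg * s (Suc i) then c (?off (i, a)) else 0)" for i a
    by (simp add: F_def coeff_sum if_distrib cong: if_cong)
  have "(\<Sum>i<m. pa Y (F i) (g (Suc i))) = 0" using 0 unfolding to_blocks F_def .
  then have "(\<Sum>j\<in>{1..m}. pa Y (F (j - 1)) (g j)) = 0"
    by (subst sum.reindex_bij_witness[of _ "Suc" "\<lambda>j. j - 1" "{..<m}"
      "\<lambda>i. pa Y (F i) (g (Suc i))"]) auto
  moreover have "\<forall>j\<in>{1..m}. pa Y (F (j - 1)) (g j) \<in> Uc j" using Uc_pa g_Uc by auto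
  ultimately have "\<forall>j\<in>{1..m}. pa Y (F (j - 1)) (g j) = 0"
    using Uc_sum_eq_0[of m "\<lambda>j. pa Y (F (j - 1)) (g j)"] by simp
  then have F0: "F i = 0" if "i < m" for i
    using g_ann_low[of "Suc i" "F i"] that cF by (auto dest: bspec[of _ _ "Suc i"])
  show "\<forall>r<length blist. c r = 0"
  proof (intro allI impI)
    fix r assume "r < length blist"
    then have r: "r < sum_list sizes" by simp
    obtain i a where ia: "block_pos sizes r = (i, a)" by (cases "block_pos sizes r")
    then have b: "i < m" "a < deg * s (Suc i)" "?off (i, a) = r" using block_pos_bound[OF r] by auto
    then show "c r = 0" using cF[of i a] F0[of i] by simp
  qed
next
  fix w
  obtain u where u: "\<forall>j\<in>{1..m}. u j \<in> Uc j" "w = (\<Sum>j\<in>{1..m}. u j)"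
    using Us_sum_Uc[of m w] Us_m by auto
  have "\<forall>j\<in>{1..m}. \<exists>f. (\<forall>k\<ge>deg * s j. coeff f k = 0) \<and> u j = pa Y f (g j)"
    using u(1) g_rep_low by blast
  then obtain F where F: "\<And>j. j \<in> {1..m} \<Longrightarrow> (\<forall>k\<ge>deg * s j. coeff (F j) k = 0) \<and> u j = pa Y (F j) (g j)"
    by metis
  have "w = (\<Sum>i<m. u (Suc i))" unfolding u(2)
    by (rule sum.reindex_bij_witness[of _ "Suc" "\<lambda>j. j - 1"]) auto
  also have "\<dots> = (\<Sum>i<m. \<Sum>a<deg * s (Suc i). sc (coeff (F (Suc i)) a) (bvec (i, a)))"
  proof (rule sum.cong)
    fix i assume "i \<in> {..<m}"
    then have "Suc i \<in> {1..m}" by auto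
    from F[OF this] show "u (Suc i) = (\<Sum>a<deg * s (Suc i). sc (coeff (F (Suc i)) a) (bvec (i, a)))"
      using pa_expand[of "deg * s (Suc i)" "F (Suc i)" Y "g (Suc i)"] by (simp add: bvec_def)
  qed simp
  finally have "w = (\<Sum>r<length blist. sc (coeff (F (Suc (fst (block_pos sizes r)))) (snd (block_pos sizes r))) (blist ! r))"
    using sum_blist[of "\<lambda>x. coeff (F (Suc (fst x))) (snd x)"] by simp
  then show "\<exists>c. w = (\<Sum>r<length blist. sc (c r) (blist ! r))"
    by (intro exI[of _ "\<lambda>r. coeff (F (Suc (fst (block_pos sizes r)))) (snd (block_pos sizes r))"])
qed

sublocale B: basis_list sc blist
  by unfold_locales (rule basis_blist)

lemma mx_block:
  assumes "\<And>k b. k < m \<Longrightarrow> b < deg * s (Suc k) \<Longrightarrow>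
    h (bvec (k, b)) = (\<Sum>i<m. \<Sum>a<deg * s (Suc i). sc (M i k $$ (a, b)) (bvec (i, a)))"
  shows "B.mx h = block_mat sizes M"
proof (rule B.mx_eqI)
  show "block_mat sizes M \<in> carrier_mat (length blist) (length blist)" using block_mat_carrier by simp
  fix c assume "c < length blist"
  then have c: "c < sum_list sizes" by simp
  obtain k b where kb: "block_pos sizes c = (k, b)" by (cases "block_pos sizes c")
  then have b: "k < m" "b < deg * s (Suc k)" using block_pos_bound[OF c] by auto
  have "(\<Sum>r<length blist. sc (block_mat sizes M $$ (r, c)) (blist ! r)) =
      (\<Sum>r<sum_list sizes. sc (M (fst (block_pos sizes r)) k $$ (snd (block_pos sizes r), b)) (blist ! r))"
    by (rule sum.cong) (use c kb in \<open>auto simp: block_mat_index\<close>)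
  also have "\<dots> = (\<Sum>i<m. \<Sum>a<deg * s (Suc i). sc (M i k $$ (a, b)) (bvec (i, a)))"
    using sum_blist[of "\<lambda>x. M (fst x) k $$ (snd x, b)"] by simp
  finally show "h (blist ! c) = (\<Sum>r<length blist. sc (block_mat sizes M $$ (r, c)) (blist ! r))"
    using assms[OF b] kb blist_nth[OF c] by simp
qed

lemma mx_block_expand:
  assumes mx: "B.mx h = block_mat sizes M" and b: "k < m" "b < deg * s (Suc k)"
  shows "h (bvec (k, b)) = (\<Sum>i<m. \<Sum>a<deg * s (Suc i). sc (M i k $$ (a, b)) (bvec (i, a)))"
proof -
  define c where "c = sum_list (take k sizes) + b"
  have c: "c < sum_list sizes" "block_pos sizes c = (k, b)"
    unfolding c_def using offset_less[of k sizes b] block_pos_offset[of k sizes b] b by auto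
  have "h (bvec (k, b)) = h (blist ! c)" using blist_nth[OF c(1)] c(2) by simp
  also have "\<dots> = (\<Sum>r<length blist. sc (block_mat sizes M $$ (r, c)) (blist ! r))"
    using B.mx_expand[of c h] c(1) mx by simp
  also have "\<dots> = (\<Sum>r<sum_list sizes. sc (M (fst (block_pos sizes r)) k $$ (snd (block_pos sizes r), b)) (blist ! r))"
    by (rule sum.cong) (use c in \<open>auto simp: block_mat_index\<close>)
  also have "\<dots> = (\<Sum>i<m. \<Sum>a<deg * s (Suc i). sc (M i k $$ (a, b)) (bvec (i, a)))"
    using sum_blist[of "\<lambda>x. M (fst x) k $$ (snd x, b)"] by simp
  finally show ?thesis .
qed

lemma companion_bvec:
  assumes k: "k < m" and b: "b < deg * s (Suc k)"
  shows "(\<Sum>a<deg * s (Suc k). sc (companion_mat (p (Suc k) ^ s (Suc k)) $$ (a, b)) (bvec (k, a))) = Y (bvec (k, b))"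
proof -
  let ?f = "p (Suc k) ^ s (Suc k)" and ?N = "deg * s (Suc k)"
  have kS: "Suc k \<in> {1..m}" using k by auto
  have dN: "degree ?f = ?N" by (rule degree_p_power[OF kS])
  have lN: "coeff ?f ?N = 1" using lead_p_power[OF kS, of "s (Suc k)"] dN by simp
  have idx: "companion_mat ?f $$ (a, b) = (if Suc b = ?N then - coeff ?f a else if a = Suc b then 1 else 0)"
    if "a < ?N" for a using that b by (simp add: companion_mat_def dN)
  have Yb: "Y (bvec (k, b)) = (Y ^^ Suc b) (g (Suc k))" by (simp add: bvec_def)
  show ?thesis
  proof (cases "Suc b = ?N")
    case True
    \<comment> \<open>The last column of the companion matrix: the monic relation satisfied by the
      generator expresses its highest power through the lower ones.\<close>
    have "0 = pa Y ?f (g (Suc k))" using g_ann[OF kS] by simp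
    also have "\<dots> = (\<Sum>a\<le>?N. sc (coeff ?f a) ((Y ^^ a) (g (Suc k))))" by (rule pa_eq_sum) (simp add: dN)
    also have "\<dots> = (\<Sum>a<?N. sc (coeff ?f a) ((Y ^^ a) (g (Suc k)))) + (Y ^^ ?N) (g (Suc k))"
      by (simp add: lessThan_Suc_atMost[symmetric] lN)
    finally have "(Y ^^ ?N) (g (Suc k)) = - (\<Sum>a<?N. sc (coeff ?f a) ((Y ^^ a) (g (Suc k))))"
      by (metis add.inverse_unique add.commute)
    moreover have "(\<Sum>a<?N. sc (companion_mat ?f $$ (a, b)) (bvec (k, a))) =
        - (\<Sum>a<?N. sc (coeff ?f a) ((Y ^^ a) (g (Suc k))))"
      unfolding sum_negf[symmetric] by (rule sum.cong) (use idx True in \<open>auto simp: bvec_def\<close>)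
    ultimately show ?thesis using Yb True by simp
  next
    case False
    have "(\<Sum>a<?N. sc (companion_mat ?f $$ (a, b)) (bvec (k, a))) = (\<Sum>a<?N. if a = Suc b then bvec (k, a) else 0)"
      by (rule sum.cong) (use idx False in auto)
    also have "\<dots> = bvec (k, Suc b)" using False b by simp
    finally show ?thesis using Yb by (simp add: bvec_def)
  qed
qed

lemma sum_diag_block:
  assumes "k < m" and that: "b < deg * s (Suc k)"
  shows "(\<Sum>i<m. \<Sum>a<deg * s (Suc i). sc ((if i = k then D i else 0\<^sub>m (sizes ! i) (sizes ! k)) $$ (a, b)) (bvec (i, a))) =
    (\<Sum>a<deg * s (Suc k). sc (D k $$ (a, b)) (bvec (k, a)))"
proof -
  have "(\<Sum>i<m. \<Sum>a<deg * s (Suc i). sc ((if i = k then D i else 0\<^sub>m (sizes ! i) (sizes ! k)) $$ (a, b)) (bvec (i, a))) =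
    (\<Sum>i<m. if i = k then (\<Sum>a<deg * s (Suc k). sc (D k $$ (a, b)) (bvec (k, a))) else 0)"
  proof (rule sum.cong)
    fix i assume "i \<in> {..<m}"
    then have i: "i < m" by simp
    show "(\<Sum>a<deg * s (Suc i). sc ((if i = k then D i else 0\<^sub>m (sizes ! i) (sizes ! k)) $$ (a, b)) (bvec (i, a))) =
      (if i = k then (\<Sum>a<deg * s (Suc k). sc (D k $$ (a, b)) (bvec (k, a))) else 0)"
    proof (cases "i = k")
      case False
      then show ?thesis using i assms(1) that by simp
    qed simp
  qed simp
  then show ?thesis using assms by simp
qed

lemma companion_carrier: "k < m \<Longrightarrow> companion_mat (p (Suc k) ^ s (Suc k)) \<in> carrier_mat (deg * s (Suc k)) (deg * s (Suc k))"
  using degree_p_power[of "Suc k" "s (Suc k)"] by (simp add: companion_mat_def)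

lemma nth_upt_1: "i < m \<Longrightarrow> map f [1..<Suc m] ! i = f (Suc i)"
  by (subst nth_map) (auto simp del: upt_Suc)

lemma matrix_A_block: "matrix_A m p s = block_mat sizes
    (\<lambda>i k. if i = k then companion_mat (p (Suc i) ^ s (Suc i)) else 0\<^sub>m (sizes ! i) (sizes ! k))"
proof -
  have "matrix_A m p s = block_mat sizes (\<lambda>i k. if i = k then map (\<lambda>i. companion_mat (p i ^ s i)) [1..<Suc m] ! i
      else 0\<^sub>m (sizes ! i) (sizes ! k))"
    unfolding matrix_A_def
  proof (rule diag_block_mat_eq_block_mat)
    fix i assume "i < length sizes"
    then have i: "i < m" by simp
    show "map (\<lambda>i. companion_mat (p i ^ s i)) [1..<Suc m] ! i \<in> carrier_mat (sizes ! i) (sizes ! i)"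
      unfolding nth_upt_1[OF i] sizes_nth[OF i] by (rule companion_carrier[OF i])
  qed simp
  also have "\<dots> = block_mat sizes
    (\<lambda>i k. if i = k then companion_mat (p (Suc i) ^ s (Suc i)) else 0\<^sub>m (sizes ! i) (sizes ! k))"
    by (rule block_mat_cong) (simp only: length_sizes nth_upt_1)
  finally show ?thesis .
qed

lemma matrix_E_block: "matrix_E m p s = block_mat sizes
    (\<lambda>i k. if i = k then companion_mat (p (Suc i) ^ s (Suc i)) + of_nat i \<cdot>\<^sub>m 1\<^sub>m (deg * s (Suc i))
      else 0\<^sub>m (sizes ! i) (sizes ! k))"
proof -
  have dp: "degree (p (Suc i) ^ s (Suc i)) = deg * s (Suc i)" if "i < m" for i
    using that by (intro degree_p_power) auto
  have "matrix_E m p s = block_mat sizes (\<lambda>i k. if i = k then map (\<lambda>i. companion_mat (p i ^ s i) +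
     of_nat (i - 1) \<cdot>\<^sub>m 1\<^sub>m (degree (p i ^ s i))) [1..<Suc m] ! i
      else 0\<^sub>m (sizes ! i) (sizes ! k))"
    unfolding matrix_E_def
  proof (rule diag_block_mat_eq_block_mat)
    fix i assume "i < length sizes"
    then have i: "i < m" by simp
    show "map (\<lambda>i. companion_mat (p i ^ s i) + of_nat (i - 1) \<cdot>\<^sub>m 1\<^sub>m (degree (p i ^ s i))) [1..<Suc m] ! i
        \<in> carrier_mat (sizes ! i) (sizes ! i)"
      unfolding nth_upt_1[OF i] sizes_nth[OF i] dp[OF i] using companion_carrier[OF i] by simp
  qed simp
  also have "\<dots> = block_mat sizes
    (\<lambda>i k. if i = k then companion_mat (p (Suc i) ^ s (Suc i)) + of_nat i \<cdot>\<^sub>m 1\<^sub>m (deg * s (Suc i))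
      else 0\<^sub>m (sizes ! i) (sizes ! k))"
    by (rule block_mat_cong) (simp only: length_sizes nth_upt_1 dp diff_Suc_1)
  finally show ?thesis .
qed

lemma mx_Y: "B.mx Y = matrix_A m p s"
  unfolding matrix_A_block by (rule mx_block) (simp only: sum_diag_block companion_bvec)

text \<open>X^b is (X - 1)^b followed by the shift X -> X + 1, so y^b passes through
  \<open>V\<close> as (y - 1)^b. This is the origin of the powers of X - 1 in the blocks of
  T.\<close>

lemma V_bvec:
  assumes "Suc k < m"
  shows "V (bvec (Suc k, b)) = pa Y ([:-1, 1:] ^ b * p (Suc k) ^ (s (Suc k) - s (Suc (Suc k)))) (g (Suc k))"
proof -
  have "V (bvec (Suc k, b)) = V (pa Y ([:0, 1:] ^ b) (g (Suc (Suc k))))" by (simp add: bvec_def pa_X_power Y_lin)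
  also have "([:0, 1:] :: 'a poly) ^ b = ([:-1, 1:] ^ b) \<circ>\<^sub>p [:1, 1:]" by (simp add: pcompose_power pcompose_pCons)
  also have "V (pa Y \<dots> (g (Suc (Suc k)))) = pa Y ([:-1, 1:] ^ b) (V (g (Suc (Suc k))))" by (rule V_pa[symmetric])
  finally show ?thesis using V_g[of "Suc k"] assms by (simp add: pa_mult[OF Y_lin])
qed

lemma mx_V: "B.mx V = matrix_T deg m p s"
proof -
  have "B.mx V = block_mat sizes (\<lambda>i k. if k = Suc i then block_B deg p s (Suc k) else 0\<^sub>m (sizes ! i) (sizes ! k))"
  proof (rule mx_block)
    fix k b assume k: "k < m" and b: "b < deg * s (Suc k)"
    let ?M = "\<lambda>i k. if k = Suc i then block_B deg p s (Suc k) else 0\<^sub>m (sizes ! i) (sizes ! k)"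
    show "V (bvec (k, b)) = (\<Sum>i<m. \<Sum>a<deg * s (Suc i). sc (?M i k $$ (a, b)) (bvec (i, a)))"
    proof (cases k)
      case 0
      have "bvec (0, b) \<in> Uc (Suc 0)" using Uc_pa[of 1 "g 1" "[:0,1:] ^ b"] g_Uc[of 1] m_gt_1
        by (simp add: bvec_def pa_X_power Y_lin)
      then have "V (bvec (0, b)) = 0" using V_Uc(1)[of 0] m_gt_1 by simp
      moreover have "(\<Sum>i<m. \<Sum>a<deg * s (Suc i). sc (?M i k $$ (a, b)) (bvec (i, a))) = 0"
        by (intro sum.neutral) (use 0 b m_gt_1 in auto)
      ultimately show ?thesis using 0 by simp
    next
      case (Suc l)
      then have l: "Suc l < m" using k by simp
      then have lS: "Suc l \<in> {1..m}" "Suc l \<in> {1..<m}" by auto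
      let ?f = "[:-1, 1:] ^ b * p (Suc l) ^ (s (Suc l) - s (Suc (Suc l)))"
      have le: "s (Suc (Suc l)) \<le> s (Suc l)" using p_s_Suc(2)[OF lS(2)] .
      \<comment> \<open>A column index \<open>b\<close> below the size of block i + 1 keeps this
        degree below the size of block i, so the coefficients fill a column of the block without any
        reduction.\<close>
      have "degree ?f \<le> degree ([:-1, 1 :: 'a:] ^ b) + degree (p (Suc l) ^ (s (Suc l) - s (Suc (Suc l))))"
        by (rule degree_mult_le)
      also have "\<dots> = b + deg * (s (Suc l) - s (Suc (Suc l)))"
        using degree_p_power[OF lS(1)] by (simp add: degree_power_eq)
      also have "\<dots> < deg * s (Suc (Suc l)) + deg * (s (Suc l) - s (Suc (Suc l)))" using b Suc by simp
      also have "\<dots> = deg * s (Suc l)" using le by (simp add: add_mult_distrib2[symmetric])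
      finally have lt: "degree ?f < deg * s (Suc l)" .
      have "V (bvec (k, b)) = pa Y ?f (g (Suc l))" using V_bvec[OF l] Suc by simp
      also have "\<dots> = (\<Sum>a<deg * s (Suc l). sc (coeff ?f a) (bvec (l, a)))"
        using lt by (subst pa_expand[of "deg * s (Suc l)"]) (auto simp: bvec_def intro: coeff_eq_0)
      also have "\<dots> = (\<Sum>a<deg * s (Suc l). sc (?M l k $$ (a, b)) (bvec (l, a)))"
        by (rule sum.cong) (use b Suc in \<open>auto simp: block_B_def\<close>)
      also have "\<dots> = (\<Sum>i<m. if i = l then (\<Sum>a<deg * s (Suc l). sc (?M l k $$ (a, b)) (bvec (l, a))) else 0)"
        using l by simp
      also have "\<dots> = (\<Sum>i<m. \<Sum>a<deg * s (Suc i). sc (?M i k $$ (a, b)) (bvec (i, a)))"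
        by (rule sum.cong) (use Suc b k in \<open>auto intro!: sum.neutral[symmetric]\<close>)
      finally show ?thesis .
    qed
  qed
  then show ?thesis unfolding matrix_T_def Let_def sizes_def .
qed


subsection \<open>The operator of \<open>E\<close>\<close>

text \<open>E as an operator, determined by its matrix on the adapted basis. It acts on U_i as y +
  (i - 1), see \<open>Eop_Uc\<close>.\<close>

definition Eop :: "'b \<Rightarrow> 'b" where
  "Eop = (SOME h. lin h \<and> B.mx h = matrix_E m p s)"

lemma Eop_lin: "lin Eop" and mx_Eop: "B.mx Eop = matrix_E m p s"
proof -
  have "matrix_E m p s \<in> carrier_mat (length blist) (length blist)"
    unfolding matrix_E_block using block_mat_carrier by simp
  from someI_ex[OF B.exists_op[OF this]] show "lin Eop" "B.mx Eop = matrix_E m p s"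
    unfolding Eop_def by auto
qed

lemma Eop_bvec:
  assumes k: "k < m" and b: "b < deg * s (Suc k)"
  shows "Eop (bvec (k, b)) = Y (bvec (k, b)) + sc (of_nat k) (bvec (k, b))"
proof -
  let ?C = "companion_mat (p (Suc k) ^ s (Suc k))" and ?N = "deg * s (Suc k)"
  have "Eop (bvec (k, b)) = (\<Sum>i<m. \<Sum>a<deg * s (Suc i). sc
      ((if i = k then companion_mat (p (Suc i) ^ s (Suc i)) + of_nat i \<cdot>\<^sub>m 1\<^sub>m (deg * s (Suc i))
      else 0\<^sub>m (sizes ! i) (sizes ! k)) $$ (a, b)) (bvec (i, a)))"
    by (rule mx_block_expand[OF _ k b]) (simp only: mx_Eop matrix_E_block)
  also have "\<dots> = (\<Sum>a<?N. sc ((?C + of_nat k \<cdot>\<^sub>m 1\<^sub>m ?N) $$ (a, b)) (bvec (k, a)))"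
    by (rule sum_diag_block[OF k b])
  also have "\<dots> = (\<Sum>a<?N. sc (?C $$ (a, b)) (bvec (k, a)) + (if a = b then sc (of_nat k) (bvec (k, a)) else 0))"
    by (rule sum.cong) (use b companion_carrier[OF k] in \<open>auto simp: scale_left_distrib\<close>)
  also have "\<dots> = (\<Sum>a<?N. sc (?C $$ (a, b)) (bvec (k, a))) + sc (of_nat k) (bvec (k, b))"
    using b by (simp add: sum.distrib)
  finally show ?thesis using companion_bvec[OF k b] by simp
qed

lemma Eop_Uc:
  assumes i: "i \<in> {1..m}" and w: "w \<in> Uc i"
  shows "Eop w = Y w + sc (of_nat (i - 1)) w"
proof -
  obtain k where k: "i = Suc k" "k < m" using i by (cases i) auto
  obtain f where f: "\<forall>l\<ge>deg * s i. coeff f l = 0" "w = pa Y f (g i)" using g_rep_low[OF i w] by blast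
  have w': "w = (\<Sum>a<deg * s i. sc (coeff f a) (bvec (k, a)))"
    using pa_expand[OF f(1), of Y "g i"] f(2) k by (simp add: bvec_def)
  have "Eop w = (\<Sum>a<deg * s i. sc (coeff f a) (Eop (bvec (k, a))))"
    unfolding w' by (simp add: lin_sum lin_scale Eop_lin)
  also have "\<dots> = (\<Sum>a<deg * s i. sc (coeff f a) (Y (bvec (k, a)) + sc (of_nat k) (bvec (k, a))))"
    by (rule sum.cong) (use Eop_bvec k in auto)
  also have "\<dots> = Y w + sc (of_nat k) w"
    unfolding w' by (simp add: lin_sum lin_scale Y_lin scale_right_distrib sum.distrib scale_sum_right mult.commute)
  finally show ?thesis using k by simp
qed

lemma pa_Eop:
  assumes i: "i \<in> {1..m}" and w: "w \<in> Uc i"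
  shows "pa Eop f w = pa Y (f \<circ>\<^sub>p [:of_nat (i - 1), 1:]) w"
proof (induction f)
  case (pCons a f)
  have "pa Y (f \<circ>\<^sub>p [:of_nat (i - 1), 1:]) w \<in> Uc i" using Uc_pa w i by simp
  then show ?case
    using Eop_Uc[OF i] pCons.IH
    by (simp add: pa_pCons Eop_lin Y_lin pcompose_pCons pa_add pa_smult ac_simps)
qed simp

lemma pa_Eop_Uc: "i \<in> {1..m} \<Longrightarrow> w \<in> Uc i \<Longrightarrow> pa Eop f w \<in> Uc i"
  using pa_Eop Uc_pa by simp

text \<open>\<open>V\<close> lowers the index of a component by one, which reduces the offset of E
  by one, while y V = V y + V adds one; the two effects cancel. On U_1 both sides vanish.\<close>

lemma Eop_V: "Eop (V w) = V (Eop w)"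
proof (rule lin_eqI[of "\<lambda>w. Eop (V w)" "\<lambda>w. V (Eop w)"])
  show "lin (\<lambda>w. Eop (V w))" "lin (\<lambda>w. V (Eop w))" using Eop_lin V_lin lin_comp by auto
  fix i w assume i: "i \<in> {1..m}" and w: "w \<in> Uc i"
  obtain k where k: "i = Suc k" "k < m" using i by (cases i) auto
  have Ew: "V (Eop w) = V (Y w) + sc (of_nat k) (V w)"
    using Eop_Uc[OF i w] k by (simp add: lin_add lin_scale V_lin)
  show "Eop (V w) = V (Eop w)"
  proof (cases "k = 0")
    case True
    have "V w = 0" "V (Y w) = 0" using V_Uc(1)[of 0] w stable_mem[OF Uc_stable[of 1] ] k True by auto
    then show ?thesis using Ew True Eop_lin by simp
  next
    case False
    then have "V w \<in> Uc k" "k \<in> {1..m}" using V_Uc(2)[of k w] w k by auto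
    then have "Eop (V w) = V (Y w) + (V w + sc (of_nat (k - 1)) (V w))"
      using Eop_Uc[of k "V w"] twist by (simp add: add.assoc)
    also have "V w + sc (of_nat (k - 1)) (V w) = sc (of_nat (Suc (k - 1))) (V w)"
      by (simp add: scale_left_distrib)
    finally show ?thesis using Ew False by simp
  qed
qed

subsection \<open>Powers of the weight one operator\<close>

lemma V_funpow_lin: "lin (V ^^ j)"
  using V_lin by (rule lin_funpow)

lemma V_funpow_Uc:
  assumes "i \<in> {1..m}" "w \<in> Uc i"
  shows "(i \<le> j \<longrightarrow> (V ^^ j) w = 0) \<and> (j < i \<longrightarrow> (V ^^ j) w \<in> Uc (i - j) \<and> ((V ^^ j) w = 0 \<longrightarrow> w = 0))"
proof (induction j)
  case 0
  then show ?case using assms by simp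
next
  case (Suc j)
  show ?case
  proof (cases "j < i")
    case True
    define k where "k = i - j - 1"
    have k: "i - j = Suc k" "k < m" "i - Suc j = k" "i \<le> Suc j \<longleftrightarrow> k = 0"
      using True assms(1) by (auto simp: k_def)
    have mem: "(V ^^ j) w \<in> Uc (Suc k)" and inj: "(V ^^ j) w = 0 \<longrightarrow> w = 0" using Suc True k by auto
    show ?thesis
      using V_Uc[OF k(2) mem] inj k True by (cases "k = 0") auto
  next
    case False
    then show ?thesis using Suc V_lin by simp
  qed
qed

lemma V_funpow_twist: "Y ((V ^^ j) w) = (V ^^ j) (Y w) + sc (of_nat j) ((V ^^ j) w)"
  by (induction j) (simp_all add: twist lin_add lin_scale V_lin scale_left_distrib ac_simps)

lemma pa_V_funpow: "pa Y f ((V ^^ j) w) = (V ^^ j) (pa Y (f \<circ>\<^sub>p [:of_nat j, 1:]) w)"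
  by (rule pa_twist[OF Y_lin V_funpow_lin V_funpow_twist])

lemma pa_Eop_V_funpow: "pa Eop f ((V ^^ j) w) = (V ^^ j) (pa Eop f w)"
proof (rule pa_commute[OF Eop_lin V_funpow_lin])
  show "Eop ((V ^^ j) u) = (V ^^ j) (Eop u)" for u by (induction j) (simp_all add: Eop_V)
qed

lemma p_add:
  assumes "i \<ge> 1" "i + j \<le> m"
  shows "p (i + j) = p i \<circ>\<^sub>p [:of_nat j, 1:]"
proof -
  have "p (i + j) = p 1 \<circ>\<^sub>p [:of_nat (i - 1) + of_nat j, 1:]"
    using p_shift[of "i + j"] assms by (simp add: of_nat_diff algebra_simps)
  also have "\<dots> = (p 1 \<circ>\<^sub>p [:of_nat (i - 1), 1:]) \<circ>\<^sub>p [:of_nat j, 1:]"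
    by (simp add: pcompose_shift_shift)
  also have "p 1 \<circ>\<^sub>p [:of_nat (i - 1), 1:] = p i" by (rule p_shift[symmetric]) (use assms in auto)
  finally show ?thesis .
qed

text \<open>The exponents telescope: a power of p_(i+j) is p_i shifted by j, so pulled out of
  \<open>V ^^ j\<close> it becomes the same power of p_i.\<close>

lemma V_funpow_g:
  assumes "i \<ge> 1"
  shows "i + j \<le> m \<Longrightarrow> (V ^^ j) (g (i + j)) = pa Y (p i ^ (s i - s (i + j))) (g i)"
proof (induction j)
  case 0
  then show ?case using Y_lin by simp
next
  case (Suc j)
  let ?e = "s (i + j) - s (Suc (i + j))"
  have ij: "i + j \<in> {1..<m}" using Suc.prems assms by auto
  have le: "s (Suc (i + j)) \<le> s (i + j)" "s (i + j) \<le> s i"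
    using p_s_Suc(2)[OF ij] s_antimono[of i "i + j"] ij assms by auto
  have "(V ^^ Suc j) (g (i + Suc j)) = (V ^^ j) (V (g (Suc (i + j))))" by (simp add: funpow_swap1)
  also have "\<dots> = (V ^^ j) (pa Y ((p i ^ ?e) \<circ>\<^sub>p [:of_nat j, 1:]) (g (i + j)))"
    using V_g[OF ij] p_add[OF assms, of j] ij by (simp add: pcompose_power)
  also have "\<dots> = pa Y (p i ^ ?e) ((V ^^ j) (g (i + j)))" by (rule pa_V_funpow[symmetric])
  also have "\<dots> = pa Y (p i ^ ?e * p i ^ (s i - s (i + j))) (g i)"
    using Suc by (simp add: pa_mult[OF Y_lin])
  also have "p i ^ ?e * p i ^ (s i - s (i + j)) = p i ^ (s i - s (i + Suc j))"
    using le by (simp add: power_add[symmetric])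
  finally show ?case .
qed

subsection \<open>Weight operators as polynomials in \<open>E\<close> times powers of \<open>T\<close>\<close>

text \<open>\<open>u\<close> sends the generator of U_(j+1) to h(y) g_1. The image is annihilated by
  p_1^s_(j+1), so h is divisible by p_1^(s_1 - s_(j+1)), the polynomial that gives V^j g_(j+1).
  Hence the image is k(y) V^j g_(j+1), that is, V^j k(E) g_(j+1), and k may be reduced modulo
  p_1^s_(j+1). Uniqueness holds because V^j is injective on U_(j+1) and the degrees are too small to
  annihilate the generator.\<close>

lemma wpoly_ex1:
  assumes u: "weight_op (of_nat j) u" and j: "j < m"
  shows "\<exists>!f. f \<in> polys_below (deg * s (Suc j)) \<and> u (g (Suc j)) = (V ^^ j) (pa Eop f (g (Suc j)))"
proof (rule ex_ex1I)
  have jS: "Suc j \<in> {1..m}" and one: "1 \<in> {1..m}" using j by auto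
  let ?g = "g (Suc j)"
  have gU: "?g \<in> Uc (Suc j)" by (rule g_Uc[OF jS])
  have lu: "lin u" and tw: "\<And>w. Y (u w) = u (Y w) + sc (of_nat j) (u w)" using u unfolding weight_op_def by auto
  have pj: "p (Suc j) = p 1 \<circ>\<^sub>p [:of_nat j, 1:]" using p_shift[OF jS] by simp
  have le: "s (Suc j) \<le> s 1" using s_antimono[of 1 "Suc j"] j by simp
  have p0: "p 1 \<noteq> 0" using p_nz[OF one] .
  \<comment> \<open>On U_(j+1) the operator p_1(E) is p_1(y + j), which is p_(j+1)(y); so E sees p_1
    on every component.\<close>
  have E0: "pa Eop (p 1 ^ s (Suc j)) ?g = 0"
    using pa_Eop[OF jS gU, of "p 1 ^ s (Suc j)"] g_ann[OF jS, of "p (Suc j) ^ s (Suc j)"] pj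
    by (simp add: pcompose_power)
  have "u ?g \<in> Uc 1" using weight_op_of_nat(2)[OF u j jS gU] by simp
  then obtain h where h: "u ?g = pa Y h (g 1)" using g_rep[OF one] by blast
  have "pa Y (p 1 ^ s (Suc j)) (u ?g) = u (pa Y (p (Suc j) ^ s (Suc j)) ?g)"
    using pa_twist[OF Y_lin lu tw] pj by (simp add: pcompose_power)
  also have "\<dots> = 0" using g_ann[OF jS, of "p (Suc j) ^ s (Suc j)"] lu by simp
  finally have "pa Y (p 1 ^ s (Suc j) * h) (g 1) = 0" unfolding h by (simp add: pa_mult[OF Y_lin])
  then have "p 1 ^ (s (Suc j) + (s 1 - s (Suc j))) dvd p 1 ^ s (Suc j) * h"
    using g_ann[OF one] le by simp
  then have "p 1 ^ (s 1 - s (Suc j)) dvd h" using p0 by (simp add: power_add)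
  then obtain k where k: "h = k * p 1 ^ (s 1 - s (Suc j))" by (metis dvdE mult.commute)
  define f where "f = k mod (p 1 ^ s (Suc j))"
  have q0: "p 1 ^ s (Suc j) \<noteq> 0" using p0 by simp
  have "k = k div (p 1 ^ s (Suc j)) * p 1 ^ s (Suc j) + f"
    unfolding f_def by (rule div_mult_mod_eq[symmetric])
  then have "pa Eop k ?g = pa Eop (k div (p 1 ^ s (Suc j)) * p 1 ^ s (Suc j) + f) ?g" by simp
  also have "\<dots> = pa Eop (k div (p 1 ^ s (Suc j))) (pa Eop (p 1 ^ s (Suc j)) ?g) + pa Eop f ?g"
    by (simp only: pa_add pa_mult[OF Eop_lin])
  finally have kf: "pa Eop k ?g = pa Eop f ?g" using E0 lin_pa[OF Eop_lin] by simp
  have "u ?g = pa Y k ((V ^^ j) ?g)"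
    using V_funpow_g[of 1 j] j unfolding h k by (simp add: pa_mult[OF Y_lin])
  also have "\<dots> = (V ^^ j) (pa Eop k ?g)" using pa_Eop[OF jS gU] by (simp add: pa_V_funpow)
  finally have "u ?g = (V ^^ j) (pa Eop f ?g)" using kf by simp
  moreover have "f \<in> polys_below (deg * s (Suc j))"
    unfolding mem_polys_below_iff f_def
    using degree_mod_less[OF q0, of k] degree_p_power[OF one, of "s (Suc j)"] by (auto intro: coeff_eq_0)
  ultimately show "\<exists>f. f \<in> polys_below (deg * s (Suc j)) \<and> u ?g = (V ^^ j) (pa Eop f ?g)" by blast
next
  fix f f' assume f: "f \<in> polys_below (deg * s (Suc j)) \<and> u (g (Suc j)) = (V ^^ j) (pa Eop f (g (Suc j)))"
    and f': "f' \<in> polys_below (deg * s (Suc j)) \<and> u (g (Suc j)) = (V ^^ j) (pa Eop f' (g (Suc j)))"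
  have jS: "Suc j \<in> {1..m}" using j by auto
  have gU: "g (Suc j) \<in> Uc (Suc j)" by (rule g_Uc[OF jS])
  show "f = f'"
  proof (rule ccontr)
    assume ne: "f \<noteq> f'"
    let ?d = "f - f'"
    have "(V ^^ j) (pa Eop ?d (g (Suc j))) = 0"
      using f f' by (simp add: pa_diff lin_diff[OF V_funpow_lin])
    then have "pa Eop ?d (g (Suc j)) = 0"
      using V_funpow_Uc[OF jS pa_Eop_Uc[OF jS gU], of j] by simp
    then have 0: "pa Y (?d \<circ>\<^sub>p [:of_nat j, 1:]) (g (Suc j)) = 0" using pa_Eop[OF jS gU] by simp
    have dd: "degree ?d < deg * s (Suc j)"
      using f f' ne unfolding mem_polys_below_iff by (intro degree_lessI) auto
    have "?d \<circ>\<^sub>p [:of_nat j, 1:] = 0"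
      by (rule g_ann_low[OF jS _ 0]) (use dd in \<open>auto simp: degree_pcompose intro: coeff_eq_0\<close>)
    then have "(?d \<circ>\<^sub>p [:of_nat j, 1:]) \<circ>\<^sub>p [:- of_nat j, 1:] = 0" by simp
    then show False using ne by (simp add: pcompose_shift_shift pcompose_idR)
  qed
qed

text \<open>Choosing the unique polynomial of bounded degree is what makes the assignment linear in
  \<open>u\<close> and gives the value 1 at \<open>V\<close>, both through
  \<open>wpoly_eqI\<close>.\<close>

definition wpoly :: "nat \<Rightarrow> ('b \<Rightarrow> 'b) \<Rightarrow> 'a poly" where
  "wpoly j u = (THE f. f \<in> polys_below (deg * s (Suc j)) \<and> u (g (Suc j)) = (V ^^ j) (pa Eop f (g (Suc j))))"

lemma wpoly_below: "weight_op (of_nat j) u \<Longrightarrow> j < m \<Longrightarrow> wpoly j u \<in> polys_below (deg * s (Suc j))"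
  and wpoly_g: "weight_op (of_nat j) u \<Longrightarrow> j < m \<Longrightarrow> u (g (Suc j)) = (V ^^ j) (pa Eop (wpoly j u) (g (Suc j)))"
  using theI'[OF wpoly_ex1, of j u] unfolding wpoly_def by auto

lemma wpoly_eqI:
  assumes "weight_op (of_nat j) u" "j < m" "f \<in> polys_below (deg * s (Suc j))"
    "u (g (Suc j)) = (V ^^ j) (pa Eop f (g (Suc j)))"
  shows "wpoly j u = f"
  unfolding wpoly_def by (rule the1_equality[OF wpoly_ex1]) (use assms in auto)

text \<open>For \<open>w\<close> in U_i with i > j, a power of \<open>V\<close> brings
  \<open>w\<close> into U_(j+1), where every vector is a polynomial in y applied to the generator
  and both operators pass that polynomial in the same way. The power of \<open>V\<close> is
  injective on U_(i-j), where both images of \<open>w\<close> lie. For i \<le> j both operators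
  vanish on U_i.\<close>

lemma wpoly_eq:
  assumes u: "weight_op (of_nat j) u" and j: "j < m"
  shows "u w = (V ^^ j) (pa Eop (wpoly j u) w)"
proof -
  define t where "t w = (V ^^ j) (pa Eop (wpoly j u) w)" for w
  have lu: "lin u" and tw: "\<And>w. Y (u w) = u (Y w) + sc (of_nat j) (u w)" and uV: "\<And>w. u (V w) = V (u w)"
    using u unfolding weight_op_def by auto
  have lt: "lin t" unfolding t_def by (rule lin_comp[OF V_funpow_lin lin_pa[OF Eop_lin]])
  have jS: "Suc j \<in> {1..m}" using j by auto
  show ?thesis unfolding t_def[symmetric]
  proof (rule lin_eqI[OF lu lt])
    fix i w assume i: "i \<in> {1..m}" and w: "w \<in> Uc i"
    have Ew: "pa Eop (wpoly j u) w \<in> Uc i" by (rule pa_Eop_Uc[OF i w])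
    show "u w = t w"
    proof (cases "i \<le> j")
      case True
      then show ?thesis using weight_op_of_nat(1)[OF u j i w] V_funpow_Uc[OF i Ew, of j] by (simp add: t_def)
    next
      case False
      \<comment> \<open>The number of steps from U_i down to U_(j+1); the images of \<open>w\<close>
        lie in the component of index k + 1, so k steps do not yet destroy them.\<close>
      define k where "k = i - Suc j"
      have k: "k < i" "i - k = Suc j" "i - j = Suc k" "k < m" using False i by (auto simp: k_def)
      have uVk: "u ((V ^^ k) w) = (V ^^ k) (u w)" by (induction k) (simp_all add: uV)
      have tVk: "t ((V ^^ k) w) = (V ^^ k) (t w)"
        unfolding t_def pa_Eop_V_funpow by (metis comp_apply funpow_add add.commute)
      have "(V ^^ k) w \<in> Uc (Suc j)" using V_funpow_Uc[OF i w, of k] k by simp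
      then obtain q where q: "(V ^^ k) w = pa Y q (g (Suc j))" using g_rep[OF jS] by blast
      define q' where "q' = q \<circ>\<^sub>p [:- of_nat j, 1:]"
      have q': "q' \<circ>\<^sub>p [:of_nat j, 1:] = q" unfolding q'_def by (simp add: pcompose_shift_shift pcompose_idR)
      have "u (pa Y q (g (Suc j))) = pa Y q' (u (g (Suc j)))"
        using pa_twist[OF Y_lin lu tw, of q' "g (Suc j)"] q' by simp
      also have "\<dots> = pa Y q' (t (g (Suc j)))" using wpoly_g[OF u j] by (simp add: t_def)
      also have "\<dots> = (V ^^ j) (pa Y q (pa Eop (wpoly j u) (g (Suc j))))"
        unfolding t_def pa_V_funpow q' ..
      also have "\<dots> = t (pa Y q (g (Suc j)))"
      proof -
        have jm: "Suc j \<le> m" using jS by simp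
        show ?thesis
          unfolding t_def pa_Eop[OF jS g_Uc[OF jS]] pa_Eop[OF jS Uc_pa[OF jm g_Uc[OF jS]]]
          by (simp only: pa_mult[OF Y_lin, symmetric] mult.commute)
      qed
      finally have "(V ^^ k) (u w) = (V ^^ k) (t w)" using uVk tVk q by simp
      then have 0: "(V ^^ k) (u w - t w) = 0" by (simp add: lin_diff[OF V_funpow_lin])
      have "u w \<in> Uc (Suc k)" using weight_op_of_nat(2)[OF u j i w] False k by simp
      moreover have "t w \<in> Uc (Suc k)" using V_funpow_Uc[OF i Ew, of j] False k by (simp add: t_def)
      ultimately have "u w - t w \<in> Uc (Suc k)" using Uc_subspace[of "Suc k"] k by (simp add: subspace_diff)
      then have "u w - t w = 0" using V_funpow_Uc[of "Suc k" "u w - t w" k] 0 k by simp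
      then show ?thesis by simp
    qed
  qed
qed

text \<open>Polynomials in E commute with T, so both orders are available: the first describes
  single elements, the second the summands of the image of the Lie algebra.\<close>

lemma mx_weight_op:
  assumes "weight_op (of_nat j) u" "j < m"
  shows "B.mx u = matrix_T deg m p s ^\<^sub>m j * mat_poly (wpoly j u) (matrix_E m p s)"
    and "B.mx u = mat_poly (wpoly j u) (matrix_E m p s) * matrix_T deg m p s ^\<^sub>m j"
proof -
  have u: "u = (\<lambda>w. (V ^^ j) (pa Eop (wpoly j u) w))" using wpoly_eq[OF assms] by blast
  then show "B.mx u = matrix_T deg m p s ^\<^sub>m j * mat_poly (wpoly j u) (matrix_E m p s)"
    using B.mx_comp[OF V_funpow_lin, of j "pa Eop (wpoly j u)"]
    by (simp only: B.mx_funpow[OF V_lin] mx_V B.mat_poly_mx[OF Eop_lin, symmetric] mx_Eop)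
  have u': "u = (\<lambda>w. pa Eop (wpoly j u) ((V ^^ j) w))" using wpoly_eq[OF assms] pa_Eop_V_funpow by metis
  then show "B.mx u = mat_poly (wpoly j u) (matrix_E m p s) * matrix_T deg m p s ^\<^sub>m j"
    using B.mx_comp[OF lin_pa[OF Eop_lin], of "wpoly j u" "V ^^ j"]
    by (simp only: B.mx_funpow[OF V_lin] mx_V B.mat_poly_mx[OF Eop_lin, symmetric] mx_Eop)
qed

text \<open>On U_i the operator of weight j takes values in U_(i-j), and the components are
  independent.\<close>

lemma weight_ops_independent:
  assumes u: "\<And>j. j < m \<Longrightarrow> weight_op (of_nat j) (u j)" and 0: "\<And>w. (\<Sum>j<m. u j w) = 0" and j: "j < m"
  shows "u j w = 0"
proof (rule lin_eqI[of "u j" "\<lambda>w. 0", OF _ lin_zero])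
  show "lin (u j)" using u[OF j] unfolding weight_op_def by blast
  fix i w assume i: "i \<in> {1..m}" and w: "w \<in> Uc i"
  have "(\<Sum>l\<in>{1..i}. u (i - l) w) = (\<Sum>j<i. u j w)"
    by (rule sum.reindex_bij_witness[of _ "\<lambda>j. i - j" "\<lambda>l. i - l"]) auto
  also have "\<dots> = (\<Sum>j<m. u j w)"
    by (rule sum.mono_neutral_left) (use i weight_op_of_nat(1)[OF u _ i w] in auto)
  finally have "(\<Sum>l\<in>{1..i}. u (i - l) w) = 0" using 0 by simp
  moreover have "\<forall>l\<in>{1..i}. u (i - l) w \<in> Uc l"
  proof
    fix l assume l: "l \<in> {1..i}"
    then have "i - l < m" "i - l < i" "i - (i - l) = l" using i by auto
    then show "u (i - l) w \<in> Uc l" using weight_op_of_nat(2)[OF u _ i w, of "i - l"] by simp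
  qed
  ultimately have all: "\<forall>l\<in>{1..i}. u (i - l) w = 0" using Uc_sum_eq_0[of i "\<lambda>l. u (i - l) w"] i by simp
  show "u j w = 0"
  proof (cases "i \<le> j")
    case True
    then show ?thesis using weight_op_of_nat(1)[OF u[OF j] j i w] by simp
  next
    case False
    then have "i - j \<in> {1..i}" "i - (i - j) = j" using i by auto
    then show ?thesis using all by metis
  qed
qed

subsection \<open>Uniseriality and semisimplicity\<close>

text \<open>The product of the other prime powers annihilates the other components, so it leaves a
  multiple of \<open>u i\<close> in \<open>N\<close>. It is coprime to p_i^s_i, which annihilates
  \<open>u i\<close>, and so \<open>u i\<close> itself is recovered.\<close>

lemma component_mem:
  assumes N: "stable Y N" and u: "\<forall>j\<in>{1..m}. u j \<in> Uc j" and sum: "(\<Sum>j\<in>{1..m}. u j) \<in> N" and i: "i \<in> {1..m}"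
  shows "u i \<in> N"
proof -
  let ?Q = "\<Prod>l\<in>{1..m} - {i}. p l ^ s l" and ?P = "p i ^ s i"
  have "bezout_coprime (p l ^ s l) ?P" if "l \<in> {1..m} - {i}" for l
  proof -
    have l: "l \<in> {1..m}" "p l \<noteq> p i" using that i p_distinct[of l i] by auto
    then show ?thesis
      using irreducible_bezout_coprime_distinct[OF p_irr[OF l(1)] p_irr[OF i] p_monic[OF l(1)] p_monic[OF i]]
      by (intro bezout_coprime_powers)
  qed
  then have cop: "bezout_coprime ?Q ?P" by (intro bezout_coprime_prod) auto
  have "pa Y ?Q (\<Sum>j\<in>{1..m}. u j) = pa Y ?Q (u i) + (\<Sum>j\<in>{1..m} - {i}. pa Y ?Q (u j))"
    by (subst sum.remove[OF _ i]) (simp_all add: lin_add lin_sum lin_pa Y_lin)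
  also have "(\<Sum>j\<in>{1..m} - {i}. pa Y ?Q (u j)) = 0"
  proof (rule sum.neutral, rule ballI)
    fix j assume j: "j \<in> {1..m} - {i}"
    have "?Q = (\<Prod>l\<in>{1..m} - {i} - {j}. p l ^ s l) * p j ^ s j"
      by (subst prod.remove[OF _ j]) (simp_all add: mult.commute)
    then show "pa Y ?Q (u j) = 0" using u j lin_pa[OF Y_lin] unfolding Uc_def by (simp add: pa_mult[OF Y_lin])
  qed
  finally have "pa Y ?Q (u i) \<in> N" using stable_pa[OF Y_lin N sum, of ?Q] by simp
  moreover have "pa Y ?P (u i) = 0" using u i unfolding Uc_def by simp
  then have "pa Y ?P (u i) \<in> N" using subspace_0[OF stable_subspace[OF N]] by simp
  ultimately show ?thesis by (rule bezout_coprime_mem[OF Y_lin cop N])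
qed

text \<open>With s_i = 1 the component is F[X]/(p_i), which is simple: a polynomial with nonzero
  value at the generator is coprime to p_i.\<close>

lemma simple_component:
  assumes N: "stable Y N" and i: "i \<in> {1..m}" and s1: "s i = 1" and w: "w \<in> Uc i" "w \<in> N" "w \<noteq> 0"
  shows "Uc i \<subseteq> N"
proof -
  obtain f where f: "w = pa Y f (g i)" using g_rep[OF i w(1)] by blast
  have "\<not> p i dvd f" using g_ann[OF i, of f] f w(3) s1 by simp
  then have cop: "bezout_coprime f (p i)" using irreducible_bezout_coprime[OF p_irr[OF i]] bezout_coprime_sym by blast
  have "pa Y (p i) (g i) = 0" using g_ann[OF i, of "p i"] s1 by simp
  then have "g i \<in> N"
    using bezout_coprime_mem[OF Y_lin cop N] f w(2) subspace_0[OF stable_subspace[OF N]] by simp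
  then show ?thesis using g_rep[OF i] stable_pa[OF Y_lin N] by blast
qed

text \<open>A nonzero vector of U_k in \<open>N\<close> fills U_k by simplicity and is carried by
  powers of \<open>V\<close> to nonzero vectors of all lower components. So the components met by
  \<open>N\<close> are the first ones and lie in it, and \<open>N\<close> is their sum by
  \<open>component_mem\<close>.\<close>

lemma simple_components_chain:
  assumes s1: "\<And>i. i \<in> {1..m} \<Longrightarrow> s i = 1" and N: "stable Y N" "stable V N"
  shows "\<exists>k\<le>m. N = Us k"
proof -
  have down: "Uc i \<subseteq> N" if "i \<in> {1..m}" "k \<in> {1..m}" "i \<le> k" and ex: "\<exists>w\<in>Uc k. w \<in> N \<and> w \<noteq> 0" for i k
  proof -
    obtain w where w: "w \<in> Uc k" "w \<in> N" "w \<noteq> 0" using ex by blast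
    have VN: "(V ^^ j) w \<in> N" for j by (induction j) (use w N stable_mem in auto)
    have "(V ^^ (k - i)) w \<in> Uc i \<and> (V ^^ (k - i)) w \<noteq> 0"
      using V_funpow_Uc[OF that(2) w(1), of "k - i"] that w(3) by auto
    then show ?thesis using simple_component[OF N(1) that(1) s1[OF that(1)]] VN by blast
  qed
  define K where "K = {k\<in>{1..m}. Uc k \<subseteq> N}"
  \<comment> \<open>The value 0 covers the submodule that contains no component, which is
    \<open>Us 0\<close>.\<close>
  define k where "k = (if K = {} then 0 else Max K)"
  have fin: "finite K" unfolding K_def by simp
  have km: "k \<le> m" using Max_in[OF fin] unfolding k_def K_def by auto
  have nz: "\<exists>w\<in>Uc i. w \<noteq> 0" if "i \<in> {1..m}" for i
  proof -
    have "g i \<noteq> 0" using g_ann[OF that, of 1] Y_lin p_irr[OF that] s1[OF that] by (auto simp: irreducible_def)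
    then show ?thesis using g_Uc[OF that] by blast
  qed
  have low: "Uc i \<subseteq> N" if "i \<in> {1..m}" "i \<le> k" for i
  proof -
    have K: "K \<noteq> {}" using that unfolding k_def by auto
    then have "k \<in> K" using Max_in[OF fin K] by (simp add: k_def)
    then have "k \<in> {1..m}" "Uc k \<subseteq> N" unfolding K_def by auto
    then show ?thesis using down[OF that(1) _ that(2)] nz by blast
  qed
  have high: "w = 0" if "i \<in> {1..m}" "k < i" "w \<in> Uc i" "w \<in> N" for i w
  proof (rule ccontr)
    assume "w \<noteq> 0"
    then have "Uc i \<subseteq> N" using simple_component[OF N(1) that(1) s1[OF that(1)]] that by blast
    then have "i \<in> K" using that unfolding K_def by blast
    then have "i \<le> k" using Max_ge[OF fin] unfolding k_def by auto
    then show False using that by simp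
  qed
  have "N = Us k"
  proof (intro equalityI subsetI)
    fix w assume w: "w \<in> N"
    obtain u where u: "\<forall>j\<in>{1..m}. u j \<in> Uc j" "w = (\<Sum>j\<in>{1..m}. u j)"
      using Us_sum_Uc[of m w] Us_m by auto
    have "u j = 0" if "j \<in> {1..m}" "k < j" for j
      using high[OF that] u(1) component_mem[OF N(1) u(1) _ that(1)] u(2) w that by blast
    then have "w = (\<Sum>j\<in>{1..k}. u j)"
      unfolding u(2) by (intro sum.mono_neutral_right) (use km in auto)
    also have "\<dots> \<in> Us k"
    proof (rule subspace_sum[OF Us_subspace[OF km]])
      fix j assume j: "j \<in> {1..k}"
      then have "u j \<in> Uc j" using u(1) km by simp
      then show "u j \<in> Us k" using Uc_subset[of j] Us_le[of j k] km j by auto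
    qed
    finally show "w \<in> Us k" .
  next
    fix w assume "w \<in> Us k"
    then obtain u where u: "\<forall>j\<in>{1..k}. u j \<in> Uc j" "w = (\<Sum>j\<in>{1..k}. u j)"
      using Us_sum_Uc[OF km] by blast
    show "w \<in> N" unfolding u(2)
    proof (rule subspace_sum[OF stable_subspace[OF N(1)]])
      fix j assume "j \<in> {1..k}"
      then show "u j \<in> N" using u(1) low[of j] km by auto
    qed
  qed
  then show ?thesis using km by blast
qed

text \<open>If \<open>s\<^sub>1 > 1\<close>, the socles of the first two components span a submodule which is not comparable
  with \<open>U\<^sup>(\<^sup>1\<^sup>)\<close>.\<close>
lemma not_chain:
  assumes s1: "s 1 \<noteq> 1"
  obtains N where "stable Y N" "\<And>d u. weight_op d u \<Longrightarrow> stable u N" "\<not> N \<subseteq> Us 1" "\<not> Us 1 \<subseteq> N"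
proof -
  have one: "1 \<in> {1..m}" and two: "2 \<in> {1..m}" using m_gt_1 by auto
  have Us1: "Us 1 = Uc 1"
  proof
    show "Us 1 \<subseteq> Uc 1" using Us_kill[of 0] Us_0 m_gt_1 unfolding Uc_def by auto
  qed (rule Uc_subset)
  define K where "K i = {w\<in>Uc i. pa Y (p i) w \<in> {0}}" for i
  define N where "N = {a + b |a b. a \<in> K 1 \<and> b \<in> K 2}"
  have sK: "subspace (K i)" if "i \<in> {1..m}" for i
    unfolding K_def by (rule subspace_vimage[OF lin_pa[OF Y_lin]]) (use Uc_subspace[of i] that in auto)
  have sN: "subspace N" unfolding N_def by (rule subspace_sums[OF sK[OF one] sK[OF two]])
  have KN: "K 1 \<subseteq> N" "K 2 \<subseteq> N"
  proof -
    show "K 1 \<subseteq> N" unfolding N_def using subspace_0[OF sK[OF two]] by force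
    show "K 2 \<subseteq> N" unfolding N_def using subspace_0[OF sK[OF one]] by force
  qed
  have N1: "stable Y N"
  proof -
    have YK: "Y w \<in> K i" if "i \<in> {1..m}" "w \<in> K i" for i w
      using that stable_mem[OF Uc_stable[of i]] pa_commute[OF Y_lin Y_lin, of "p i" w] Y_lin
      unfolding K_def by auto
    have "Y w \<in> N" if w: "w \<in> N" for w
    proof -
      obtain a b where ab: "w = a + b" "a \<in> K 1" "b \<in> K 2" using w unfolding N_def by blast
      then have "Y w = Y a + Y b" by (simp add: lin_add Y_lin)
      then show ?thesis unfolding N_def using YK[OF one ab(2)] YK[OF two ab(3)] by blast
    qed
    then show ?thesis unfolding stable_def using sN by blast
  qed
  have N2: "stable u N" if u: "weight_op d u" for d u
  proof -
    have lu: "lin u" and tw: "\<And>w. Y (u w) = u (Y w) + sc d (u w)" using u unfolding weight_op_def by auto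
    have mem: "u w \<in> N" if i: "i \<in> {1..m}" "i \<le> 2" and w: "w \<in> K i" for i w
    proof (cases "u w = 0")
      case True
      then show ?thesis using subspace_0[OF sN] by simp
    next
      case False
      have wU: "w \<in> Uc i" using w unfolding K_def by blast
      obtain j where j: "j \<in> {1..i}" "d = of_nat (i - j)" "u w \<in> Uc j"
        using weight_op_component[OF u i(1) wU False] by blast
      \<comment> \<open>A weight operator maps kernels of the p_i(y) to each other, because its
        shift carries p_j to p_i.\<close>
      have "p i = p j \<circ>\<^sub>p [:d, 1:]" using p_add[of j "i - j"] j i by auto
      then have "pa Y (p j) (u w) = u (pa Y (p i) w)" using pa_twist[OF Y_lin lu tw] by simp
      also have "\<dots> = 0" using w lu unfolding K_def by simp
      finally have "u w \<in> K j" using j(3) unfolding K_def by simp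
      moreover have "j = 1 \<or> j = 2" using j(1) i by auto
      ultimately show ?thesis using KN by auto
    qed
    have "u w \<in> N" if w: "w \<in> N" for w
    proof -
      obtain a b where "w = a + b" "a \<in> K 1" "b \<in> K 2" using w unfolding N_def by blast
      then show ?thesis using mem[of 1 a] mem[of 2 b] one two sN lu by (simp add: lin_add subspace_add)
    qed
    then show ?thesis unfolding stable_def using sN by blast
  qed
  have N3: "\<not> N \<subseteq> Us 1"
  proof
    assume sub: "N \<subseteq> Us 1"
    obtain t where t: "s 2 = Suc t" using s_pos[OF two] by (cases "s 2") auto
    \<comment> \<open>A nonzero vector of the socle of U_2, which meets \<open>Us 1\<close> only in
      zero.\<close>
    let ?w = "pa Y (p 2 ^ t) (g 2)"
    have p2: "p 2 \<noteq> 0" "\<not> is_unit (p 2)" using p_irr[OF two] by (auto simp: irreducible_def)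
    have "pa Y (p 2) ?w = 0" using g_ann[OF two, of "p 2 * p 2 ^ t"] t by (simp add: pa_mult[OF Y_lin])
    then have wK: "?w \<in> K 2" unfolding K_def using Uc_pa[of 2 "g 2"] g_Uc[OF two] two by simp
    then have "?w \<in> Us 1" using KN sub by blast
    then have "?w = 0" using Uc_Int_lower[of 1 ?w "s 2"] wK m_gt_1 unfolding K_def Uc_def
      by (simp add: numeral_2_eq_2)
    then have "p 2 ^ Suc t dvd p 2 ^ t" using g_ann[OF two, of "p 2 ^ t"] t by simp
    then have "Suc t \<le> t" using p2 by (metis dvd_power_iff)
    then show False by simp
  qed
  have N4: "\<not> Us 1 \<subseteq> N"
  proof
    assume "Us 1 \<subseteq> N"
    \<comment> \<open>If the generator of U_1 were a sum of socle elements, its part in U_2 would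
      vanish, p_1(y) would annihilate it, and s_1 would be 1.\<close>
    then have "g 1 \<in> N" using Us1 g_Uc[OF one] by blast
    then obtain a b where ab: "g 1 = a + b" "a \<in> K 1" "b \<in> K 2" unfolding N_def by blast
    have "b = g 1 - a" using ab(1) by simp
    moreover have "g 1 - a \<in> Us 1"
      using ab(2) g_Uc[OF one] Us1 Us_subspace[of 1] one unfolding K_def by (auto intro: subspace_diff)
    ultimately have "b \<in> Us 1" by simp
    then have "b = 0" using Uc_Int_lower[of 1 b "s 2"] ab(3) m_gt_1 unfolding K_def Uc_def
      by (simp add: numeral_2_eq_2)
    then have "pa Y (p 1) (g 1) = 0" using ab unfolding K_def by simp
    then have "p 1 ^ s 1 dvd p 1 ^ 1" using g_ann[OF one] by simp
    moreover have "p 1 \<noteq> 0" "\<not> is_unit (p 1)" using p_irr[OF one] by (auto simp: irreducible_def)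
    ultimately have "s 1 \<le> 1" by (metis dvd_power_iff)
    then show False using s1 s_pos[OF one] by simp
  qed
  show thesis using that[OF N1 N2 N3 N4] .
qed

text \<open>Every component is simple and \<open>W\<close> is the sum of the components it contains,
  so the remaining components add up to a stable complement.\<close>

lemma semisimple_Y:
  assumes s1: "\<And>i. i \<in> {1..m} \<Longrightarrow> s i = 1"
  shows "semisimple_operator sc Y"
  unfolding semisimple_operator_def
proof (intro allI impI)
  fix W assume W: "subspace W \<and> Y ` W \<subseteq> W"
  then have N: "stable Y W" unfolding stable_def by blast
  define I where "I = {i\<in>{1..m}. \<not> Uc i \<subseteq> W}"
  define W' where "W' = {(\<Sum>i\<in>{1..m}. u i) |u. (\<forall>i\<in>{1..m}. u i \<in> Uc i) \<and> (\<forall>i\<in>{1..m} - I. u i = 0)}"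
  have "subspace W'"
  proof (rule subspaceI)
    have "(\<Sum>i\<in>{1..m}. (\<lambda>i. 0 :: 'b) i) \<in> W'" unfolding W'_def
      using subspace_0[OF Uc_subspace] by (intro CollectI exI[of _ "\<lambda>i. 0"]) auto
    then show "0 \<in> W'" by simp
  next
    fix x y assume "x \<in> W'" "y \<in> W'"
    then obtain u u' where u: "x = (\<Sum>i\<in>{1..m}. u i)" "\<forall>i\<in>{1..m}. u i \<in> Uc i" "\<forall>i\<in>{1..m} - I. u i = 0"
      and u': "y = (\<Sum>i\<in>{1..m}. u' i)" "\<forall>i\<in>{1..m}. u' i \<in> Uc i" "\<forall>i\<in>{1..m} - I. u' i = 0"
      unfolding W'_def by blast
    then show "x + y \<in> W'" unfolding W'_def using subspace_add[OF Uc_subspace]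
      by (intro CollectI exI[of _ "\<lambda>i. u i + u' i"]) (auto simp: sum.distrib)
  next
    fix c x assume "x \<in> W'"
    then obtain u where u: "x = (\<Sum>i\<in>{1..m}. u i)" "\<forall>i\<in>{1..m}. u i \<in> Uc i" "\<forall>i\<in>{1..m} - I. u i = 0"
      unfolding W'_def by blast
    then show "sc c x \<in> W'" unfolding W'_def using subspace_scale[OF Uc_subspace]
      by (intro CollectI exI[of _ "\<lambda>i. sc c (u i)"]) (auto simp: scale_sum_right)
  qed
  moreover have "Y ` W' \<subseteq> W'"
  proof
    fix x assume "x \<in> Y ` W'"
    then obtain u where u: "x = Y (\<Sum>i\<in>{1..m}. u i)" "\<forall>i\<in>{1..m}. u i \<in> Uc i" "\<forall>i\<in>{1..m} - I. u i = 0"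
      unfolding W'_def by blast
    then show "x \<in> W'" unfolding W'_def using stable_mem[OF Uc_stable] Y_lin
      by (intro CollectI exI[of _ "\<lambda>i. Y (u i)"]) (auto simp: lin_sum)
  qed
  moreover have "W \<inter> W' = {0}"
  proof (intro equalityI subsetI)
    fix x assume x: "x \<in> W \<inter> W'"
    then obtain u where u: "x = (\<Sum>i\<in>{1..m}. u i)" "\<forall>i\<in>{1..m}. u i \<in> Uc i" "\<forall>i\<in>{1..m} - I. u i = 0"
      unfolding W'_def by blast
    have "u i = 0" if i: "i \<in> {1..m}" for i
    proof (rule ccontr)
      assume nz: "u i \<noteq> 0"
      have "u i \<in> W" using component_mem[OF N u(2) _ i] x u(1) by simp
      then have "Uc i \<subseteq> W" using simple_component[OF N i s1[OF i]] u(2) i nz by blast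
      then have "i \<in> {1..m} - I" using i unfolding I_def by blast
      then show False using u(3) nz by blast
    qed
    then show "x \<in> {0}" using u(1) by simp
  next
    fix x assume "x \<in> {0 :: 'b}"
    then show "x \<in> W \<inter> W'" using W \<open>subspace W'\<close> subspace_0 by auto
  qed
  moreover have "\<exists>w\<in>W. \<exists>w'\<in>W'. x = w + w'" for x
  proof -
    obtain u where u: "\<forall>j\<in>{1..m}. u j \<in> Uc j" "x = (\<Sum>j\<in>{1..m}. u j)"
      using Us_sum_Uc[of m x] Us_m by auto
    let ?a = "\<lambda>i. if i \<in> I then 0 else u i" and ?b = "\<lambda>i. if i \<in> I then u i else 0"
    have "x = (\<Sum>i\<in>{1..m}. ?a i) + (\<Sum>i\<in>{1..m}. ?b i)"
      unfolding u(2) sum.distrib[symmetric] by (rule sum.cong) auto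
    moreover have "(\<Sum>i\<in>{1..m}. ?a i) \<in> W"
    proof (rule subspace_sum)
      show "subspace W" using W by blast
      fix i assume "i \<in> {1..m}"
      then show "?a i \<in> W" using u(1) W subspace_0[of W] unfolding I_def by auto
    qed
    moreover have "(\<Sum>i\<in>{1..m}. ?b i) \<in> W'" unfolding W'_def
      using u(1) subspace_0[OF Uc_subspace] by (intro CollectI exI[of _ ?b]) auto
    ultimately show ?thesis by blast
  qed
  ultimately show "\<exists>W'. subspace W' \<and> Y ` W' \<subseteq> W' \<and> W \<inter> W' = {0} \<and> (\<forall>u. \<exists>w\<in>W. \<exists>w'\<in>W'. u = w + w')"
    by blast
qed

end

lemma (in fd_space) cyc_scale_operator:
  assumes h: "lin h" and c: "c \<noteq> 0" and W: "stable h W"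
  shows "cyc W (\<lambda>u. sc c (h u)) v = cyc W h v"
proof
  have sW: "subspace W" using W by (rule stable_subspace)
  have l: "lin (\<lambda>u. sc c (h u))" using h by (rule lin_smult)
  have st: "stable (\<lambda>u. sc c (h u)) N \<longleftrightarrow> stable h N" for N
  proof
    assume a: "stable (\<lambda>u. sc c (h u)) N"
    have "h w \<in> N" if "w \<in> N" for w
    proof -
      have "sc (inverse c) (sc c (h w)) \<in> N" using a that unfolding stable_def by (blast intro: subspace_scale)
      then show ?thesis using c by simp
    qed
    then show "stable h N" using a unfolding stable_def by blast
  qed (auto simp: stable_def subspace_scale)
  show "cyc W (\<lambda>u. sc c (h u)) v \<subseteq> cyc W h v"
    using st stable_cyc[OF h W] cyc_self[OF h sW] subset_cyc by (intro cyc_subset[OF l]) auto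
  show "cyc W h v \<subseteq> cyc W (\<lambda>u. sc c (h u)) v"
    using st stable_cyc[OF l] W cyc_self[OF l sW] subset_cyc by (intro cyc_subset[OF h]) auto
qed

section \<open>From the Lie module to commuting operators: the choice of y and v\<close>

section \<open>Linked modules over a semidirect product\<close>

locale semidirect_module = lie_module scale bracket scaleU act
  for scale :: "'f::field \<Rightarrow> 'g::ab_group_add \<Rightarrow> 'g" and bracket :: "'g \<Rightarrow> 'g \<Rightarrow> 'g"
    and scaleU :: "'f \<Rightarrow> 'u::ab_group_add \<Rightarrow> 'u" and act :: "'g \<Rightarrow> 'u \<Rightarrow> 'u" +
  fixes x :: 'g and A :: "'g set"
  assumes semidirect: "is_semidirect x A" and abel: "abelian A" and diag: "ad_diagonalizable_on x A"
begin

sublocale M: fd_space scaleU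
  by unfold_locales (rule finite_dim_module)

lemma act_lin: "M.lin (act z)"
  unfolding M.lin_def by (simp add: act_add_right act_scale_right)

lemma act_0 [simp]: "act 0 w = 0"
  using act_scale_left[of 0 0 w] by simp

lemma bracket_0 [simp]: "bracket 0 z = 0" "bracket z 0 = 0"
  using bracket_scale_left[of 0 0 z] bracket_scale_right[of z 0 0] by simp_all

lemma bracket_anti: "bracket a b = - bracket b a"
proof -
  have "bracket a b + bracket b a = 0"
    using bracket_self[of "a + b"] by (simp add: bracket_add_left bracket_add_right bracket_self[of a] bracket_self[of b] add.commute)
  then show ?thesis by (simp add: eq_neg_iff_add_eq_0)
qed

lemma act_swap: "act a (act b w) = act b (act a w) + act (bracket a b) w"
  by (simp add: act_bracket)

lemma A_subspace: "subspace A" and A_ideal: "b \<in> A \<Longrightarrow> bracket a b \<in> A" and x_notin: "x \<notin> A"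
  and decomp: "\<exists>c. \<exists>u\<in>A. z = scale c x + u"
  using semidirect unfolding is_semidirect_def ideal_def by auto

lemma A_abelian: "a \<in> A \<Longrightarrow> b \<in> A \<Longrightarrow> bracket a b = 0"
  using abel unfolding abelian_def by blast

lemma act_A_commute: "a \<in> A \<Longrightarrow> b \<in> A \<Longrightarrow> act a (act b w) = act b (act a w)"
  using act_swap[of a b w] A_abelian by simp

definition a0 :: "'g set" where "a0 = eigenspace_in A x 0"

lemma a0_iff: "u \<in> a0 \<longleftrightarrow> u \<in> A \<and> bracket x u = 0"
  unfolding a0_def eigenspace_in_def by simp

lemma a0_subspace: "subspace a0"
  using A_subspace by (auto simp: subspace_def a0_iff bracket_add_right bracket_scale_right)

definition Y0 :: "'g set" where "Y0 = span (insert x a0)"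

lemma Y0_iff: "z \<in> Y0 \<longleftrightarrow> (\<exists>c. \<exists>a\<in>a0. z = scale c x + a)"
proof -
  have "z \<in> Y0 \<longleftrightarrow> (\<exists>c. z - scale c x \<in> a0)"
    unfolding Y0_def span_insert using a0_subspace by (simp add: span_eq_iff[THEN iffD2])
  also have "\<dots> \<longleftrightarrow> (\<exists>c. \<exists>a\<in>a0. z = scale c x + a)" by (metis add_diff_cancel_left' diff_add_cancel add.commute)
  finally show ?thesis .
qed

lemma Y0_commute:
  assumes "z \<in> Y0" "z' \<in> Y0" shows "bracket z z' = 0"
proof -
  obtain c a c' a' where "z = scale c x + a" "a \<in> a0" "z' = scale c' x + a'" "a' \<in> a0"
    using assms unfolding Y0_iff by blast
  moreover from this have "bracket a x = 0" using bracket_anti[of a x] a0_iff by simp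
  ultimately show ?thesis
    using A_abelian by (simp add: a0_iff bracket_add_left bracket_add_right bracket_scale_left bracket_scale_right bracket_self)
qed

lemma Y0_subspace: "subspace Y0"
  unfolding Y0_def by (rule subspace_span)

lemma eigenbasis: "\<exists>B. span B = A \<and> (\<forall>b\<in>B. b \<in> A \<and> (\<exists>d. bracket x b = scale d b))"
proof -
  obtain B where B: "span B = A" "\<forall>b\<in>B. \<exists>d. bracket x b = scale d b"
    using diag unfolding ad_diagonalizable_on_def by blast
  then show ?thesis using span_superset[of B] by blast
qed

lemma solvable_UNIV: "solvable UNIV"
proof -
  have br: "bracket z z' \<in> A" for z z'
  proof -
    obtain c a c' a' where *: "z = scale c x + a" "a \<in> A" "z' = scale c' x + a'" "a' \<in> A"
      using decomp[of z] decomp[of z'] by blast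
    have "bracket z z' = scale c (bracket x a') - scale c' (bracket x a)"
      unfolding * using A_abelian[OF *(2,4)] bracket_anti[of a x]
      by (simp add: bracket_add_left bracket_add_right bracket_scale_left bracket_scale_right bracket_self)
    then show ?thesis using A_ideal * A_subspace by (simp add: subspace_diff subspace_scale)
  qed
  have d1: "derived_series UNIV (Suc 0) \<subseteq> A"
    unfolding derived_series.simps bracket_span_def using br by (intro span_minimal A_subspace) auto
  have "derived_series UNIV (Suc (Suc 0)) \<subseteq> span {0}"
    unfolding derived_series.simps(2)[of UNIV "Suc 0"] bracket_span_def
    using d1 A_abelian by (intro span_mono) auto
  then have "derived_series UNIV (Suc (Suc 0)) = {0}"
    using span_zero unfolding derived_series.simps(2)[of UNIV "Suc 0"] bracket_span_def by auto
  then show ?thesis unfolding solvable_def by blast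
qed

text \<open>All brackets lie in the abelian ideal, so the Lie algebra is solvable and equal to its
  radical.\<close>

lemma nil_part_eq: "nil_part = bracket_span UNIV UNIV"
proof -
  have "ideal UNIV" unfolding ideal_def by simp
  then have "UNIV \<subseteq> radical" unfolding radical_def using solvable_UNIV
    by (intro subset_trans[OF _ span_superset]) blast
  then have "radical = UNIV" by blast
  then show ?thesis unfolding nil_part_def by simp
qed

lemma bracket_nil_part: "bracket z z' \<in> nil_part"
  unfolding nil_part_eq bracket_span_def by (rule span_base) blast

lemma nil_part_subspace: "subspace nil_part"
  unfolding nil_part_eq bracket_span_def by (rule subspace_span)

lemma eigen_nil_part:
  assumes "d \<noteq> 0" "bracket z b = scale d b" shows "b \<in> nil_part"
proof -
  have "scale (inverse d) (bracket z b) \<in> nil_part" using bracket_nil_part nil_part_subspace subspace_scale by blast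
  then show ?thesis using assms by simp
qed

definition nzeig :: "'g set" where
  "nzeig = {b\<in>A. \<exists>d. d \<noteq> 0 \<and> bracket x b = scale d b}"

text \<open>Elements of the ideal commute, and [x, a] retains only the eigenvectors with nonzero
  eigenvalue in \<open>a\<close>. Conditions on \<open>nil_part\<close> can therefore be tested on
  eigenvectors.\<close>

lemma nil_part_span: "nil_part \<subseteq> span nzeig"
proof -
  obtain B where B: "span B = A" "\<And>b. b \<in> B \<Longrightarrow> b \<in> A" "\<And>b. b \<in> B \<Longrightarrow> \<exists>d. bracket x b = scale d b"
    using eigenbasis by blast
  have xa: "bracket x a \<in> span nzeig" if "a \<in> A" for a
  proof -
    have "a \<in> span B" using that B by simp
    then show ?thesis
    proof (induction rule: span_induct_alt)
      case base
      then show ?case by (simp add: span_zero)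
    next
      case (step c b a)
      obtain d where d: "bracket x b = scale d b" using B(3) step(1) by blast
      have "bracket x b \<in> span nzeig"
      proof (cases "d = 0")
        case True
        then show ?thesis using d by (simp add: span_zero)
      next
        case False
        then have "b \<in> nzeig" using d B(2) step(1) unfolding nzeig_def by blast
        then show ?thesis using d by (simp add: span_scale span_base)
      qed
      then show ?case using step by (simp add: bracket_add_right bracket_scale_right span_add span_scale)
    qed
  qed
  have "bracket z z' \<in> span nzeig" for z z'
  proof -
    obtain c a c' a' where *: "z = scale c x + a" "a \<in> A" "z' = scale c' x + a'" "a' \<in> A"
      using decomp[of z] decomp[of z'] by blast
    have "bracket z z' = scale c (bracket x a') - scale c' (bracket x a)"
      unfolding * using A_abelian[OF *(2,4)] bracket_anti[of a x]
      by (simp add: bracket_add_left bracket_add_right bracket_scale_left bracket_scale_right bracket_self)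
    then show ?thesis using xa * by (simp add: span_diff span_scale)
  qed
  then show ?thesis unfolding nil_part_eq bracket_span_def by (intro span_minimal subspace_span) auto
qed

text \<open>Exchanging z' in \<open>nil_part\<close> with z costs the action of [z', z], which is
  again in \<open>nil_part\<close>.\<close>

lemma nil_series_stable: "U.subspace (nil_series i) \<and> (\<forall>z. \<forall>w\<in>nil_series i. act z w \<in> nil_series i)"
proof (induction i)
  case 0
  then show ?case by (simp add: U.subspace_def M.lin_0[OF act_lin])
next
  case (Suc i)
  then have s: "U.subspace (nil_series i)" and st: "\<And>z w. w \<in> nil_series i \<Longrightarrow> act z w \<in> nil_series i" by auto
  have "U.subspace (nil_series (Suc i))"
    using s by (auto simp: U.subspace_def act_add_right act_scale_right M.lin_0[OF act_lin])
  moreover have "act z w \<in> nil_series (Suc i)" if w: "w \<in> nil_series (Suc i)" for z w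
  proof -
    have "act z' (act z w) \<in> nil_series i" if z': "z' \<in> nil_part" for z'
    proof -
      have "act z' (act z w) = act z (act z' w) + act (bracket z' z) w" by (rule act_swap)
      moreover have "act z (act z' w) \<in> nil_series i" using st w z' by simp
      moreover have "act (bracket z' z) w \<in> nil_series i" using w bracket_nil_part by simp
      ultimately show ?thesis using s by (simp add: U.subspace_add)
    qed
    then show ?thesis by simp
  qed
  ultimately show ?case by blast
qed

lemma nil_series_subspace: "U.subspace (nil_series i)"
  and nil_series_act: "w \<in> nil_series i \<Longrightarrow> act z w \<in> nil_series i"
  using nil_series_stable[of i] by auto

lemma nil_series_stable_act: "M.stable (act z) (nil_series i)"
  unfolding M.stable_def using nil_series_subspace nil_series_act by blast

lemma nil_series_mono: "nil_series i \<subseteq> nil_series (Suc i)"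
  using nil_series_act by auto

lemma nil_series_down: "z \<in> nil_part \<Longrightarrow> w \<in> nil_series (Suc i) \<Longrightarrow> act z w \<in> nil_series i"
  by simp

lemma nil_series_SucI:
  assumes "\<And>b. b \<in> nzeig \<Longrightarrow> act b w \<in> nil_series i"
  shows "w \<in> nil_series (Suc i)"
proof -
  have "act z w \<in> nil_series i" if "z \<in> span nzeig" for z
    using that
  proof (induction rule: span_induct_alt)
    case base
    then show ?case using nil_series_subspace U.subspace_0 by simp
  next
    case (step c b z)
    then show ?case using assms nil_series_subspace
      by (simp add: act_add_left act_scale_left U.subspace_add U.subspace_scale)
  qed
  then show ?thesis using nil_part_span by auto
qed

lemma stable_by_generators:
  assumes N: "U.subspace N" and y: "\<And>w. w \<in> N \<Longrightarrow> act y w \<in> N" and y_form: "y = scale c x + a" "c \<noteq> 0" "a \<in> A"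
    and B: "span B = A" "\<And>b w. b \<in> B \<Longrightarrow> w \<in> N \<Longrightarrow> act b w \<in> N" and w: "w \<in> N"
  shows "act z w \<in> N"
proof -
  have An: "act u w \<in> N" if "u \<in> A" "w \<in> N" for u w
  proof -
    have "u \<in> span B" using that B by simp
    then show ?thesis
    proof (induction rule: span_induct_alt)
      case base
      then show ?case using N U.subspace_0 by simp
    next
      case (step k b u)
      then show ?case using B(2) that(2) N by (simp add: act_add_left act_scale_left U.subspace_add U.subspace_scale)
    qed
  qed
  obtain k u where z: "z = scale k x + u" "u \<in> A" using decomp by blast
  have "x = scale (inverse c) (y - a)" using y_form by simp
  then have "act x w = scaleU (inverse c) (act y w - act a w)"
    using act_add_left[of "y - a" a w] by (simp add: act_scale_left)
  then have "act x w \<in> N" using y[OF w] An[OF y_form(3) w] N by (simp add: U.subspace_diff U.subspace_scale)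
  then show ?thesis using z An[OF _ w] N by (simp add: act_add_left act_scale_left U.subspace_add U.subspace_scale)
qed

sublocale LO: comm_ops scaleU "act ` Y0"
proof
  fix h k c assume "h \<in> act ` Y0"
  then obtain z where z: "z \<in> Y0" "h = act z" by blast
  show "M.lin h" using z act_lin by simp
  assume "k \<in> act ` Y0"
  then obtain z' where z': "z' \<in> Y0" "k = act z'" by blast
  show "h (k u) = k (h u)" for u using act_swap[of z z' u] Y0_commute[OF z(1) z'(1)] z z' by simp
  have "(\<lambda>u. h u + scaleU c (k u)) = act (z + scale c z')"
    using z z' by (simp add: fun_eq_iff act_add_left act_scale_left)
  moreover have "z + scale c z' \<in> Y0" using z z' Y0_subspace by (simp add: subspace_add subspace_scale)
  ultimately show "(\<lambda>u. h u + scaleU c (k u)) \<in> act ` Y0" by blast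
next
  show "act ` Y0 \<noteq> {}" using subspace_0[OF Y0_subspace] by blast
qed

lemma x_Y0: "x \<in> Y0"
  unfolding Y0_def by (rule span_base) simp

lemma a0_Y0: "a \<in> a0 \<Longrightarrow> a \<in> Y0"
  unfolding Y0_def by (rule span_base) simp

text \<open>Eigenvectors with nonzero eigenvalue map the upper term into the lower one, so only x
  and the zero eigenspace have to be tested. This turns uniseriality of a factor over the Lie
  algebra into uniseriality over commuting operators.\<close>

lemma Lstable_between:
  assumes N: "LO.Lstable N" "nil_series i \<subseteq> N" "N \<subseteq> nil_series (Suc i)" and w: "w \<in> N"
  shows "act z w \<in> N"
proof -
  obtain B where B: "span B = A" "\<And>b. b \<in> B \<Longrightarrow> b \<in> A" "\<And>b. b \<in> B \<Longrightarrow> \<exists>d. bracket x b = scale d b"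
    using eigenbasis by blast
  have L: "act z w \<in> N" if "z \<in> Y0" "w \<in> N" for z w
    using N(1) that unfolding LO.Lstable_def by blast
  have "act b w \<in> N" if b: "b \<in> B" and w: "w \<in> N" for b w
  proof -
    obtain d where d: "bracket x b = scale d b" using B(3) b by blast
    show ?thesis
    proof (cases "d = 0")
      case True
      then have "b \<in> a0" using d B(2) b by (simp add: a0_iff)
      then show ?thesis using L a0_Y0 w by blast
    next
      case False
      then have "act b w \<in> nil_series i" using eigen_nil_part[OF False d] nil_series_down N(3) w by blast
      then show ?thesis using N(2) by blast
    qed
  qed
  moreover have "x = scale 1 x + 0" by simp
  ultimately show ?thesis
    using stable_by_generators[of N x 1 0 B w z] L[OF x_Y0] LO.Lstable_subspace[OF N(1)] B(1) w subspace_0[OF A_subspace] by auto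
qed

lemma module_ops_lin: "h \<in> module_ops \<Longrightarrow> M.lin h"
  unfolding module_ops_def using act_lin M.lin_smult[OF M.lin_id] by auto

lemma module_ops_stable_iff:
  assumes "U.subspace N"
  shows "(\<forall>h\<in>module_ops. M.stable h N) \<longleftrightarrow> (\<forall>z. \<forall>w\<in>N. act z w \<in> N)"
  using assms unfolding module_ops_def M.stable_def by (auto simp: U.subspace_scale)

lemma scale_module_ops: "scaleU c \<in> module_ops"
  unfolding module_ops_def by blast

lemma uniserial_iff_chain: "uniserial \<longleftrightarrow> (UNIV :: 'u set) \<noteq> {0} \<and> M.chain_between module_ops {0} UNIV"
  unfolding uniserial_def by (rule M.uniserial_module_UNIV_iff[OF module_ops_lin scale_module_ops])

end

locale linked_semidirect_module = semidirect_module +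
  fixes m :: nat
  assumes len: "has_nil_length m" and link: "linked" and m1: "m > 1"
begin

lemma nil_series_m: "nil_series m = UNIV" and nil_series_strict: "i < m \<Longrightarrow> nil_series i \<subset> nil_series (Suc i)"
  using len unfolding has_nil_length_def by auto

text \<open>\<open>linked\<close> quantifies over a length of its own; strict growth below the
  length and stagnation from it on identify the two.\<close>

lemma nil_length_unique:
  assumes "has_nil_length m'" shows "m' = m"
proof (rule ccontr)
  assume "m' \<noteq> m"
  then consider "m' < m" | "m < m'" by linarith
  then show False
    using assms nil_series_strict nil_series_m unfolding has_nil_length_def by cases blast+
qed

lemma layer: assumes i: "i < m" shows "LO.layer (nil_series i) (nil_series (Suc i))"
proof -
  obtain m' where m': "has_nil_length m'"
    "\<forall>i\<in>{1..m'}. uniserial_quotient (nil_series i) (nil_series (i - 1)) module_ops"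
    using link unfolding linked_def by blast
  then have "uniserial_quotient (nil_series (Suc i)) (nil_series i) module_ops"
    using nil_length_unique[OF m'(1)] i by (auto dest: bspec[of _ _ "Suc i"])
  then have chain: "M.chain_between module_ops (nil_series i) (nil_series (Suc i))"
    using M.uniserial_quotient_iff[OF nil_series_subspace nil_series_subspace nil_series_mono module_ops_lin _ _ scale_module_ops]
      module_ops_stable_iff[OF nil_series_subspace] nil_series_act by blast
  have L: "LO.Lstable (nil_series j)" for j
    unfolding LO.Lstable_def using nil_series_subspace nil_series_act by blast
  have "N \<subseteq> N' \<or> N' \<subseteq> N"
    if "LO.Lstable N" "LO.Lstable N'" "nil_series i \<subseteq> N" "N \<subseteq> nil_series (Suc i)"
      "nil_series i \<subseteq> N'" "N' \<subseteq> nil_series (Suc i)" for N N'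
    by (rule M.chain_betweenD[OF chain])
      (use that module_ops_stable_iff LO.Lstable_subspace Lstable_between in blast)+
  then show ?thesis unfolding LO.layer_def using L nil_series_strict[OF i] by blast
qed

definition good :: "nat \<Rightarrow> 'b \<Rightarrow> bool" where
  "good i z \<longleftrightarrow> (\<exists>v\<in>nil_series (Suc i). M.cyc (nil_series i) (act z) v = nil_series (Suc i))"

lemma good_scale: assumes "c \<noteq> 0" "good i z" shows "good i (scale c z)"
proof -
  have "act (scale c z) = (\<lambda>u. scaleU c (act z u))" by (simp add: fun_eq_iff act_scale_left)
  then show ?thesis
    using assms M.cyc_scale_operator[OF act_lin assms(1) nil_series_stable_act] unfolding good_def by simp
qed

lemma finite_not_good:
  assumes i: "i < m" and z: "z \<in> Y0" and b: "b \<in> Y0" and good: "good i z"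
  shows "finite {c. \<not> good i (z + scale c b)}"
proof -
  obtain v where v: "v \<in> nil_series (Suc i)" "M.cyc (nil_series i) (act z) v = nil_series (Suc i)"
    using good unfolding good_def by blast
  have eq: "act (z + scale c b) = (\<lambda>u. act z u + scaleU c (act b u))" for c
    by (simp add: fun_eq_iff act_add_left act_scale_left)
  have "finite {c. M.cyc (nil_series i) (\<lambda>u. act z u + scaleU c (act b u)) v \<noteq> nil_series (Suc i)}"
    using layer[OF i] z b v unfolding LO.layer_def by (intro LO.finite_not_cyc) auto
  moreover have "{c. \<not> good i (z + scale c b)} \<subseteq>
      {c. M.cyc (nil_series i) (\<lambda>u. act z u + scaleU c (act b u)) v \<noteq> nil_series (Suc i)}"
    unfolding good_def eq using v(1) by blast
  ultimately show ?thesis by (rule finite_subset[rotated])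
qed

text \<open>Membership in \<open>a0\<close> forces the coefficient of x to vanish, an affine
  equation in \<open>c\<close> with nonzero constant term.\<close>

lemma finite_mem_a0:
  assumes z: "z \<in> Y0" "z \<notin> a0" and b: "b \<in> Y0"
  shows "finite {c. z + scale c b \<in> a0}"
proof -
  obtain \<alpha> a \<beta> a' where f: "z = scale \<alpha> x + a" "a \<in> a0" "b = scale \<beta> x + a'" "a' \<in> a0"
    using z(1) b unfolding Y0_iff by blast
  have \<alpha>: "\<alpha> \<noteq> 0" using f(1,2) z(2) by auto
  have 0: "\<alpha> + c * \<beta> = 0" if "z + scale c b \<in> a0" for c
  proof (rule ccontr)
    assume n: "\<alpha> + c * \<beta> \<noteq> 0"
    have "a + scale c a' \<in> a0" using f(2,4) a0_subspace by (simp add: subspace_add subspace_scale)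
    then have "z + scale c b - (a + scale c a') \<in> a0" by (rule subspace_diff[OF a0_subspace that])
    moreover have "z + scale c b - (a + scale c a') = scale (\<alpha> + c * \<beta>) x"
      unfolding f by (simp add: scale_left_distrib scale_right_distrib)
    ultimately have "scale (\<alpha> + c * \<beta>) x \<in> A" by (simp add: a0_iff)
    then have "scale (inverse (\<alpha> + c * \<beta>)) (scale (\<alpha> + c * \<beta>) x) \<in> A"
      using A_subspace subspace_scale by blast
    then show False using n x_notin by simp
  qed
  have "{c. z + scale c b \<in> a0} \<subseteq> {- \<alpha> / \<beta>}"
  proof
    fix c assume "c \<in> {c. z + scale c b \<in> a0}"
    then have e: "\<alpha> + c * \<beta> = 0" using 0 by blast
    then have "\<beta> \<noteq> 0" using \<alpha> by auto
    moreover have "c * \<beta> = - \<alpha>" using e by (metis add.inverse_unique)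
    ultimately have "c = - \<alpha> / \<beta>" by (metis nonzero_mult_div_cancel_right)
    then show "c \<in> {- \<alpha> / \<beta>}" by blast
  qed
  then show ?thesis using finite_subset by blast
qed

lemma x_notin_a0: "x \<notin> a0"
  using x_notin a0_iff by blast

text \<open>If \<open>a0\<close> is zero, stability under x is stability under all of
  \<open>Y0\<close>, and x serves. Otherwise treat the factors one after another: a \<open>z\<close>
  good for the earlier ones and a \<open>b\<close> good for the next are joined by a line on which
  only finitely many points are bad.\<close>

lemma exists_good:
  assumes "(infinite (UNIV :: 'a set) \<and> perfect_field TYPE('a)) \<or> a0 = {0}"
  shows "\<exists>z\<in>Y0 - a0. \<forall>i<m. good i z"
  using assms
proof
  assume a: "a0 = {0}"
  have "good i x" if i: "i < m" for i unfolding good_def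
  proof (rule LO.exists_cyclic_single[OF layer[OF i]])
    show "act x \<in> act ` Y0" using x_Y0 by blast
    fix N assume N: "M.stable (act x) N"
    show "LO.Lstable N" unfolding LO.Lstable_def
    proof (intro conjI ballI)
      show s: "U.subspace N" using N by (rule M.stable_subspace)
      fix h w assume h: "h \<in> act ` Y0" and w: "w \<in> N"
      then obtain c where "h = act (scale c x)" using a Y0_iff by auto
      then show "h w \<in> N" using M.stable_mem[OF N w] s by (simp add: act_scale_left U.subspace_scale)
    qed
  qed
  then show ?thesis using x_Y0 x_notin_a0 by blast
next
  assume ip: "infinite (UNIV :: 'a set) \<and> perfect_field TYPE('a)"
  have "\<exists>z\<in>Y0 - a0. \<forall>i<k. good i z" if "k \<le> m" for k
    using that
  proof (induction k)
    case 0
    then show ?case using x_Y0 x_notin_a0 by blast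
  next
    case (Suc k)
    then obtain z where z: "z \<in> Y0" "z \<notin> a0" "\<And>i. i < k \<Longrightarrow> good i z" by auto
    have "\<exists>y\<in>act ` Y0. \<exists>v\<in>nil_series (Suc k). M.cyc (nil_series k) y v = nil_series (Suc k)"
      using ip layer[of k] Suc.prems by (intro LO.exists_cyclic) auto
    then obtain b where b: "b \<in> Y0" "good k b" unfolding good_def by blast
    \<comment> \<open>The bad parameters: loss of an earlier factor, membership in
      \<open>a0\<close>, and, since z + c b = c (b + c^-1 z), the inverses of the parameters at
      which \<open>b\<close> is spoiled.\<close>
    let ?B1 = "\<Union>i<k. {c. \<not> good i (z + scale c b)}" and ?B2 = "{c. z + scale c b \<in> a0}"
      and ?B3 = "{c. \<not> good k (b + scale c z)}"
    have fin: "finite (?B1 \<union> ?B2 \<union> inverse ` ?B3 \<union> {0})"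
      using finite_not_good z b finite_mem_a0 Suc.prems by auto
    obtain c where c: "c \<notin> ?B1 \<union> ?B2 \<union> inverse ` ?B3 \<union> {0}"
      using ex_new_if_finite[OF conjunct1[OF ip] fin] by (rule exE)
    have "good k (b + scale (inverse c) z)"
    proof (rule ccontr)
      assume "\<not> good k (b + scale (inverse c) z)"
      then have "inverse (inverse c) \<in> inverse ` ?B3" by blast
      then show False using c by simp
    qed
    then have "good k (scale c (b + scale (inverse c) z))" using c good_scale by simp
    moreover have "scale c (b + scale (inverse c) z) = z + scale c b" using c by (simp add: scale_right_distrib)
    ultimately have "good k (z + scale c b)" by simp
    then have "\<forall>i<Suc k. good i (z + scale c b)" using c by (auto simp: less_Suc_eq)
    moreover have "z + scale c b \<in> Y0 - a0" using c z b Y0_subspace by (simp add: subspace_add subspace_scale)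
    ultimately show ?case by blast
  qed
  then show ?thesis by blast
qed

lemma good_chain:
  assumes i: "i < m" and z: "z \<in> Y0" "good i z"
  shows "M.chain_between {act z} (nil_series i) (nil_series (Suc i))"
  using LO.cyclic_chain_between[OF layer[OF i], of "act z"] z unfolding good_def by blast

text \<open>\<open>b\<close> maps factor i + 2 injectively into factor i + 1, the factors being
  numbered from 1.\<close>

definition injective_at :: "nat \<Rightarrow> 'b \<Rightarrow> bool" where
  "injective_at i b \<longleftrightarrow> (\<forall>w\<in>nil_series (Suc (Suc i)). act b w \<in> nil_series i \<longrightarrow> w \<in> nil_series (Suc i))"

text \<open>The kernels of the eigenvectors on the factor are stable under \<open>z\<close>, so they
  form a chain, and one of least dimension lies in all the others. A vector in every kernel is sent
  to \<open>nil_series i\<close> by all of \<open>nil_part\<close>, hence is zero in the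
  factor.\<close>

lemma exists_injective_at:
  assumes i: "Suc i < m" and z: "z \<in> Y0" "good (Suc i) z"
  shows "\<exists>b\<in>nzeig. injective_at i b"
proof -
  obtain c a where za: "z = scale c x + a" "a \<in> a0" using z(1) unfolding Y0_iff by blast
  define K where "K b = {w\<in>nil_series (Suc (Suc i)). act b w \<in> nil_series i}" for b
  have K: "M.stable (act z) (K b)" "nil_series (Suc i) \<subseteq> K b" "K b \<subseteq> nil_series (Suc (Suc i))" if b: "b \<in> nzeig" for b
  proof -
    obtain d where d: "b \<in> A" "d \<noteq> 0" "bracket x b = scale d b" using b unfolding nzeig_def by blast
    have bn: "b \<in> nil_part" using eigen_nil_part[OF d(2,3)] .
    have "bracket z b = scale (c * d) b" unfolding za using d A_abelian[of a b] za(2)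
      by (simp add: bracket_add_left bracket_scale_left a0_iff)
    then have zb: "act b (act z w) = act z (act b w) - scaleU (c * d) (act b w)" for w
      using act_swap[of z b w] by (simp add: act_scale_left)
    have s: "U.subspace (K b)"
      unfolding K_def by (rule M.subspace_vimage[OF act_lin nil_series_subspace nil_series_subspace])
    moreover have "act z w \<in> K b" if "w \<in> K b" for w
      using that nil_series_act unfolding K_def
      by (auto simp: zb simp del: nil_series.simps intro!: U.subspace_diff U.subspace_scale nil_series_subspace)
    ultimately show "M.stable (act z) (K b)" unfolding M.stable_def by blast
    show "nil_series (Suc i) \<subseteq> K b" using nil_series_mono nil_series_down[OF bn] unfolding K_def by blast
    show "K b \<subseteq> nil_series (Suc (Suc i))" unfolding K_def by blast
  qed
  have "\<exists>b. b \<in> nzeig"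
  proof (rule ccontr)
    assume "\<not> ?thesis"
    then have "nil_series (Suc (Suc i)) \<subseteq> nil_series (Suc i)" using nil_series_SucI by blast
    then show False using nil_series_strict[OF i] by blast
  qed
  then obtain b0 where "b0 \<in> nzeig" by blast
  then have "\<exists>b. b \<in> nzeig \<and> (\<forall>b'. b' \<in> nzeig \<longrightarrow> U.dim (K b) \<le> U.dim (K b'))"
    by (rule ex_has_least_nat)
  then obtain b where b: "b \<in> nzeig" and min: "\<And>b'. b' \<in> nzeig \<Longrightarrow> U.dim (K b) \<le> U.dim (K b')"
    by blast
  have sub: "K b \<subseteq> K b'" if b': "b' \<in> nzeig" for b'
  proof -
    have "K b \<subseteq> K b' \<or> K b' \<subseteq> K b"
      by (rule M.chain_betweenD[OF good_chain[OF i z]])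
        (use K[OF b] K[OF b'] M.stable_subspace in auto)
    moreover have "K b' = K b" if "K b' \<subseteq> K b"
      using that K[OF b] K[OF b'] min[OF b'] M.stable_subspace by (intro M.subspace_dim_equal) auto
    ultimately show ?thesis by blast
  qed
  have "w \<in> nil_series (Suc i)" if "w \<in> K b" for w
    using that sub by (intro nil_series_SucI) (auto simp: K_def simp del: nil_series.simps)
  then show ?thesis using b unfolding injective_at_def K_def by blast
qed

text \<open>If \<open>b w\<close> is too low, then so is b b' w = b' b w; injectivity of
  \<open>b\<close> one level below makes \<open>b' w\<close> too low, and injectivity of
  \<open>b'\<close> finishes.\<close>

lemma injective_at_Suc:
  assumes b: "b \<in> nzeig" "injective_at i b" and b': "b' \<in> nzeig" "injective_at (Suc i) b'"
  shows "injective_at (Suc i) b"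
  unfolding injective_at_def
proof (intro ballI impI)
  have bn: "b \<in> nil_part" "b' \<in> nil_part" "b \<in> A" "b' \<in> A"
    using b(1) b'(1) eigen_nil_part unfolding nzeig_def by auto
  fix w assume w: "w \<in> nil_series (Suc (Suc (Suc i)))" and bw: "act b w \<in> nil_series (Suc i)"
  have "act b (act b' w) = act b' (act b w)" using act_A_commute bn by blast
  also have "\<dots> \<in> nil_series i" by (rule nil_series_down[OF bn(2) bw])
  finally have "act b (act b' w) \<in> nil_series i" .
  moreover have "act b' w \<in> nil_series (Suc (Suc i))" by (rule nil_series_down[OF bn(2) w])
  ultimately have "act b' w \<in> nil_series (Suc i)" using b(2) unfolding injective_at_def by blast
  then show "w \<in> nil_series (Suc (Suc i))" using b'(2) w unfolding injective_at_def by blast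
qed

text \<open>Since \<open>A\<close> is abelian, an eigenvector which is injective on the second nilpotency factor is
  injective on all the later ones.\<close>
lemma exists_y_v:
  assumes "(infinite (UNIV :: 'a set) \<and> perfect_field TYPE('a)) \<or> a0 = {0}"
  shows "\<exists>y v. y \<in> Y0 - a0 \<and> (\<forall>i<m. good i y) \<and> v \<in> A \<and> bracket y v = v \<and> (\<forall>i. Suc i < m \<longrightarrow> injective_at i v)"
proof -
  obtain z where z: "z \<in> Y0" "z \<notin> a0" "\<And>i. i < m \<Longrightarrow> good i z" using exists_good[OF assms] by blast
  obtain c a where za: "z = scale c x + a" "a \<in> a0" using z(1) unfolding Y0_iff by blast
  have c0: "c \<noteq> 0" using za z(2) by auto
  obtain v where v: "v \<in> nzeig" "injective_at 0 v" using exists_injective_at[of 0 z] m1 z by auto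
  obtain d where d: "v \<in> A" "d \<noteq> 0" "bracket x v = scale d v" using v(1) unfolding nzeig_def by blast
  have inj: "Suc i < m \<Longrightarrow> injective_at i v" for i
  proof (induction i)
    case (Suc i)
    obtain b' where "b' \<in> nzeig" "injective_at (Suc i) b'" using exists_injective_at[of "Suc i" z] Suc.prems z by auto
    then show ?case using injective_at_Suc[OF v(1), of i b'] Suc by simp
  qed (rule v(2))
  \<comment> \<open>The part of \<open>z\<close> in \<open>a0\<close> commutes with
    \<open>v\<close>, so \<open>v\<close> has eigenvalue c d for \<open>z\<close>; dividing by it
    makes the eigenvalue 1.\<close>
  define y where "y = scale (inverse (c * d)) z"
  have "bracket z v = scale (c * d) v" unfolding za using d A_abelian[of a v] za(2)
    by (simp add: bracket_add_left bracket_scale_left a0_iff)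
  then have "bracket y v = v" unfolding y_def using c0 d(2)
    by (simp add: bracket_scale_left del: inverse_mult_distrib)
  moreover have "y \<in> Y0" unfolding y_def using z(1) Y0_subspace subspace_scale by blast
  moreover have "y \<notin> a0"
  proof
    assume "y \<in> a0"
    then have "scale (c * d) y \<in> a0" using a0_subspace subspace_scale by blast
    then show False using z(2) c0 d(2) unfolding y_def by (simp del: inverse_mult_distrib)
  qed
  moreover have "good i y" if "i < m" for i
    unfolding y_def by (rule good_scale) (use c0 d(2) z(3)[OF that] in simp_all)
  ultimately show ?thesis using d(1) inj by blast
qed

end

section \<open>The conclusions of the theorem read off from the adapted basis\<close>

section \<open>The adapted basis of a linked module\<close>

lemma (in fd_space) chain_between_mono:
  assumes "chain_between H W V" "H \<subseteq> H'"
  shows "chain_between H' W V"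
  unfolding chain_between_def[of H']
proof (intro allI impI)
  fix N N' assume N: "subspace N" "subspace N'" "\<forall>h\<in>H'. stable h N" "\<forall>h\<in>H'. stable h N'"
    "W \<subseteq> N" "N \<subseteq> V" "W \<subseteq> N'" "N' \<subseteq> V"
  show "N \<subseteq> N' \<or> N' \<subseteq> N"
    by (rule chain_betweenD[OF assms(1) N(1,2) _ _ N(5-8)]) (use N(3,4) assms(2) in blast)+
qed

locale adapted_module = linked_semidirect_module +
  fixes y v :: 'b and p :: "nat \<Rightarrow> 'a poly" and s :: "nat \<Rightarrow> nat" and e :: "nat \<Rightarrow> 'c" and g :: "nat \<Rightarrow> 'c"
  assumes y: "y \<in> Y0" "y \<notin> a0" and v: "v \<in> A" "bracket y v = v"
    and gen: "gen_tower scaleU (act y) (act v) nil_series m p s e g"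
begin

sublocale T: gen_tower scaleU "act y" "act v" nil_series m p s e g
  by (rule gen)

abbreviation "mx \<equiv> matrix_in_basis scaleU T.blist"

lemma y_form: "\<exists>c a. c \<noteq> 0 \<and> a \<in> a0 \<and> y = scale c x + a"
proof -
  obtain c a where ca: "y = scale c x + a" "a \<in> a0" using y(1) unfolding Y0_iff by blast
  then have "c \<noteq> 0" using y(2) by auto
  then show ?thesis using ca by blast
qed

abbreviation "ad \<equiv> eigenspace_in A y"

lemma ad_iff: "u \<in> ad d \<longleftrightarrow> u \<in> A \<and> bracket y u = scale d u"
  unfolding eigenspace_in_def by simp

lemma ad_subspace: "subspace (ad d)"
proof (rule subspaceI)
  show "0 \<in> ad d" using subspace_0[OF A_subspace] by (simp add: ad_iff)
  show "a + b \<in> ad d" if "a \<in> ad d" "b \<in> ad d" for a b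
    using that subspace_add[OF A_subspace] by (simp add: ad_iff bracket_add_right scale_right_distrib)
  show "scale c a \<in> ad d" if "a \<in> ad d" for c a
    using that subspace_scale[OF A_subspace] by (simp add: ad_iff bracket_scale_right mult.commute)
qed

lemma weight_op_act: "u \<in> ad d \<Longrightarrow> T.weight_op d (act u)"
  unfolding T.weight_op_def ad_iff
  using act_lin nil_series_act act_A_commute v(1) act_swap[of y u]
  by (auto simp: act_scale_left simp del: nil_series.simps)

lemma v_nil: "v \<in> bracket_span UNIV UNIV"
  using bracket_nil_part[of y v] v(2) nil_part_eq by simp

lemma act_v_nonzero: "\<exists>w. act v w \<noteq> 0"
proof (rule ccontr)
  assume "\<not> ?thesis"
  then have 0: "act v w \<in> nil_series 0" for w by simp
  have "w \<in> nil_series (Suc 0)" if w: "w \<in> nil_series (Suc (Suc 0))" for w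
    by (rule T.V_inj[of 0, OF _ w 0]) (use m1 in simp)
  then have "nil_series (Suc (Suc 0)) \<subseteq> nil_series (Suc 0)" by blast
  moreover have "Suc 0 < m" using m1 by simp
  ultimately show False using nil_series_strict[of "Suc 0"] by blast
qed

text \<open>As y is a multiple of x plus an element of the abelian ideal, eigenvectors of x in the
  ideal are eigenvectors of y. Those that act nontrivially have a weight below \<open>m\<close>; the
  others are dropped, which is why the equality is one of operators and not of elements.\<close>

lemma act_eq_sum_weights:
  assumes "z \<in> A"
  shows "\<exists>u. (\<forall>j<m. u j \<in> ad (of_nat j)) \<and> (\<forall>w. act z w = (\<Sum>j<m. act (u j) w))"
proof -
  obtain c a where ca: "c \<noteq> 0" "a \<in> a0" "y = scale c x + a" using y_form by blast
  obtain B where B: "span B = A" "\<And>b. b \<in> B \<Longrightarrow> b \<in> A" "\<And>b. b \<in> B \<Longrightarrow> \<exists>d. bracket x b = scale d b"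
    using eigenbasis by blast
  have "z \<in> span B" using assms B by simp
  then show ?thesis
  proof (induction rule: span_induct_alt)
    case base
    show ?case using subspace_0[OF ad_subspace] by (intro exI[of _ "\<lambda>j. 0"]) simp
  next
    case (step k b z)
    then obtain u where u: "\<And>j. j < m \<Longrightarrow> u j \<in> ad (of_nat j)" "\<And>w. act z w = (\<Sum>j<m. act (u j) w)" by blast
    show ?case
    proof (cases "\<forall>w. act b w = 0")
      case True
      then show ?thesis using u by (intro exI[of _ u]) (simp add: act_add_left act_scale_left)
    next
      case False
      obtain d where "bracket x b = scale d b" using B(3) step(1) by blast
      then have "bracket y b = scale (c * d) b" unfolding ca(3) using A_abelian[of a b] ca(2) B(2) step(1)
        by (simp add: bracket_add_left bracket_scale_left a0_iff)
      then have b: "b \<in> ad (c * d)" using B(2) step(1) by (simp add: ad_iff)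
      then obtain l where l: "l < m" "c * d = of_nat l"
        using T.weight_op_nonzero[OF weight_op_act] False by blast
      let ?u = "u(l := u l + scale k b)"
      have "\<forall>j<m. ?u j \<in> ad (of_nat j)" using u(1) b l ad_subspace by (simp add: subspace_add subspace_scale)
      moreover have "act (scale k b + z) w = (\<Sum>j<m. act (?u j) w)" for w
      proof -
        have "(\<Sum>j<m. act (?u j) w) = (\<Sum>j<m. act (u j) w + (if j = l then act (scale k b) w else 0))"
          by (rule sum.cong) (auto simp: act_add_left)
        also have "\<dots> = act z w + act (scale k b) w" using l u(2) by (simp add: sum.distrib)
        finally show ?thesis by (simp add: act_add_left)
      qed
      ultimately show ?thesis by blast
    qed
  qed
qed

lemma act_sum: "act (sum u I) w = (\<Sum>i\<in>I. act (u i) w)"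
  by (induction I rule: infinite_finite_induct) (auto simp: act_add_left)

subsection \<open>The weights\<close>

lemma weights: "1 \<in> {d. \<exists>u\<in>ad d. \<exists>w. act u w \<noteq> 0}"
    "\<forall>d\<in>{d. \<exists>u\<in>ad d. \<exists>w. act u w \<noteq> 0}. \<exists>j<m. d = of_nat j"
proof -
  have "v \<in> ad 1" using v by (simp add: ad_iff)
  then show "1 \<in> {d. \<exists>u\<in>ad d. \<exists>w. act u w \<noteq> 0}" using act_v_nonzero by blast
  show "\<forall>d\<in>{d. \<exists>u\<in>ad d. \<exists>w. act u w \<noteq> 0}. \<exists>j<m. d = of_nat j"
    using T.weight_op_nonzero[OF weight_op_act] by blast
qed

subsection \<open>The matrices\<close>

definition gp :: "nat \<Rightarrow> 'b \<Rightarrow> 'a poly" where "gp j u = T.wpoly j (act u)"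

lemma gp_linear: assumes j: "j < m"
  shows "linear_map_on scale Polynomial.smult (ad (of_nat j)) (gp j)"
  unfolding linear_map_on_def gp_def
proof (intro conjI ballI allI)
  fix u w assume u: "u \<in> ad (of_nat j)" and w: "w \<in> ad (of_nat j)"
  note wu = weight_op_act[OF u] and ww = weight_op_act[OF w]
  have uw: "u + w \<in> ad (of_nat j)" using u w ad_subspace subspace_add by blast
  show "T.wpoly j (act (u + w)) = T.wpoly j (act u) + T.wpoly j (act w)"
  proof (rule T.wpoly_eqI[OF weight_op_act[OF uw] j])
    show "T.wpoly j (act u) + T.wpoly j (act w) \<in> polys_below (T.deg * s (Suc j))"
      using T.wpoly_below[OF wu j] T.wpoly_below[OF ww j] by (simp add: mem_polys_below_iff)
    show "act (u + w) (g (Suc j)) = (act v ^^ j) (poly_op scaleU T.Eop (T.wpoly j (act u) + T.wpoly j (act w)) (g (Suc j)))"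
      using T.wpoly_g[OF wu j] T.wpoly_g[OF ww j]
      by (simp add: act_add_left M.pa_add M.lin_add[OF T.V_funpow_lin])
  qed
next
  fix c u assume u: "u \<in> ad (of_nat j)"
  note wu = weight_op_act[OF u]
  have cu: "scale c u \<in> ad (of_nat j)" using u ad_subspace subspace_scale by blast
  show "T.wpoly j (act (scale c u)) = Polynomial.smult c (T.wpoly j (act u))"
  proof (rule T.wpoly_eqI[OF weight_op_act[OF cu] j])
    show "Polynomial.smult c (T.wpoly j (act u)) \<in> polys_below (T.deg * s (Suc j))"
      using T.wpoly_below[OF wu j] by (simp add: mem_polys_below_iff)
    show "act (scale c u) (g (Suc j)) = (act v ^^ j) (poly_op scaleU T.Eop (Polynomial.smult c (T.wpoly j (act u))) (g (Suc j)))"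
      using T.wpoly_g[OF wu j] by (simp add: act_scale_left M.pa_smult M.lin_scale[OF T.V_funpow_lin])
  qed
qed

lemma gp_below: "j < m \<Longrightarrow> gp j ` ad (of_nat j) \<subseteq> polys_below (T.deg * s (j + 1))"
  unfolding gp_def using T.wpoly_below[OF weight_op_act] by auto

lemma gp_mx: "j < m \<Longrightarrow> u \<in> ad (of_nat j) \<Longrightarrow>
    mx (act u) = matrix_T T.deg m p s ^\<^sub>m j * mat_poly (gp j u) (matrix_E m p s)"
  and gp_mx': "j < m \<Longrightarrow> u \<in> ad (of_nat j) \<Longrightarrow>
    mx (act u) = mat_poly (gp j u) (matrix_E m p s) * matrix_T T.deg m p s ^\<^sub>m j"
  unfolding gp_def using T.mx_weight_op[OF weight_op_act] by blast+

lemma gp_v: "gp 1 v = 1"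
  unfolding gp_def
proof (rule T.wpoly_eqI)
  show "T.weight_op (of_nat 1) (act v)" using weight_op_act[of v 1] v by (simp add: ad_iff)
  show "1 < m" using m1 .
  have "s (Suc 1) \<ge> 1" using T.s_pos[of "Suc 1"] m1 by simp
  then have pos: "T.deg * s (Suc 1) > 0" using T.deg_pos by simp
  show "(1 :: 'a poly) \<in> polys_below (T.deg * s (Suc 1))" unfolding mem_polys_below_iff
  proof (intro allI impI)
    fix k assume "T.deg * s (Suc 1) \<le> k"
    then have "k > 0" using pos by linarith
    then show "coeff (1 :: 'a poly) k = 0" by simp
  qed
  show "act v (g (Suc 1)) = (act v ^^ 1) (poly_op scaleU T.Eop 1 (g (Suc 1)))" by (simp add: T.Eop_lin)
qed

lemma size_total: "T.deg * (\<Sum>i=1..m. s i) = length T.blist"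
proof -
  have "sum_list T.sizes = (\<Sum>i=1..m. T.deg * s i)"
    unfolding T.sizes_def by (subst sum_list_distinct_conv_sum_set) (auto intro!: sum.cong)
  then show ?thesis by (simp add: sum_distrib_left)
qed

lemma mx_act_add: "mx (act (a + b)) = mx (act a) + mx (act b)"
proof -
  have "act (a + b) = (\<lambda>w. act a w + act b w)" by (simp add: fun_eq_iff act_add_left)
  then show ?thesis using T.B.mx_add[of "act a" "act b"] by simp
qed

lemma mx_act_scale: "mx (act (scale c a)) = c \<cdot>\<^sub>m mx (act a)"
proof -
  have "act (scale c a) = (\<lambda>w. scaleU c (act a w))" by (simp add: fun_eq_iff act_scale_left)
  then show ?thesis using T.B.mx_smult[of c "act a"] by simp
qed

lemma mx_act_0: "mx (act 0) = 0\<^sub>m (length T.blist) (length T.blist)"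
proof -
  have "act 0 = (\<lambda>w. 0)" by (simp add: fun_eq_iff)
  then show ?thesis using T.B.mx_zero by simp
qed

lemma mx_act_bracket: "mx (act (bracket a b)) = mx (act a) * mx (act b) - mx (act b) * mx (act a)"
proof -
  have "act (bracket a b) = (\<lambda>w. act a (act b w) + scaleU (- 1) (act b (act a w)))"
    by (simp add: fun_eq_iff act_bracket)
  then have "mx (act (bracket a b)) = mx (\<lambda>w. act a (act b w)) + mx (\<lambda>w. scaleU (- 1) (act b (act a w)))"
    by (simp only: T.B.mx_add)
  also have "\<dots> = mx (act a) * mx (act b) + (- 1) \<cdot>\<^sub>m (mx (act b) * mx (act a))"
    using T.B.mx_smult[of "- 1" "\<lambda>w. act b (act a w)"] T.B.mx_comp[OF act_lin, of a "act b"]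
      T.B.mx_comp[OF act_lin, of b "act a"] by simp
  finally have "mx (act (bracket a b)) = mx (act a) * mx (act b) + (- 1) \<cdot>\<^sub>m (mx (act b) * mx (act a))" .
  then show ?thesis using T.B.mx_carrier by (intro eq_matI) auto
qed

lemma mat_subspace_mx: "subspace W \<Longrightarrow> mat_subspace (length T.blist) {mx (act u) |u. u \<in> W}"
  unfolding mat_subspace_def
proof (intro conjI ballI allI)
  assume W: "subspace W"
  show "{mx (act u) |u. u \<in> W} \<subseteq> carrier_mat (length T.blist) (length T.blist)" using T.B.mx_carrier by auto
  show "0\<^sub>m (length T.blist) (length T.blist) \<in> {mx (act u) |u. u \<in> W}"
    using mx_act_0 subspace_0[OF W] by (intro CollectI exI[of _ 0]) simp
  fix P assume "P \<in> {mx (act u) |u. u \<in> W}"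
  then obtain a where a: "P = mx (act a)" "a \<in> W" by blast
  show "c \<cdot>\<^sub>m P \<in> {mx (act u) |u. u \<in> W}" for c
    using a mx_act_scale[of c a] subspace_scale[OF W] by (intro CollectI exI[of _ "scale c a"]) simp
  fix Q assume "Q \<in> {mx (act u) |u. u \<in> W}"
  then obtain b where b: "Q = mx (act b)" "b \<in> W" by blast
  show "P + Q \<in> {mx (act u) |u. u \<in> W}"
    using a b mx_act_add[of a b] subspace_add[OF W] by (intro CollectI exI[of _ "a + b"]) simp
qed

lemma weight_image_eq:
  assumes "j < m"
  shows "{P * matrix_T T.deg m p s ^\<^sub>m j |P. P \<in> {mat_poly (gp j u) (matrix_E m p s) |u. u \<in> ad (of_nat j)}} =
    {mx (act u) |u. u \<in> ad (of_nat j)}"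
proof (intro equalityI subsetI)
  fix Q assume "Q \<in> {P * matrix_T T.deg m p s ^\<^sub>m j |P. P \<in> {mat_poly (gp j u) (matrix_E m p s) |u. u \<in> ad (of_nat j)}}"
  then obtain u where u: "u \<in> ad (of_nat j)" "Q = mat_poly (gp j u) (matrix_E m p s) * matrix_T T.deg m p s ^\<^sub>m j"
    by blast
  then have "Q = mx (act u)" using gp_mx'[OF assms] by simp
  then show "Q \<in> {mx (act u) |u. u \<in> ad (of_nat j)}" using u(1) by blast
next
  fix Q assume "Q \<in> {mx (act u) |u. u \<in> ad (of_nat j)}"
  then obtain u where u: "u \<in> ad (of_nat j)" "Q = mx (act u)" by blast
  then have "Q = mat_poly (gp j u) (matrix_E m p s) * matrix_T T.deg m p s ^\<^sub>m j" using gp_mx'[OF assms] by simp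
  then show "Q \<in> {P * matrix_T T.deg m p s ^\<^sub>m j |P. P \<in> {mat_poly (gp j u) (matrix_E m p s) |u. u \<in> ad (of_nat j)}}"
    using u(1) by blast
qed

lemma mat_sum_below_mx:
  assumes "\<And>j. j < m \<Longrightarrow> P j = mx (act (u j))"
  shows "mat_sum_below (length T.blist) m P = mx (\<lambda>w. \<Sum>j<m. act (u j) w)"
  by (rule eq_matI) (simp_all add: mat_sum_below_def assms T.B.mx_index T.B.coord_sum del: T.length_blist)

text \<open>The summands add up to the image of the ideal by \<open>act_eq_sum_weights\<close>. The
  sum is direct because different weights move a component to different components.\<close>

lemma direct_sum:
  "mat_direct_sum (length T.blist) m (\<lambda>j. {P * matrix_T T.deg m p s ^\<^sub>m j |P.
      P \<in> {mat_poly (gp j u) (matrix_E m p s) |u. u \<in> ad (of_nat j)}}) {mx (act z) |z. z \<in> A}"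
  unfolding mat_direct_sum_def
proof (intro conjI allI impI)
  let ?W = "\<lambda>j. {P * matrix_T T.deg m p s ^\<^sub>m j |P. P \<in> {mat_poly (gp j u) (matrix_E m p s) |u. u \<in> ad (of_nat j)}}"
  show "mat_subspace (length T.blist) (?W j)" if "j < m" for j
    unfolding weight_image_eq[OF that] by (rule mat_subspace_mx[OF ad_subspace])
  have choose: "\<exists>u. \<forall>j<m. u j \<in> ad (of_nat j) \<and> P j = mx (act (u j))" if P: "\<forall>j<m. P j \<in> ?W j" for P
  proof -
    have "\<forall>j. \<exists>u. j < m \<longrightarrow> u \<in> ad (of_nat j) \<and> P j = mx (act u)"
      using P weight_image_eq by blast
    then show ?thesis by metis
  qed
  show "{mx (act z) |z. z \<in> A} = {mat_sum_below (length T.blist) m P |P. \<forall>j<m. P j \<in> ?W j}"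
  proof (intro equalityI subsetI)
    fix Q assume "Q \<in> {mx (act z) |z. z \<in> A}"
    then obtain z where z: "Q = mx (act z)" "z \<in> A" by blast
    obtain u where u: "\<And>j. j < m \<Longrightarrow> u j \<in> ad (of_nat j)" "\<And>w. act z w = (\<Sum>j<m. act (u j) w)"
      using act_eq_sum_weights[OF z(2)] by blast
    have "act z = (\<lambda>w. \<Sum>j<m. act (u j) w)" using u(2) by blast
    then have "Q = mat_sum_below (length T.blist) m (\<lambda>j. mx (act (u j)))"
      using mat_sum_below_mx[of "\<lambda>j. mx (act (u j))" u] z(1) by simp
    moreover have "\<forall>j<m. mx (act (u j)) \<in> ?W j" using u(1) weight_image_eq by blast
    ultimately show "Q \<in> {mat_sum_below (length T.blist) m P |P. \<forall>j<m. P j \<in> ?W j}" by blast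
  next
    fix Q assume "Q \<in> {mat_sum_below (length T.blist) m P |P. \<forall>j<m. P j \<in> ?W j}"
    then obtain P where P: "Q = mat_sum_below (length T.blist) m P" "\<forall>j<m. P j \<in> ?W j" by blast
    obtain u where u: "\<And>j. j < m \<Longrightarrow> u j \<in> ad (of_nat j)" "\<And>j. j < m \<Longrightarrow> P j = mx (act (u j))"
      using choose[OF P(2)] by blast
    have "act (\<Sum>j<m. u j) = (\<lambda>w. \<Sum>j<m. act (u j) w)" using act_sum by blast
    then have "Q = mx (act (\<Sum>j<m. u j))" using P(1) mat_sum_below_mx[of P u] u(2) by simp
    moreover have "(\<Sum>j<m. u j) \<in> A" by (rule subspace_sum[OF A_subspace]) (use u(1) in \<open>auto simp: ad_iff\<close>)
    ultimately show "Q \<in> {mx (act z) |z. z \<in> A}" by blast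
  qed
  fix P j assume P: "(\<forall>j<m. P j \<in> ?W j) \<and> mat_sum_below (length T.blist) m P = 0\<^sub>m (length T.blist) (length T.blist)"
    and j: "j < m"
  obtain u where u: "\<And>j. j < m \<Longrightarrow> u j \<in> ad (of_nat j)" "\<And>j. j < m \<Longrightarrow> P j = mx (act (u j))"
    using choose P by blast
  have "act (\<Sum>j<m. u j) = (\<lambda>w. \<Sum>j<m. act (u j) w)" using act_sum by blast
  then have "mx (act (\<Sum>j<m. u j)) = mx (\<lambda>w. 0)"
    using mat_sum_below_mx[of P u] u(2) P T.B.mx_zero by metis
  then have 0: "(\<Sum>j<m. act (u j) w) = 0" for w
    using T.B.mx_inject[OF act_lin M.lin_zero] act_sum[of u "{..<m}" w] by metis
  have "act (u j) w = 0" for w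
    by (rule T.weight_ops_independent[of "\<lambda>j. act (u j)", OF weight_op_act[OF u(1)] 0 j])
  then have "act (u j) = (\<lambda>w. 0)" by blast
  then show "P j = 0\<^sub>m (length T.blist) (length T.blist)" using u(2)[OF j] T.B.mx_zero by simp
qed

lemma decomp_y: "\<exists>c. \<exists>u\<in>A. z = scale c y + u"
proof -
  obtain c a where ca: "c \<noteq> 0" "a \<in> a0" "y = scale c x + a" using y_form by blast
  obtain k u where z: "z = scale k x + u" "u \<in> A" using decomp by blast
  have "scale (k / c) y = scale k x + scale (k / c) a" unfolding ca(3) using ca(1) by (simp add: scale_right_distrib)
  then have "z = scale (k / c) y + (u - scale (k / c) a)" using z(1) by simp
  moreover have "u - scale (k / c) a \<in> A" using z(2) ca(2) A_subspace
    by (simp add: a0_iff subspace_diff subspace_scale)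
  ultimately show ?thesis by blast
qed

lemma semidirect_sum:
  "mat_semidirect (length T.blist) (matrix_A m p s) {mx (act z) |z. z \<in> A} {mx (act z) |z. True}"
  unfolding mat_semidirect_def
proof (intro conjI)
  let ?N = "{mx (act z) |z. z \<in> A}"
  show "matrix_A m p s \<in> carrier_mat (length T.blist) (length T.blist)"
    unfolding T.mx_Y[symmetric] by (rule T.B.mx_carrier)
  show "mat_subspace (length T.blist) ?N" by (rule mat_subspace_mx[OF A_subspace])
  show "matrix_A m p s \<notin> ?N"
  proof
    assume "matrix_A m p s \<in> ?N"
    then obtain u where u: "u \<in> A" "mx (act y) = mx (act u)" unfolding T.mx_Y[symmetric] by blast
    then have yu: "act y w = act u w" for w using T.B.mx_inject[OF act_lin act_lin] by blast
    \<comment> \<open>If \<open>y\<close> acted as an element of the abelian ideal it would commute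
      with the action of \<open>v\<close>, and [y, v] = v would make \<open>v\<close> act as
      zero.\<close>
    have "act v w = 0" for w
    proof -
      have "act u (act v w) = act v (act u w) + act v w" using T.twist[of w] yu by simp
      then show ?thesis using act_A_commute[OF u(1) v(1), of w] by simp
    qed
    then show False using act_v_nonzero by blast
  qed
  show "{mx (act z) |z. True} = {c \<cdot>\<^sub>m matrix_A m p s + P |c P. P \<in> ?N}"
  proof (intro equalityI subsetI)
    fix Q assume "Q \<in> {mx (act z) |z. True}"
    then obtain z where z: "Q = mx (act z)" by blast
    obtain c u where cu: "u \<in> A" "z = scale c y + u" using decomp_y by blast
    have "Q = c \<cdot>\<^sub>m matrix_A m p s + mx (act u)" unfolding z cu(2) mx_act_add mx_act_scale T.mx_Y ..
    then show "Q \<in> {c \<cdot>\<^sub>m matrix_A m p s + P |c P. P \<in> ?N}" using cu(1) by blast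
  next
    fix Q assume "Q \<in> {c \<cdot>\<^sub>m matrix_A m p s + P |c P. P \<in> ?N}"
    then obtain c u where "Q = c \<cdot>\<^sub>m matrix_A m p s + mx (act u)" by blast
    then have "Q = mx (act (scale c y + u))" unfolding mx_act_add mx_act_scale T.mx_Y .
    then show "Q \<in> {mx (act z) |z. True}" by blast
  qed
  show "\<forall>P\<in>{mx (act z) |z. True}. \<forall>Q\<in>?N. P * Q - Q * P \<in> ?N"
  proof (intro ballI)
    fix P Q assume "P \<in> {mx (act z) |z. True}" "Q \<in> ?N"
    then obtain z u where zu: "P = mx (act z)" "Q = mx (act u)" "u \<in> A" by blast
    have "P * Q - Q * P = mx (act (bracket z u))" unfolding zu(1,2) by (rule mx_act_bracket[symmetric])
    then show "P * Q - Q * P \<in> ?N" using A_ideal[OF zu(3)] by blast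
  qed
qed

subsection \<open>Uniseriality and semisimplicity\<close>

lemma stable_module_ops:
  assumes N: "M.stable (act y) N" "\<And>d u. T.weight_op d u \<Longrightarrow> M.stable u N" and h: "h \<in> module_ops"
  shows "M.stable h N"
proof -
  have s: "U.subspace N" using N(1) by (rule M.stable_subspace)
  have actA: "act u w \<in> N" if u: "u \<in> A" and w: "w \<in> N" for u w
  proof -
    obtain f where f: "\<And>j. j < m \<Longrightarrow> f j \<in> ad (of_nat j)" "\<And>w. act u w = (\<Sum>j<m. act (f j) w)"
      using act_eq_sum_weights[OF u] by blast
    show ?thesis unfolding f(2)
    proof (rule U.subspace_sum[OF s])
      fix j assume "j \<in> {..<m}"
      then have "f j \<in> ad (of_nat j)" using f(1) by simp
      then show "act (f j) w \<in> N" using M.stable_mem[OF N(2)[OF weight_op_act] w] by blast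
    qed
  qed
  have "act z w \<in> N" if w: "w \<in> N" for z w
  proof -
    obtain c u where cu: "u \<in> A" "z = scale c y + u" using decomp_y by blast
    show ?thesis using actA[OF cu(1) w] M.stable_mem[OF N(1) w] s unfolding cu(2)
      by (simp add: act_add_left act_scale_left U.subspace_add U.subspace_scale)
  qed
  then show ?thesis using module_ops_stable_iff[OF s] h by blast
qed

text \<open>\<open>not_chain\<close> excludes s_1 > 1, and the remaining exponents are at least 1
  and at most s_1. Conversely, every submodule is a term of the nilpotency series.\<close>

lemma uniserial_iff: "uniserial \<longleftrightarrow> (\<forall>i\<in>{1..m}. s i = 1)"
proof
  assume us: "uniserial"
  have "s 1 = 1"
  proof (rule ccontr)
    assume "s 1 \<noteq> 1"
    then obtain N where N: "M.stable (act y) N" "\<And>d u. T.weight_op d u \<Longrightarrow> M.stable u N"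
      "\<not> N \<subseteq> nil_series 1" "\<not> nil_series 1 \<subseteq> N" using T.not_chain by blast
    have "N \<subseteq> nil_series 1 \<or> nil_series 1 \<subseteq> N"
    proof (rule M.chain_betweenD[of module_ops "{0}" UNIV])
      show "M.chain_between module_ops {0} UNIV" using us uniserial_iff_chain by blast
      show "U.subspace N" by (rule M.stable_subspace[OF N(1)])
      show "U.subspace (nil_series 1)" by (rule nil_series_subspace)
      show "\<forall>h\<in>module_ops. M.stable h N" using stable_module_ops[OF N(1)] N(2) by blast
      show "\<forall>h\<in>module_ops. M.stable h (nil_series 1)"
        using module_ops_stable_iff[OF nil_series_subspace] nil_series_act by blast
      show "{0} \<subseteq> N" using U.subspace_0[OF M.stable_subspace[OF N(1)]] by blast
      show "{0} \<subseteq> nil_series 1" using U.subspace_0[OF nil_series_subspace] by blast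
    qed auto
    then show False using N(3,4) by blast
  qed
  then show "\<forall>i\<in>{1..m}. s i = 1"
    using T.s_antimono[of 1] T.s_pos by (metis atLeastAtMost_iff le_antisym le_refl)
next
  assume s1: "\<forall>i\<in>{1..m}. s i = 1"
  have "M.chain_between module_ops {0} UNIV" unfolding M.chain_between_def
  proof (intro allI impI)
    have ops: "act z \<in> module_ops" for z unfolding module_ops_def by blast
    fix N N' assume N: "\<forall>h\<in>module_ops. M.stable h N" "\<forall>h\<in>module_ops. M.stable h N'"
    then obtain k k' where k: "k \<le> m" "N = nil_series k" "k' \<le> m" "N' = nil_series k'"
      using T.simple_components_chain[of N] T.simple_components_chain[of N'] s1 ops by metis
    then show "N \<subseteq> N' \<or> N' \<subseteq> N" using T.Us_le by (metis nat_le_linear)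
  qed
  moreover have "(UNIV :: 'c set) \<noteq> {0}" using act_v_nonzero by (metis UNIV_I singletonD)
  ultimately show "uniserial" using uniserial_iff_chain by blast
qed

text \<open>Write y = c x + a. Once \<open>a\<close> acts as a scalar, x and y have the same stable
  subspaces. If the degree is 1, \<open>a\<close> has weight 0 and acts as a polynomial in E of
  degree below 1, that is, as a constant.\<close>

lemma semisimple_x:
  assumes s1: "\<forall>i\<in>{1..m}. s i = 1" and cases: "a0 = {0} \<or> T.deg = 1"
  shows "semisimple_operator scaleU (act x)"
proof -
  obtain c a where ca: "c \<noteq> 0" "a \<in> a0" "y = scale c x + a" using y_form by blast
  have "\<exists>k. \<forall>w. act a w = scaleU k w"
    using cases
  proof
    assume "a0 = {0}"
    then show ?thesis using ca(2) by (intro exI[of _ 0]) simp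
  next
    assume d: "T.deg = 1"
    have "bracket a x = 0" using ca(2) bracket_anti[of a x] a0_iff by simp
    then have "bracket y a = 0" unfolding ca(3) using ca(2) by (simp add: bracket_add_left bracket_scale_left a0_iff bracket_self)
    then have a: "a \<in> ad (of_nat 0)" using ca(2) by (simp add: ad_iff a0_iff)
    have m0: "0 < m" using m1 by simp
    have "T.wpoly 0 (act a) \<in> polys_below 1"
      using T.wpoly_below[OF weight_op_act[OF a] m0] d s1 m0 by simp
    then have "degree (T.wpoly 0 (act a)) = 0" by (simp add: mem_polys_below_iff degree_le le_zero_eq[symmetric] del: le_zero_eq)
    then obtain k where "T.wpoly 0 (act a) = [:k:]" by (metis degree_eq_zeroE)
    then have "act a w = scaleU k w" for w
      using T.wpoly_eq[OF weight_op_act[OF a] m0, of w] T.Eop_lin by simp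
    then show ?thesis by blast
  qed
  then obtain k where k: "\<And>w. act a w = scaleU k w" by blast
  have yw: "act y w = scaleU c (act x w) + scaleU k w" for w
    unfolding ca(3) by (simp add: act_add_left act_scale_left k)
  have xw: "act x w = scaleU (inverse c) (act y w - scaleU k w)" for w
    using ca(1) by (simp add: yw)
  have inv: "act x ` W \<subseteq> W \<longleftrightarrow> act y ` W \<subseteq> W" if W: "U.subspace W" for W
  proof
    assume "act x ` W \<subseteq> W"
    then show "act y ` W \<subseteq> W" using W by (auto simp: yw intro!: U.subspace_add U.subspace_scale)
  next
    assume "act y ` W \<subseteq> W"
    then show "act x ` W \<subseteq> W" using W by (auto simp: xw intro!: U.subspace_diff U.subspace_scale)
  qed
  have "semisimple_operator scaleU (act y)" using T.semisimple_Y s1 by blast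
  then show ?thesis unfolding semisimple_operator_def using inv by metis
qed

end

context linked_semidirect_module
begin

text \<open>The polynomials and exponents are arbitrary here; each given isomorphism supplies a
  generator of its factor. So the conclusions hold for all descriptions of the factors.\<close>

lemma factor_data_tower:
  assumes y: "y \<in> Y0" "\<forall>i<m. good i y" and v: "v \<in> A" "bracket y v = v" "\<forall>i. Suc i < m \<longrightarrow> injective_at i v"
    and data: "\<forall>i\<in>{1..m}. lead_coeff (p i) = 1 \<and> irreducible (p i) \<and>
      quotient_iso_cyclic scaleU (act y) (nil_series i) (nil_series (i - 1)) (p i ^ s i)"
  shows "\<exists>e. tower scaleU (act y) (act v) nil_series m p s e"
proof -
  have "\<forall>i\<in>{1..m}. \<exists>w\<in>nil_series i. M.cyc (nil_series (i - 1)) (act y) w = nil_series i \<and>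
      (\<forall>f. poly_op scaleU (act y) f w \<in> nil_series (i - 1) \<longleftrightarrow> p i ^ s i dvd f)"
  proof
    fix i assume i: "i \<in> {1..m}"
    have "nil_series (i - 1) \<subseteq> nil_series i" using nil_series_mono[of "i - 1"] i by (simp del: nil_series.simps)
    then show "\<exists>w\<in>nil_series i. M.cyc (nil_series (i - 1)) (act y) w = nil_series i \<and>
      (\<forall>f. poly_op scaleU (act y) f w \<in> nil_series (i - 1) \<longleftrightarrow> p i ^ s i dvd f)"
      using data i M.quotient_iso_cyclic_iff[OF act_lin nil_series_stable_act nil_series_stable_act] by blast
  qed
  then obtain e where e: "\<And>i. i \<in> {1..m} \<Longrightarrow> e i \<in> nil_series i"
    "\<And>i. i \<in> {1..m} \<Longrightarrow> M.cyc (nil_series (i - 1)) (act y) (e i) = nil_series i"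
    "\<And>i f. i \<in> {1..m} \<Longrightarrow> poly_op scaleU (act y) f (e i) \<in> nil_series (i - 1) \<longleftrightarrow> p i ^ s i dvd f"
    by metis
  have vn: "v \<in> nil_part" using bracket_nil_part[of y v] v(2) by simp
  have "tower scaleU (act y) (act v) nil_series m p s e"
  proof
    show "act y (act v w) = act v (act y w) + act v w" for w using act_swap[of y v w] v(2) by simp
    show "nil_series i \<subset> nil_series (Suc i)" if "i < m" for i using nil_series_strict[OF that] .
    show "act v w \<in> nil_series i" if "w \<in> nil_series (Suc i)" for i w using nil_series_down[OF vn that] .
    show "w \<in> nil_series (Suc i)" if "Suc i < m" "w \<in> nil_series (Suc (Suc i))" "act v w \<in> nil_series i" for i w
      using v(3) that unfolding injective_at_def by blast
  qed (use act_lin m1 nil_series_m nil_series_stable_act data e in auto)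
  then show ?thesis by blast
qed

lemma factor_uniserial:
  assumes y: "y \<in> Y0" "good i y" and i: "i < m"
  shows "uniserial_quotient (nil_series (Suc i)) (nil_series i) (range (poly_op scaleU (act y)))"
proof -
  have st: "M.stable (poly_op scaleU (act y) f) (nil_series j)" for f j
    using M.stable_pa[OF act_lin nil_series_stable_act] nil_series_subspace unfolding M.stable_def by blast
  have sc: "scaleU c \<in> range (poly_op scaleU (act y))" for c
  proof -
    have "scaleU c = poly_op scaleU (act y) [:c:]" using act_lin by (simp add: fun_eq_iff)
    then show ?thesis by blast
  qed
  have "act y = poly_op scaleU (act y) [:0, 1:]" using M.pa_X[OF act_lin] by (simp add: fun_eq_iff)
  then have "{act y} \<subseteq> range (poly_op scaleU (act y))" by blast
  then have "M.chain_between (range (poly_op scaleU (act y))) (nil_series i) (nil_series (Suc i))"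
    by (rule M.chain_between_mono[OF good_chain[OF i y]])
  moreover have "nil_series i \<noteq> nil_series (Suc i)" using nil_series_strict[OF i] by blast
  moreover have "uniserial_quotient (nil_series (Suc i)) (nil_series i) (range (poly_op scaleU (act y))) \<longleftrightarrow>
      nil_series i \<noteq> nil_series (Suc i) \<and>
      M.chain_between (range (poly_op scaleU (act y))) (nil_series i) (nil_series (Suc i))"
    by (rule M.uniserial_quotient_iff[OF nil_series_subspace nil_series_subspace nil_series_mono])
      (use st sc M.lin_pa[OF act_lin] in blast)+
  ultimately show ?thesis by blast
qed

lemma exists_factor_data:
  assumes y: "y \<in> Y0" "\<forall>i<m. good i y"
  shows "\<exists>p s. \<forall>i\<in>{1..m}. lead_coeff (p i) = 1 \<and> irreducible (p i) \<and>
      quotient_iso_cyclic scaleU (act y) (nil_series i) (nil_series (i - 1)) (p i ^ s i)"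
proof -
  have "\<exists>p s. lead_coeff p = 1 \<and> irreducible p \<and>
      quotient_iso_cyclic scaleU (act y) (nil_series i) (nil_series (i - 1)) (p ^ s)" if i: "i \<in> {1..m}" for i
  proof -
    obtain k where k: "i = Suc k" "k < m" using i by (cases i) auto
    obtain w where w: "w \<in> nil_series (Suc k)" "M.cyc (nil_series k) (act y) w = nil_series (Suc k)"
      using y(2) k(2) unfolding good_def by blast
    obtain p s where ps: "lead_coeff p = 1" "irreducible p"
      "\<forall>f. poly_op scaleU (act y) f w \<in> nil_series k \<longleftrightarrow> p ^ s dvd f"
      using M.cyclic_factor[OF act_lin nil_series_stable_act nil_series_stable_act nil_series_strict[OF k(2)]
        good_chain[OF k(2) y(1)] w] y(2) k(2) by blast
    then have "quotient_iso_cyclic scaleU (act y) (nil_series (Suc k)) (nil_series k) (p ^ s)"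
      using w M.quotient_iso_cyclic_iff[OF act_lin nil_series_stable_act nil_series_stable_act nil_series_mono] by blast
    then show ?thesis using ps k(1) by auto
  qed
  then show ?thesis by metis
qed

end

text \<open>In characteristic zero a nonzero shift changes the second highest coefficient; otherwise
  the characteristic is prime and the hypothesis applies.\<close>

lemma trivial_stabilizer:
  fixes p :: "'f::field poly"
  assumes "prime CHAR('f) \<longrightarrow> {c. p \<circ>\<^sub>p [:c, 1:] = p} = {0}" and p: "degree p > 0" "lead_coeff p = 1"
    and eq: "p \<circ>\<^sub>p [:c, 1:] = p"
  shows "c = 0"
proof (cases "CHAR('f) = 0")
  case False
  then have "prime CHAR('f)" by (simp add: prime_CHAR_semidom)
  then show ?thesis using assms(1) eq by blast
next
  case True
  obtain n where n: "degree p = Suc n" using p(1) by (cases "degree p") auto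
  have "of_nat (Suc n) * c = 0" using coeff_pcompose_shift_penultimate[OF n, of c] eq p(2) by simp
  moreover have "(of_nat (Suc n) :: 'f) \<noteq> 0" unfolding of_nat_eq_0_iff_char_dvd using True by simp
  ultimately show ?thesis by simp
qed

text \<open>A difference of numbers below \<open>m\<close> that vanishes in the field is divisible
  by the characteristic, hence zero.\<close>

lemma of_nat_inj_below_char:
  assumes c: "prime CHAR('f::field) \<longrightarrow> CHAR('f) \<ge> m" and ij: "i < m" "j < m" and eq: "of_nat i = (of_nat j :: 'f)"
  shows "i = j"
proof -
  have "a = b" if "a \<le> b" "b < m" "of_nat a = (of_nat b :: 'f)" for a b
  proof -
    have "(of_nat (b - a) :: 'f) = 0" using that by (simp add: of_nat_diff)
    then have d: "CHAR('f) dvd b - a" by (simp add: of_nat_eq_0_iff_char_dvd)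
    show ?thesis
    proof (cases "CHAR('f) = 0")
      case False
      then have "CHAR('f) \<ge> m" using c by (simp add: prime_CHAR_semidom)
      have "b - a = 0"
      proof (rule ccontr)
        assume "b - a \<noteq> 0"
        then have "CHAR('f) \<le> b - a" using d by (intro dvd_imp_le) auto
        then show False using \<open>CHAR('f) \<ge> m\<close> that(2) by simp
      qed
      then show ?thesis using that(1) by simp
    qed (use d that in simp)
  qed
  then show ?thesis using ij eq by (metis nat_le_linear)
qed

theorem theorem3p14:
  fixes sG :: "'f::field \<Rightarrow> 'g::ab_group_add \<Rightarrow> 'g"
    and br :: "'g \<Rightarrow> 'g \<Rightarrow> 'g"
    and sU :: "'f \<Rightarrow> 'u::ab_group_add \<Rightarrow> 'u"
    and act :: "'g \<Rightarrow> 'u \<Rightarrow> 'u"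
    and x :: 'g and \<aa> \<nn> \<aa>0 :: "'g set" and m :: nat
    and Us :: "nat \<Rightarrow> 'u set"
  assumes "lie_algebra sG br"
    and "lie_algebra.is_semidirect sG br x \<aa>"
    and "lie_algebra.abelian br \<aa>"
    and "lie_algebra.ad_diagonalizable_on sG br x \<aa>"
    and n_def: "\<nn> = lie_algebra.bracket_span sG br UNIV UNIV"
    and a0_def: "\<aa>0 = lie_algebra.eigenspace_in sG br \<aa> x 0"
    and "(infinite (UNIV :: 'f set) \<and> perfect_field TYPE('f)) \<or> \<aa>0 = {0}"
    and "lie_module sG br sU act"
    and "lie_module.linked sG br sU act"
    and "lie_module.has_nil_length sG br act m"
    and "m > 1"
    and Us_def: "Us = lie_module.nil_series sG br act"
  shows "\<exists>y \<in> Modules.module.span sG (insert x \<aa>0) - \<aa>0.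
    (\<forall>i\<in>{1..m}. uniserial_quotient (Us i) (Us (i - 1)) (range (poly_op sU (act y)))) \<and>
    (let is_factor_data = (\<lambda>(p :: nat \<Rightarrow> 'f poly) (s :: nat \<Rightarrow> nat). \<forall>i\<in>{1..m}.
           lead_coeff (p i) = 1 \<and> irreducible (p i) \<and>
           quotient_iso_cyclic sU (act y) (Us i) (Us (i - 1)) (p i ^ s i))
     in
      (\<exists>p s. is_factor_data p s) \<and>
      (\<forall>p s. is_factor_data p s \<longrightarrow>
        (\<exists>d. (\<forall>i\<in>{1..m}. degree (p i) = d) \<and>
             (\<forall>i\<in>{1..m}. p i = p 1 \<circ>\<^sub>p [:of_nat (i - 1), 1:]) \<and>
             (\<forall>i\<in>{1..<m}. s i \<ge> s (i + 1)) \<and>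
          ((prime CHAR('f) \<longrightarrow> CHAR('f) \<ge> m \<and> {\<gamma>. p 1 \<circ>\<^sub>p [:\<gamma>, 1:] = p 1} = {0}) \<longrightarrow>
            (let a\<delta> = lie_algebra.eigenspace_in sG br \<aa> y;
                 S = {\<delta>. \<exists>u\<in>a\<delta> \<delta>. \<exists>w. act u w \<noteq> 0};
                 A = matrix_A m p s; E = matrix_E m p s; T = matrix_T d m p s;
                 t = d * (\<Sum>i=1..m. s i)
             in
              (1 \<in> S \<and> (\<forall>\<delta>\<in>S. \<exists>j<m. \<delta> = of_nat j)) \<and>
              (\<exists>bs. is_basis_list sU bs \<and>
                 matrix_in_basis sU bs (act y) = A \<and>
                 (\<exists>v\<in>\<nn>. v \<noteq> 0 \<and> br y v = v \<and> matrix_in_basis sU bs (act v) = T \<and>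
                   (\<exists>g :: nat \<Rightarrow> 'g \<Rightarrow> 'f poly.
                     (\<forall>j<m. linear_map_on sG Polynomial.smult (a\<delta> (of_nat j)) (g j) \<and>
                            g j ` a\<delta> (of_nat j) \<subseteq> polys_below (d * s (j + 1)) \<and>
                            (\<forall>u\<in>a\<delta> (of_nat j).
                               matrix_in_basis sU bs (act u) = T ^\<^sub>m j * mat_poly (g j u) E)) \<and>
                     g 1 v = 1 \<and>
                     (let \<E> = (\<lambda>j. {mat_poly (g j u) E |u. u \<in> a\<delta> (of_nat j)}) in
                      \<exists>N. mat_direct_sum t m (\<lambda>j. {M * T ^\<^sub>m j |M. M \<in> \<E> j}) N \<and>
                          mat_semidirect t A N {matrix_in_basis sU bs (act z) |z. True})))) \<and>
              (lie_module.uniserial sU act \<longleftrightarrow> (\<forall>i\<in>{1..m}. s i = 1)) \<and>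
              ((\<forall>i\<in>{1..m}. s i = 1) \<longrightarrow>
                 semisimple_operator sU (act y) \<and>
                 (\<aa>0 = {0} \<or> d = 1 \<longrightarrow> semisimple_operator sU (act x))))))))"
proof -
  interpret semidirect_module sG br sU act x \<aa>
    by (rule semidirect_module.intro[OF assms(8)], rule semidirect_module_axioms.intro) (fact assms(2,3,4))+
  interpret linked_semidirect_module sG br sU act x \<aa> m
    by (rule linked_semidirect_module.intro[OF semidirect_module_axioms],
      rule linked_semidirect_module_axioms.intro) (fact assms(9,10,11))+
  have a0: "\<aa>0 = a0" unfolding a0_def by (rule assms(6))
  have Us: "Us = nil_series" by (rule assms(12))
  \<comment> \<open>Both are fixed before any \<open>p\<close> and \<open>s\<close>, so the same
    \<open>y\<close> serves all descriptions of the factors.\<close>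
  obtain y v where y: "y \<in> Y0" "y \<notin> a0" "\<forall>i<m. good i y"
    and v: "v \<in> \<aa>" "br y v = v" "\<forall>i. Suc i < m \<longrightarrow> injective_at i v"
    using exists_y_v assms(7) unfolding a0 by blast
  \<comment> \<open>The claim for fixed \<open>p\<close> and \<open>s\<close>, with the
    abbreviations of the goal unfolded so that the closing step can match it.\<close>
  have main: "\<exists>d. (\<forall>i\<in>{1..m}. degree (p i) = d) \<and>
      (\<forall>i\<in>{1..m}. p i = p 1 \<circ>\<^sub>p [:of_nat (i - 1), 1:]) \<and>
      (\<forall>i\<in>{1..<m}. s (i + 1) \<le> s i) \<and>
      ((prime CHAR('f) \<longrightarrow> m \<le> CHAR('f) \<and> {\<gamma>. p 1 \<circ>\<^sub>p [:\<gamma>, 1:] = p 1} = {0}) \<longrightarrow>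
        (1 \<in> {\<delta>. \<exists>u\<in>eigenspace_in \<aa> y \<delta>. \<exists>w. act u w \<noteq> 0} \<and> (\<forall>\<delta>\<in>{\<delta>. \<exists>u\<in>eigenspace_in \<aa> y \<delta>. \<exists>w. act u w \<noteq> 0}. \<exists>j<m. \<delta> = of_nat j)) \<and>
        (\<exists>bs. is_basis_list sU bs \<and>
          matrix_in_basis sU bs (act y) = matrix_A m p s \<and>
          (\<exists>v\<in>\<nn>. v \<noteq> 0 \<and> br y v = v \<and> matrix_in_basis sU bs (act v) = matrix_T (d) m p s \<and>
            (\<exists>g. (\<forall>j<m. linear_map_on sG Polynomial.smult (eigenspace_in \<aa> y (of_nat j)) (g j) \<and>
                  g j ` eigenspace_in \<aa> y (of_nat j) \<subseteq> polys_below (d * s (j + 1)) \<and>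
                  (\<forall>u\<in>eigenspace_in \<aa> y (of_nat j). matrix_in_basis sU bs (act u) = matrix_T (d) m p s ^\<^sub>m j * mat_poly (g j u) (matrix_E m p s))) \<and>
              g 1 v = 1 \<and>
              (\<exists>N. mat_direct_sum (d * (\<Sum>i = 1..m. s i)) m (\<lambda>j. {M * matrix_T (d) m p s ^\<^sub>m j |M. M \<in> {mat_poly (g j u) (matrix_E m p s) |u. u \<in> eigenspace_in \<aa> y (of_nat j)}}) N \<and>
                  mat_semidirect (d * (\<Sum>i = 1..m. s i)) (matrix_A m p s) N {matrix_in_basis sU bs (act z) |z. True})))) \<and>
        (uniserial \<longleftrightarrow> (\<forall>i\<in>{1..m}. s i = 1)) \<and>
        ((\<forall>i\<in>{1..m}. s i = 1) \<longrightarrow> semisimple_operator sU (act y) \<and>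
          (\<aa>0 = {0} \<or> d = 1 \<longrightarrow> semisimple_operator sU (act x))))"
    if data: "\<forall>i\<in>{1..m}. lead_coeff (p i) = 1 \<and> irreducible (p i) \<and>
      quotient_iso_cyclic sU (act y) (nil_series i) (nil_series (i - 1)) (p i ^ s i)"
    for p :: "nat \<Rightarrow> 'f poly" and s :: "nat \<Rightarrow> nat"
  proof -
    obtain e where tow: "tower sU (act y) (act v) nil_series m p s e"
      using factor_data_tower[OF y(1,3) v data] by blast
    interpret W: tower sU "act y" "act v" nil_series m p s e by (rule tow)
    have p1: "degree (p 1) > 0" "lead_coeff (p 1) = 1"
      using irreducible_degree_pos[OF W.p_irr] W.p_monic m1 by auto
    show ?thesis
    proof (rule exI[of _ "degree (p 1)"], intro conjI impI)
      show "\<forall>i\<in>{1..m}. degree (p i) = degree (p 1)" using W.degree_p by blast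
      show "\<forall>i\<in>{1..m}. p i = p 1 \<circ>\<^sub>p [:of_nat (i - 1), 1:]" using W.p_shift by blast
      show "\<forall>i\<in>{1..<m}. s (i + 1) \<le> s i" using W.p_s_Suc(2) by simp
    next
      assume hyp: "prime CHAR('f) \<longrightarrow> m \<le> CHAR('f) \<and> {\<gamma>. p 1 \<circ>\<^sub>p [:\<gamma>, 1:] = p 1} = {0}"
      \<comment> \<open>In characteristic zero both separation conditions are automatic; in prime
        characteristic they come from \<open>hyp\<close>.\<close>
      interpret separated_tower sU "act y" "act v" nil_series m p s e
      proof
        show "c = 0" if "p 1 \<circ>\<^sub>p [:c, 1:] = p 1" for c
          by (rule trivial_stabilizer[OF _ p1 that]) (use hyp in blast)
        show "i = j" if "i < m" "j < m" "of_nat i = (of_nat j :: 'f)" for i j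
          by (rule of_nat_inj_below_char[OF _ that]) (use hyp in blast)
      qed
      obtain g where g: "\<forall>i\<in>{1..m}. generates i (g i) \<and>
          (i > 1 \<longrightarrow> act v (g i) = poly_op sU (act y) (p (i - 1) ^ (s (i - 1) - s i)) (g (i - 1)))"
        using exists_generators by blast
      have gen: "gen_tower sU (act y) (act v) nil_series m p s e g"
        by unfold_locales (use g in auto)
      interpret D: adapted_module sG br sU act x \<aa> m y v p s e g
        by (rule adapted_module.intro[OF linked_semidirect_module_axioms], rule adapted_module_axioms.intro)
          (fact y(1) y(2) v(1) v(2) gen)+
      have deg: "degree (p 1) = D.T.deg" by (simp only: D.T.deg_def)
      have v0: "v \<noteq> 0" using D.act_v_nonzero by auto
      show "1 \<in> {\<delta>. \<exists>u\<in>eigenspace_in \<aa> y \<delta>. \<exists>w. act u w \<noteq> 0}"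
        "\<forall>\<delta>\<in>{\<delta>. \<exists>u\<in>eigenspace_in \<aa> y \<delta>. \<exists>w. act u w \<noteq> 0}. \<exists>j<m. \<delta> = of_nat j"
        by (fact D.weights)+
      show "uniserial \<longleftrightarrow> (\<forall>i\<in>{1..m}. s i = 1)" by (rule D.uniserial_iff)
      show "semisimple_operator sU (act y)" if "\<forall>i\<in>{1..m}. s i = 1"
        using that D.T.semisimple_Y by blast
      show "semisimple_operator sU (act x)" if "\<forall>i\<in>{1..m}. s i = 1" "\<aa>0 = {0} \<or> degree (p 1) = 1"
        using D.semisimple_x that unfolding deg a0 by blast
      let ?bs = D.T.blist and ?T = "matrix_T (degree (p 1)) m p s" and ?E = "matrix_E m p s"
      let ?t = "degree (p 1) * (\<Sum>i = 1..m. s i)" and ?a = "eigenspace_in \<aa> y"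
      have gp: "\<forall>j<m. linear_map_on sG Polynomial.smult (?a (of_nat j)) (D.gp j) \<and>
          D.gp j ` ?a (of_nat j) \<subseteq> polys_below (degree (p 1) * s (j + 1)) \<and>
          (\<forall>u\<in>?a (of_nat j). matrix_in_basis sU ?bs (act u) = ?T ^\<^sub>m j * mat_poly (D.gp j u) ?E)"
        using D.gp_linear D.gp_below D.gp_mx unfolding deg by blast
      have N: "mat_direct_sum ?t m (\<lambda>j. {M * ?T ^\<^sub>m j |M. M \<in> {mat_poly (D.gp j u) ?E |u. u \<in> ?a (of_nat j)}})
            {matrix_in_basis sU ?bs (act z) |z. z \<in> \<aa>}"
          "mat_semidirect ?t (matrix_A m p s) {matrix_in_basis sU ?bs (act z) |z. z \<in> \<aa>}
            {matrix_in_basis sU ?bs (act z) |z. True}"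
        using D.direct_sum D.semidirect_sum unfolding deg D.size_total by blast+
      show "\<exists>bs. is_basis_list sU bs \<and>
        matrix_in_basis sU bs (act y) = matrix_A m p s \<and>
        (\<exists>v\<in>\<nn>. v \<noteq> 0 \<and> br y v = v \<and> matrix_in_basis sU bs (act v) = ?T \<and>
          (\<exists>g. (\<forall>j<m. linear_map_on sG Polynomial.smult (?a (of_nat j)) (g j) \<and>
                g j ` ?a (of_nat j) \<subseteq> polys_below (degree (p 1) * s (j + 1)) \<and>
                (\<forall>u\<in>?a (of_nat j). matrix_in_basis sU bs (act u) = ?T ^\<^sub>m j * mat_poly (g j u) ?E)) \<and>
            g 1 v = 1 \<and>
            (\<exists>N. mat_direct_sum ?t m (\<lambda>j. {M * ?T ^\<^sub>m j |M. M \<in> {mat_poly (g j u) ?E |u. u \<in> ?a (of_nat j)}}) N \<and>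
                mat_semidirect ?t (matrix_A m p s) N {matrix_in_basis sU bs (act z) |z. True})))"
      proof (intro exI[of _ ?bs] exI[of _ D.gp] bexI[of _ v] conjI
          exI[of _ "{matrix_in_basis sU ?bs (act z) |z. z \<in> \<aa>}"])
        show "v \<in> \<nn>" unfolding n_def by (rule D.v_nil)
        show "matrix_in_basis sU ?bs (act v) = ?T" unfolding deg by (rule D.T.mx_V)
      qed (fact D.T.basis_blist D.T.mx_Y v0 v(2) gp D.gp_v N)+
    qed
  qed
  have "\<forall>i\<in>{1..m}. uniserial_quotient (nil_series i) (nil_series (i - 1)) (range (poly_op sU (act y)))"
  proof
    fix i assume i: "i \<in> {1..m}"
    then obtain k where k: "i = Suc k" "k < m" by (cases i) auto
    show "uniserial_quotient (nil_series i) (nil_series (i - 1)) (range (poly_op sU (act y)))"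
      using factor_uniserial[OF y(1) _ k(2)] y(3) k by (simp del: nil_series.simps)
  qed
  moreover have "y \<in> Modules.module.span sG (insert x \<aa>0) - \<aa>0"
    using y(1,2) unfolding Y0_def a0 by blast
  ultimately show ?thesis unfolding Let_def Us
    by (intro bexI[of _ y] conjI allI impI) (assumption | rule exists_factor_data[OF y(1,3)] | rule main)+
qed

end
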